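(* Let $N\ge 1$ be an integer, let $g_1,\ldots,g_N\in\mathbb{R}$ and $\sigma_1^2,\ldots,\sigma_N^2>0$, and let $X=(X_1,\ldots,X_N)$ be a system of $N$ competing Brownian particles with drift coefficients $g_1,\ldots,g_N$ and diffusion coefficients $\sigma_1^2,\ldots,\sigma_N^2$. Let $n\ge 4$ be an integer. If $$\max_{1\le k\le N}\sigma_k^2<\frac{n-1}{2}\min_{1\le k\le N}\sigma_k^2,$$ then there are no $n$-tuple collisions in this system.
   Context: Ranking permutation: for $x=(x_1,\ldots,x_N)\in\mathbb{R}^N$, $\mathbf{p}_x:\{1,\ldots,N\}\to\{1,\ldots,N\}$ is the unique bijection such that (a) $x_{\mathbf{p}_x(i)}\le x_{\mathbf{p}_x(j)}$ for $1\le i<j\le N$; (b) if $x_{\mathbf{p}_x(i)}=x_{\mathbf{p}_x(j)}$ for $1\le i<j\le N$, then $\mathbf{p}_x(i)<\mathbf{p}_x(j)$. System of competing Brownian particles: on a filtered probability space $(\Omega,\mathcal{F},(\mathcal{F}_t)_{t\ge 0},\mathbf{P})$ with the filtration satisfying the usual conditions, a system of $N$ competing Brownian particles with drift coefficients $g_1,\ldots,g_N\in\mathbb{R}$ and diffusion coefficients $\sigma_1^2,\ldots,\sigma_N^2>0$ is a continuous adapted $\mathbb{R}^N$-valued process $X=(X(t),t\ge 0)$, $X(t)=(X_1(t),\ldots,X_N(t))$, satisfying for $i=1,\ldots,N$ $$\mathrm{d}X_i(t)=\sum_{k=1}^N 1(\mathbf{p}_t(k)=i)\,(g_k\,\mathrm{d}t+\sigma_k\,\mathrm{d}W_i(t)),$$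 where $W=(W_1,\ldots,W_N)$ is an $N$-dimensional Brownian motion (with respect to the filtration), $1(\cdot)$ is the indicator function and $\mathbf{p}_t:=\mathbf{p}_{X(t)}$. The initial condition $X(0)$ is arbitrary. The ranked particles are $Y_k(t):=X_{\mathbf{p}_t(k)}(t)$, $k=1,\ldots,N$, so that $Y_1(t)\le\cdots\le Y_N(t)$. No collisions: there are no collisions of particles with ranks $k_-,\ldots,k_+\in\{1,\ldots,N\}$ if $\mathbf{P}(\exists\,t>0:\ Y_{k_-}(t)=\cdots=Y_{k_+}(t))=0$. There are no $n$-tuple collisions if there are no collisions of particles with ranks $k_-<\cdots<k_+$ for every pair $k_-,k_+\in\{1,\ldots,N\}$ with $k_+-k_-=n-1$; equivalently, if for every $n$-element subset $\{i_1,\ldots,i_n\}\subseteq\{1,\ldots,N\}$, $\mathbf{P}(\exists\,t>0:\ X_{i_1}(t)=\cdots=X_{i_n}(t))=0$. *)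

theory Defs
  imports "HOL-Probability.Probability" "HOL-Combinatorics.Permutations"
begin

text \<open>
  Vectors in \<open>\<real>\<^sup>N\<close> are functions \<open>nat \<Rightarrow> real\<close> of which only the components with index in
  \<open>{1..N}\<close> are used. Time is a \<^typ>\<open>real\<close>, and processes and filtrations are only constrained
  at times \<open>t \<ge> 0\<close>. Of each \<open>F t\<close> only the sigma-algebra matters.
\<close>

section \<open>Ranking permutation\<close>

definition is_ranking :: "nat \<Rightarrow> (nat \<Rightarrow> real) \<Rightarrow> (nat \<Rightarrow> nat) \<Rightarrow> bool" where
  "is_ranking N x p \<longleftrightarrow>
     p permutes {1..N} \<and>
     (\<forall>i j. 1 \<le> i \<and> i < j \<and> j \<le> N \<longrightarrow> x (p i) \<le> x (p j)) \<and>
     (\<forall>i j. 1 \<le> i \<and> i < j \<and> j \<le> N \<and> x (p i) = x (p j) \<longrightarrow> p i < p j)"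

definition ranking :: "nat \<Rightarrow> (nat \<Rightarrow> real) \<Rightarrow> nat \<Rightarrow> nat" where
  "ranking N x = (THE p. is_ranking N x p)"

lemma ex1_is_ranking: "\<exists>!p. is_ranking N x p"
proof -
  define lt where "lt i j \<longleftrightarrow> x i < x j \<or> x i = x j \<and> i < j" for i j :: nat
  define D where "D i = {j \<in> {1..N}. lt j i}" for i
  define r where "r i = (if i \<in> {1..N} then Suc (card (D i)) else i)" for i
  have fin: "finite (D i)" for i by (simp add: D_def)
  have rank_iff: "is_ranking N x p \<longleftrightarrow>
      p permutes {1..N} \<and> (\<forall>i j. 1 \<le> i \<and> i < j \<and> j \<le> N \<longrightarrow> lt (p i) (p j))" for p
  proof -
    have "lt a b \<longleftrightarrow> x a \<le> x b \<and> (x a = x b \<longrightarrow> a < b)" for a b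
      unfolding lt_def by auto
    then show ?thesis unfolding is_ranking_def by blast
  qed
  have r_mono: "r i < r j" if "i \<in> {1..N}" "j \<in> {1..N}" "lt i j" for i j
  proof -
    have "D i \<subset> D j" using that unfolding D_def lt_def by auto
    then show ?thesis using that psubset_card_mono[OF fin] by (simp add: r_def)
  qed
  have total: "lt i j \<or> lt j i" if "i \<noteq> j" for i j
    using that unfolding lt_def by auto
  have inj: "inj_on r {1..N}"
  proof (rule inj_onI, rule ccontr)
    fix i j assume "i \<in> {1..N}" "j \<in> {1..N}" "r i = r j" "i \<noteq> j"
    then show False using total[of i j] r_mono[of i j] r_mono[of j i] by auto
  qed
  have into: "r ` {1..N} \<subseteq> {1..N}"
  proof (rule image_subsetI)
    fix i assume i: "i \<in> {1..N}"
    have "D i \<subseteq> {1..N}" "i \<notin> D i" by (auto simp: D_def lt_def)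
    with i have "D i \<subset> {1..N}" by blast
    from psubset_card_mono[OF _ this] have "card (D i) < N" by simp
    then show "r i \<in> {1..N}" using i by (simp add: r_def)
  qed
  have "bij_betw r {1..N} {1..N}"
    using inj into by (simp add: bij_betw_def endo_inj_surj)
  then have perm: "r permutes {1..N}"
    by (rule bij_imp_permutes) (auto simp: r_def)
  have "is_ranking N x (inv r)"
    unfolding rank_iff
  proof (intro conjI allI impI)
    show pinv: "inv r permutes {1..N}" by (rule permutes_inv[OF perm])
    fix i j assume ij: "1 \<le> i \<and> i < j \<and> j \<le> N"
    then have mem: "inv r i \<in> {1..N}" "inv r j \<in> {1..N}"
      using permutes_in_image[OF pinv] by auto
    have rinv: "r (inv r i) = i" "r (inv r j) = j"
      using permutes_inverses(1)[OF perm] by auto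
    then have "inv r i \<noteq> inv r j" using ij by force
    moreover have "\<not> lt (inv r j) (inv r i)"
      using r_mono[OF mem(2,1)] rinv ij by auto
    ultimately show "lt (inv r i) (inv r j)" using total by blast
  qed
  moreover have "p = inv r" if p: "is_ranking N x p" for p
  proof -
    have pp: "p permutes {1..N}"
      and plt: "\<And>i j. 1 \<le> i \<Longrightarrow> i < j \<Longrightarrow> j \<le> N \<Longrightarrow> lt (p i) (p j)"
      using p unfolding rank_iff by auto
    have "r (p i) = i" for i
    proof (cases "i \<in> {1..N}")
      case True
      have asym: "\<not> lt a a" "lt a b \<Longrightarrow> \<not> lt b a" for a b unfolding lt_def by auto
      have "D (p i) = p ` {1..<i}"
      proof (intro equalityI subsetI)
        fix j assume j: "j \<in> D (p i)"
        then obtain k where k: "k \<in> {1..N}" "j = p k"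
          using permutes_image[OF pp] unfolding D_def by blast
        have "lt (p k) (p i)" using j k by (simp add: D_def)
        then have "k \<noteq> i" "\<not> i < k"
          using asym(1)[of "p i"] asym(2)[of "p k" "p i"] plt[of i k] True k by auto
        then have "k < i" by simp
        then show "j \<in> p ` {1..<i}" using k by auto
      next
        fix j assume "j \<in> p ` {1..<i}"
        then obtain k where k: "1 \<le> k" "k < i" "j = p k" by auto
        then have "k \<in> {1..N}" using True by auto
        then have "p k \<in> {1..N}" using permutes_in_image[OF pp] by blast
        then show "j \<in> D (p i)" using plt[of k i] k True by (auto simp: D_def)
      qed
      moreover have "card (p ` {1..<i}) = i - 1"
        using card_image[OF inj_on_subset[OF permutes_inj[OF pp] subset_UNIV]] by simp
      moreover have "p i \<in> {1..N}" using True permutes_in_image[OF pp] by blast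
      ultimately show ?thesis using True by (simp add: r_def)
    next
      case False
      then show ?thesis using permutes_not_in[OF pp] by (auto simp: r_def)
    qed
    then have "inv r (r (p i)) = inv r i" for i by simp
    then show ?thesis by (simp add: permutes_inverses(2)[OF perm] fun_eq_iff)
  qed
  ultimately show ?thesis by blast
qed

lemma is_ranking_ranking: "is_ranking N x (ranking N x)"
  unfolding ranking_def by (rule theI'[OF ex1_is_ranking])


section \<open>Filtrations and processes\<close>

text \<open>
  Filtered probability space satisfying the usual conditions: the filtration is right-continuous
  and \<open>F 0\<close> contains every subset of every null event of \<open>M\<close> (so \<open>M\<close> is complete, too).
\<close>

definition usual_filtration :: "'a measure \<Rightarrow> (real \<Rightarrow> 'a measure) \<Rightarrow> bool" where
  "usual_filtration M F \<longleftrightarrow>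
     prob_space M \<and>
     (\<forall>t\<ge>0. subalgebra M (F t)) \<and>
     (\<forall>s t. 0 \<le> s \<and> s \<le> t \<longrightarrow> sets (F s) \<subseteq> sets (F t)) \<and>
     (\<forall>t\<ge>0. sets (F t) = (\<Inter>u\<in>{t<..}. sets (F u))) \<and>
     (\<forall>A\<in>null_sets M. \<forall>B\<subseteq>A. B \<in> sets (F 0))"

definition continuous_adapted ::
    "'a measure \<Rightarrow> (real \<Rightarrow> 'a measure) \<Rightarrow> (real \<Rightarrow> 'a \<Rightarrow> real) \<Rightarrow> bool" where
  "continuous_adapted M F Z \<longleftrightarrow>
     (\<forall>t\<ge>0. Z t \<in> borel_measurable (F t)) \<and>
     (\<forall>\<omega>\<in>space M. continuous_on {0..} (\<lambda>t. Z t \<omega>))"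

definition progressively_measurable ::
    "(real \<Rightarrow> 'a measure) \<Rightarrow> (real \<Rightarrow> 'a \<Rightarrow> real) \<Rightarrow> bool" where
  "progressively_measurable F H \<longleftrightarrow>
     (\<forall>t\<ge>0. (\<lambda>(s, \<omega>). H s \<omega>) \<in> borel_measurable (restrict_space borel {0..t} \<Otimes>\<^sub>M F t))"

text \<open>
  \<open>N\<close>-dimensional Brownian motion \<open>(W 1, \<dots>, W N)\<close> with respect to the filtration \<open>F\<close>: the
  sigma-algebra generated by the increment vector over \<open>[s, t]\<close> is independent of \<open>F s\<close>, and
  the components of that vector are independent centred Gaussians with variance \<open>t - s\<close>.
\<close>

definition brownian_motion ::
    "'a measure \<Rightarrow> (real \<Rightarrow> 'a measure) \<Rightarrow> nat \<Rightarrow> (nat \<Rightarrow> real \<Rightarrow> 'a \<Rightarrow> real) \<Rightarrow> bool" where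
  "brownian_motion M F N W \<longleftrightarrow>
     (\<forall>i\<in>{1..N}. continuous_adapted M F (W i) \<and> (AE \<omega> in M. W i 0 \<omega> = 0)) \<and>
     (\<forall>s t. 0 \<le> s \<and> s < t \<longrightarrow>
        prob_space.indep_set M (sets (F s))
          (sets (vimage_algebra (space M) (\<lambda>\<omega>. \<lambda>i\<in>{1..N}. W i t \<omega> - W i s \<omega>)
                   (Pi\<^sub>M {1..N} (\<lambda>_. borel)))) \<and>
        prob_space.indep_vars M (\<lambda>_. borel) (\<lambda>i \<omega>. W i t \<omega> - W i s \<omega>) {1..N} \<and>
        (\<forall>i\<in>{1..N}. distributed M lborel (\<lambda>\<omega>. W i t \<omega> - W i s \<omega>)
                        (\<lambda>x. ennreal (normal_density 0 (sqrt (t - s)) x))))"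


section \<open>Ito integral\<close>

text \<open>
  A simple process is \<open>\<Sum>j<m. \<xi> j \<cdot> 1\<^bsub>(\<tau> j, \<tau> (j + 1)]\<^esub>\<close> with deterministic times
  \<open>0 \<le> \<tau> 0 \<le> \<dots> \<le> \<tau> m\<close> and bounded, \<open>F (\<tau> j)\<close>-measurable \<open>\<xi> j\<close>.
\<close>

definition simple_data ::
    "'a measure \<Rightarrow> (real \<Rightarrow> 'a measure) \<Rightarrow> nat \<Rightarrow> (nat \<Rightarrow> real) \<Rightarrow> (nat \<Rightarrow> 'a \<Rightarrow> real) \<Rightarrow> bool"
  where
  "simple_data M F m \<tau> \<xi> \<longleftrightarrow>
     0 \<le> \<tau> 0 \<and> (\<forall>j<m. \<tau> j \<le> \<tau> (Suc j)) \<and>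
     (\<forall>j<m. \<xi> j \<in> borel_measurable (F (\<tau> j))) \<and>
     (\<exists>C. \<forall>j<m. \<forall>\<omega>\<in>space M. \<bar>\<xi> j \<omega>\<bar> \<le> C)"

definition simple_proc ::
    "nat \<Rightarrow> (nat \<Rightarrow> real) \<Rightarrow> (nat \<Rightarrow> 'a \<Rightarrow> real) \<Rightarrow> real \<Rightarrow> 'a \<Rightarrow> real" where
  "simple_proc m \<tau> \<xi> s \<omega> = (\<Sum>j<m. \<xi> j \<omega> * indicator {\<tau> j<..\<tau> (Suc j)} s)"

definition simple_integral ::
    "(real \<Rightarrow> 'a \<Rightarrow> real) \<Rightarrow> nat \<Rightarrow> (nat \<Rightarrow> real) \<Rightarrow> (nat \<Rightarrow> 'a \<Rightarrow> real) \<Rightarrow> real \<Rightarrow> 'a \<Rightarrow> real"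
  where
  "simple_integral B m \<tau> \<xi> t \<omega> =
     (\<Sum>j<m. \<xi> j \<omega> * (B (min (\<tau> (Suc j)) t) \<omega> - B (min (\<tau> j) t) \<omega>))"

text \<open>
  \<open>I\<close> is a continuous version of \<open>t \<mapsto> \<integral>\<^sub>0\<^sup>t H dB\<close> for a Brownian motion \<open>B\<close> and a
  progressively measurable \<open>H\<close> with \<open>E (\<integral>\<^sub>0\<^sup>T H\<^sup>2 ds) < \<infinity>\<close> for all \<open>T\<close>: the
  \<open>L\<^sup>2\<close>-limit of the integrals of simple processes that approximate \<open>H\<close> in
  \<open>L\<^sup>2(ds \<Otimes> M)\<close> on every \<open>[0, T]\<close>. By the Ito isometry the limit does not depend on the
  approximating sequence. No localization is needed, since the integrands below are bounded.
\<close>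

definition ito_integral ::
    "'a measure \<Rightarrow> (real \<Rightarrow> 'a measure) \<Rightarrow> (real \<Rightarrow> 'a \<Rightarrow> real) \<Rightarrow>
     (real \<Rightarrow> 'a \<Rightarrow> real) \<Rightarrow> (real \<Rightarrow> 'a \<Rightarrow> real) \<Rightarrow> bool" where
  "ito_integral M F B H I \<longleftrightarrow>
     progressively_measurable F H \<and> continuous_adapted M F I \<and>
     (\<exists>m \<tau> \<xi>.
        (\<forall>n. simple_data M F (m n) (\<tau> n) (\<xi> n)) \<and>
        (\<forall>T\<ge>0. (\<lambda>n. \<integral>\<^sup>+ \<omega>. (\<integral>\<^sup>+ s\<in>{0..T}.
             ennreal ((simple_proc (m n) (\<tau> n) (\<xi> n) s \<omega> - H s \<omega>)\<^sup>2) \<partial>lborel) \<partial>M)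
           \<longlonglongrightarrow> 0) \<and>
        (\<forall>t\<ge>0. (\<lambda>n. \<integral>\<^sup>+ \<omega>.
             ennreal ((simple_integral B (m n) (\<tau> n) (\<xi> n) t \<omega> - I t \<omega>)\<^sup>2) \<partial>M)
           \<longlonglongrightarrow> 0))"


section \<open>Competing Brownian particles\<close>

definition rank_at :: "nat \<Rightarrow> (nat \<Rightarrow> real \<Rightarrow> 'a \<Rightarrow> real) \<Rightarrow> real \<Rightarrow> 'a \<Rightarrow> nat \<Rightarrow> nat" where
  "rank_at N X t \<omega> = ranking N (\<lambda>i. X i t \<omega>)"

definition ranked_particle ::
    "nat \<Rightarrow> (nat \<Rightarrow> real \<Rightarrow> 'a \<Rightarrow> real) \<Rightarrow> nat \<Rightarrow> real \<Rightarrow> 'a \<Rightarrow> real" where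
  "ranked_particle N X k t \<omega> = X (rank_at N X t \<omega> k) t \<omega>"

text \<open>
  The diffusion coefficients are the squares \<open>(\<sigma> k)\<^sup>2\<close>; the stochastic differential equation is
  understood in integrated form.
\<close>

definition competing_brownian_particles ::
    "'a measure \<Rightarrow> (real \<Rightarrow> 'a measure) \<Rightarrow> nat \<Rightarrow> (nat \<Rightarrow> real) \<Rightarrow> (nat \<Rightarrow> real) \<Rightarrow>
     (nat \<Rightarrow> real \<Rightarrow> 'a \<Rightarrow> real) \<Rightarrow> (nat \<Rightarrow> real \<Rightarrow> 'a \<Rightarrow> real) \<Rightarrow> bool" where
  "competing_brownian_particles M F N g \<sigma> W X \<longleftrightarrow>
     usual_filtration M F \<and>
     brownian_motion M F N W \<and>
     (\<forall>i\<in>{1..N}. continuous_adapted M F (X i)) \<and>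
     (\<forall>i\<in>{1..N}. \<exists>I.
        ito_integral M F (W i) (\<lambda>s \<omega>. \<Sum>k=1..N. of_bool (rank_at N X s \<omega> k = i) * \<sigma> k) I \<and>
        (AE \<omega> in M. \<forall>t\<ge>0. X i t \<omega> = X i 0 \<omega> +
           (LINT s:{0..t}|lborel. (\<Sum>k=1..N. of_bool (rank_at N X s \<omega> k = i) * g k)) + I t \<omega>))"

definition no_collisions_of_ranks ::
    "'a measure \<Rightarrow> nat \<Rightarrow> (nat \<Rightarrow> real \<Rightarrow> 'a \<Rightarrow> real) \<Rightarrow> nat \<Rightarrow> nat \<Rightarrow> bool" where
  "no_collisions_of_ranks M N X k l \<longleftrightarrow>
     {\<omega> \<in> space M. \<exists>t>0. \<forall>j\<in>{k..l}. ranked_particle N X j t \<omega> = ranked_particle N X k t \<omega>}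
       \<in> null_sets M"

definition no_tuple_collisions ::
    "'a measure \<Rightarrow> nat \<Rightarrow> (nat \<Rightarrow> real \<Rightarrow> 'a \<Rightarrow> real) \<Rightarrow> nat \<Rightarrow> bool" where
  "no_tuple_collisions M N X n \<longleftrightarrow>
     (\<forall>k\<in>{1..N}. \<forall>l\<in>{1..N}. k < l \<and> l - k = n - 1 \<longrightarrow> no_collisions_of_ranks M N X k l)"

end

theory Submission
  imports Defs
begin

text \<open>
  Let \<open>Z\<close> be the sum of the squared deviations of \<open>n\<close> given particles from their mean, let \<open>a\<close> and \<open>b\<close>
  be the minimum and the maximum of the \<open>\<sigma>\<^sub>k\<^sup>2\<close>, and consider \<open>u = t\<^sup>2 (\<eta> + Z)\<^sup>-\<^sup>p\<close> for \<open>\<eta> > 0\<close>. The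
  quadratic variation of \<open>Z\<close> grows at rate at most \<open>4 b Z\<close>, and its drift is at least \<open>(n - 1) a\<close> up to
  an error of order \<open>Z\<^sup>1\<^sup>/\<^sup>2\<close>. As \<open>2 b < (n - 1) a\<close>, for small \<open>p > 0\<close> the drift of \<open>u\<close> is at most a
  constant \<open>C\<close> which does not depend on \<open>\<eta>\<close>. So \<open>u - C t\<close> is a supermartingale; it starts at \<open>0\<close> for
  every initial configuration because of the factor \<open>t\<^sup>2\<close>. If \<open>Z\<close> vanishes at some time in \<open>[\<kappa>, T]\<close>, then
  \<open>u\<close> reaches \<open>\<kappa>\<^sup>2 \<eta>\<^sup>-\<^sup>p\<close>, and the maximal inequality bounds the probability of this event by a multiple
  of \<open>\<eta>\<^sup>p\<close>, which tends to \<open>0\<close> with \<open>\<eta>\<close>.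

  Ito's formula is replaced by a Taylor expansion over the steps of a grid whose mesh tends to \<open>0\<close>.
  This needs only the conditional moments of first, second and fourth order of the increments of the
  Ito integrals. The ranks enter only through the bounds on the coefficients.
\<close>

section \<open>Simple processes\<close>

text \<open>For equal volatilities and no drift, \<open>Z / \<sigma>^2\<close> is a squared Bessel
  process of dimension \<open>d = n - 1\<close>, which has the harmonic function
  \<open>z^(1 - d/2)\<close> off the origin. In general \<open>(n - 1) * a / b > 2\<close> takes the
  place of the dimension. The exponent \<open>p\<close> stays strictly below the critical value
  \<open>(n - 1) * a / (2 * b) - 1\<close>, so that a negative multiple of \<open>w^(-p-1)\<close>
  with \<open>w = \<eta> + Z\<close> is left over; this surplus absorbs both the drift of the
  particles and the derivative of \<open>t^2\<close>. Conditional moments given \<open>F s\<close>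
  are expressed by testing against bounded \<open>F s\<close>-measurable variables. Over a step of
  length \<open>\<epsilon>^2\<close> the Taylor remainder has to be of order
  \<open>\<epsilon>^3\<close>, and its cubic term is split into a square and a fourth power: this is
  where fourth moments are called for. The constant in front of \<open>\<epsilon>^3\<close> explodes
  as \<eta> tends to 0, which is harmless because the mesh tends to 0 first, for fixed
  \<eta>.\<close>

text \<open>Simple integrals are treated on intervals that contain no partition point in their interior,
  where they are multiples of an increment of the integrator. Since \<open>P\<close> is an arbitrary finite set, no
  common refinement of several partitions has to be constructed.\<close>

lemma interval_additive_induct:
  fixes P :: "real set" and Q :: "real \<Rightarrow> real \<Rightarrow> bool"
  assumes "finite P" "a \<le> s" "s < t"
    and free: "\<And>s t. a \<le> s \<Longrightarrow> s < t \<Longrightarrow> P \<inter> {s<..<t} = {} \<Longrightarrow> Q s t"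
    and step: "\<And>s r t. a \<le> s \<Longrightarrow> s < r \<Longrightarrow> r < t \<Longrightarrow> P \<inter> {r<..<t} = {} \<Longrightarrow> Q s r \<Longrightarrow> Q r t \<Longrightarrow> Q s t"
  shows "Q s t"
  using \<open>s < t\<close>
proof (induction "card (P \<inter> {s<..<t})" arbitrary: t rule: less_induct)
  case less
  show ?case
  proof (cases "P \<inter> {s<..<t} = {}")
    case True
    then show ?thesis using free less.prems \<open>a \<le> s\<close> by blast
  next
    case False
    define r where "r = Max (P \<inter> {s<..<t})"
    have fin: "finite (P \<inter> {s<..<t})" using \<open>finite P\<close> by simp
    have r: "r \<in> P \<inter> {s<..<t}" unfolding r_def using fin False by (rule Max_in)
    have max: "q \<le> r" if "q \<in> P \<inter> {s<..<t}" for q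
      unfolding r_def using fin that by (rule Max_ge)
    have e: "P \<inter> {r<..<t} = {}" using max r by force
    have "P \<inter> {s<..<r} \<subset> P \<inter> {s<..<t}" using r by auto
    then have "card (P \<inter> {s<..<r}) < card (P \<inter> {s<..<t})" using fin by (rule psubset_card_mono[rotated])
    then have "Q s r" using less.hyps r by simp
    moreover have "Q r t" using free[of r t] r e \<open>a \<le> s\<close> by simp
    ultimately show ?thesis using step[of s r t] r e \<open>a \<le> s\<close> by simp
  qed
qed

lemma simple_data_mono:
  assumes "simple_data M F m \<tau> \<xi>" "i \<le> j" "j \<le> m"
  shows "\<tau> i \<le> \<tau> j"
  using assms(2,3)
proof (induction j rule: dec_induct)
  case (step k)
  then have "\<tau> k \<le> \<tau> (Suc k)" using assms(1) by (simp add: simple_data_def)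
  with step show ?case by simp
qed simp

lemma simple_data_nonneg:
  assumes "simple_data M F m \<tau> \<xi>" "j \<le> m"
  shows "0 \<le> \<tau> j"
  using simple_data_mono[OF assms(1), of 0 j] assms by (simp add: simple_data_def)

text \<open>The left-open partition intervals are disjoint, so at most one coefficient is active at
  time \<open>s\<close>. Quantifying over \<open>\<xi>'\<close> inside the cases records that the
  active index depends on the times alone, and the same index then serves for transformed
  coefficients.\<close>

lemma simple_proc_cases:
  assumes "simple_data M F m \<tau> \<xi>"
  obtains "\<And>\<xi>' :: nat \<Rightarrow> 'a \<Rightarrow> real. \<And>\<omega>. simple_proc m \<tau> \<xi>' s \<omega> = 0"
  | j where "j < m" "\<tau> j < s" "s \<le> \<tau> (Suc j)"
    "\<And>\<xi>' :: nat \<Rightarrow> 'a \<Rightarrow> real. \<And>\<omega>. simple_proc m \<tau> \<xi>' s \<omega> = \<xi>' j \<omega>"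
proof (cases "\<exists>j<m. s \<in> {\<tau> j<..\<tau> (Suc j)}")
  case False
  then have "simple_proc m \<tau> \<xi>' s \<omega> = 0" for \<xi>' :: "nat \<Rightarrow> 'a \<Rightarrow> real" and \<omega>
    unfolding simple_proc_def by (intro sum.neutral) (auto simp: indicator_def)
  then show ?thesis using that by blast
next
  case True
  then obtain j where j: "j < m" "\<tau> j < s" "s \<le> \<tau> (Suc j)" by auto
  have "simple_proc m \<tau> \<xi>' s \<omega> = \<xi>' j \<omega>" for \<xi>' :: "nat \<Rightarrow> 'a \<Rightarrow> real" and \<omega>
  proof -
    have "s \<notin> {\<tau> i<..\<tau> (Suc i)}" if "i < m" "i \<noteq> j" for i
      using simple_data_mono[OF assms, of "Suc i" j] simple_data_mono[OF assms, of "Suc j" i] that j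
      by (cases "i < j") auto
    then have "simple_proc m \<tau> \<xi>' s \<omega> = (\<Sum>i<m. if i = j then \<xi>' j \<omega> else 0)"
      unfolding simple_proc_def using j by (intro sum.cong) auto
    then show ?thesis using j by simp
  qed
  then show ?thesis using that j by blast
qed

text \<open>A left-open partition interval with no endpoint strictly between \<open>s\<close> and
  \<open>t\<close> contains either all of \<open>(s, t]\<close> or none of it. This is why the
  common value is read off at the right endpoint.\<close>

lemma simple_proc_const:
  assumes "{s<..<t} \<inter> \<tau> ` {..m} = {}" "s < r" "r \<le> t"
  shows "simple_proc m \<tau> \<xi> r \<omega> = simple_proc m \<tau> \<xi> t \<omega>"
  unfolding simple_proc_def
proof (rule sum.cong)
  fix j assume "j \<in> {..<m}"
  then have "\<tau> j \<notin> {s<..<t}" "\<tau> (Suc j) \<notin> {s<..<t}" using assms(1) by auto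
  then show "\<xi> j \<omega> * indicator {\<tau> j<..\<tau> (Suc j)} r = \<xi> j \<omega> * indicator {\<tau> j<..\<tau> (Suc j)} t"
    using assms(2,3) by (auto simp: indicator_def)
qed simp

lemma simple_integral_diff:
  assumes "simple_data M F m \<tau> \<xi>" "{s<..<t} \<inter> \<tau> ` {..m} = {}" "s < t"
  shows "simple_integral B m \<tau> \<xi> t \<omega> - simple_integral B m \<tau> \<xi> s \<omega>
    = simple_proc m \<tau> \<xi> t \<omega> * (B t \<omega> - B s \<omega>)"
  unfolding simple_integral_def simple_proc_def sum_subtractf[symmetric] sum_distrib_right
proof (rule sum.cong)
  fix j assume "j \<in> {..<m}"
  then have "\<tau> j \<notin> {s<..<t}" "\<tau> (Suc j) \<notin> {s<..<t}" and "\<tau> j \<le> \<tau> (Suc j)"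
    using assms(1,2) by (auto simp: simple_data_def)
  then show "\<xi> j \<omega> * (B (min (\<tau> (Suc j)) t) \<omega> - B (min (\<tau> j) t) \<omega>) -
    \<xi> j \<omega> * (B (min (\<tau> (Suc j)) s) \<omega> - B (min (\<tau> j) s) \<omega>) =
    \<xi> j \<omega> * indicator {\<tau> j<..\<tau> (Suc j)} t * (B t \<omega> - B s \<omega>)"
    using assms(3) by (auto simp: indicator_def min_def algebra_simps)
qed simp

lemma simple_integral_0:
  assumes "simple_data M F m \<tau> \<xi>"
  shows "simple_integral B m \<tau> \<xi> 0 \<omega> = 0"
  unfolding simple_integral_def
proof (rule sum.neutral, rule ballI)
  fix j assume "j \<in> {..<m}"
  then have "0 \<le> \<tau> j" "0 \<le> \<tau> (Suc j)" using simple_data_nonneg[OF assms] by auto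
  then show "\<xi> j \<omega> * (B (min (\<tau> (Suc j)) 0) \<omega> - B (min (\<tau> j) 0) \<omega>) = 0"
    by (simp add: min_def)
qed

section \<open>Increments of Brownian motion\<close>

lemma integrable_mult_bdd:
  fixes f Y :: "'a \<Rightarrow> real"
  assumes "integrable M f" "Y \<in> borel_measurable M" "\<And>\<omega>. \<omega> \<in> space M \<Longrightarrow> \<bar>Y \<omega>\<bar> \<le> C"
  shows "integrable M (\<lambda>\<omega>. Y \<omega> * f \<omega>)"
proof (rule Bochner_Integration.integrable_bound)
  show "integrable M (\<lambda>\<omega>. C * f \<omega>)" using assms(1) by simp
  show "(\<lambda>\<omega>. Y \<omega> * f \<omega>) \<in> borel_measurable M" using assms(1,2) by auto
  show "AE \<omega> in M. norm (Y \<omega> * f \<omega>) \<le> norm (C * f \<omega>)"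
  proof (rule AE_I2)
    fix \<omega> assume "\<omega> \<in> space M"
    then have "\<bar>Y \<omega>\<bar> \<le> \<bar>C\<bar>" using assms(3)[of \<omega>] by linarith
    then show "norm (Y \<omega> * f \<omega>) \<le> norm (C * f \<omega>)"
      by (simp add: abs_mult mult_right_mono)
  qed
qed

lemma integrable_mult_of_squares:
  fixes f g :: "'a \<Rightarrow> real"
  assumes "f \<in> borel_measurable M" "g \<in> borel_measurable M"
    "integrable M (\<lambda>\<omega>. (f \<omega>)\<^sup>2)" "integrable M (\<lambda>\<omega>. (g \<omega>)\<^sup>2)"
  shows "integrable M (\<lambda>\<omega>. f \<omega> * g \<omega>)"
proof (rule Bochner_Integration.integrable_bound)
  show "integrable M (\<lambda>\<omega>. (f \<omega>)\<^sup>2 + (g \<omega>)\<^sup>2)" using assms by simp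
  show "(\<lambda>\<omega>. f \<omega> * g \<omega>) \<in> borel_measurable M" using assms by simp
  have "\<bar>a * b\<bar> \<le> a\<^sup>2 + b\<^sup>2" for a b :: real
  proof -
    have "0 \<le> (\<bar>a\<bar> - \<bar>b\<bar>)\<^sup>2" by simp
    then have "2 * \<bar>a * b\<bar> \<le> a\<^sup>2 + b\<^sup>2" by (simp add: power2_diff abs_mult)
    then show ?thesis by (smt (verit) zero_le_power2)
  qed
  then show "AE \<omega> in M. norm (f \<omega> * g \<omega>) \<le> norm ((f \<omega>)\<^sup>2 + (g \<omega>)\<^sup>2)" by simp
qed

lemma (in finite_measure) integrable_power_le_4:
  fixes f :: "'a \<Rightarrow> real"
  assumes "f \<in> borel_measurable M" "integrable M (\<lambda>\<omega>. (f \<omega>) ^ 4)" "k \<le> 4"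
  shows "integrable M (\<lambda>\<omega>. (f \<omega>) ^ k)"
proof (rule Bochner_Integration.integrable_bound)
  show "integrable M (\<lambda>\<omega>. 1 + (f \<omega>) ^ 4)" using assms by simp
  show "(\<lambda>\<omega>. (f \<omega>) ^ k) \<in> borel_measurable M" using assms by simp
  have "\<bar>x ^ k\<bar> \<le> 1 + x ^ 4" for x :: real
  proof (cases "\<bar>x\<bar> \<le> 1")
    case True
    then have "\<bar>x ^ k\<bar> \<le> 1" by (simp add: power_abs power_le_one)
    moreover have "0 \<le> x ^ 4" by simp
    ultimately show ?thesis by linarith
  next
    case False
    then have "\<bar>x\<bar> ^ k \<le> \<bar>x\<bar> ^ 4" using assms(3) by (intro power_increasing) auto
    then show ?thesis by (simp add: power_abs)
  qed
  then show "AE \<omega> in M. norm ((f \<omega>) ^ k) \<le> norm (1 + (f \<omega>) ^ 4)" by simp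
qed

lemma integrable_add_power4:
  fixes f g :: "'a \<Rightarrow> real"
  assumes "f \<in> borel_measurable M" "g \<in> borel_measurable M"
    "integrable M (\<lambda>\<omega>. (f \<omega>) ^ 4)" "integrable M (\<lambda>\<omega>. (g \<omega>) ^ 4)"
  shows "integrable M (\<lambda>\<omega>. (f \<omega> + g \<omega>) ^ 4)"
proof (rule Bochner_Integration.integrable_bound)
  show "integrable M (\<lambda>\<omega>. 8 * (f \<omega>) ^ 4 + 8 * (g \<omega>) ^ 4)" using assms by simp
  show "(\<lambda>\<omega>. (f \<omega> + g \<omega>) ^ 4) \<in> borel_measurable M" using assms by simp
  have "(a + b) ^ 4 \<le> 8 * a ^ 4 + 8 * b ^ 4" for a b :: real
  proof -
    have sq: "(x + y)\<^sup>2 \<le> 2 * x\<^sup>2 + 2 * y\<^sup>2" for x y :: real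
      using zero_le_power2[of "x - y"] by (simp add: power2_eq_square algebra_simps)
    have "(a + b) ^ 4 = ((a + b)\<^sup>2)\<^sup>2" by simp
    also have "\<dots> \<le> (2 * a\<^sup>2 + 2 * b\<^sup>2)\<^sup>2" by (rule power_mono[OF sq]) simp
    also have "\<dots> \<le> 2 * (2 * a\<^sup>2)\<^sup>2 + 2 * (2 * b\<^sup>2)\<^sup>2" by (rule sq)
    finally show ?thesis by (simp add: power_mult_distrib)
  qed
  then have "norm ((f \<omega> + g \<omega>) ^ 4) \<le> norm (8 * (f \<omega>) ^ 4 + 8 * (g \<omega>) ^ 4)" for \<omega>
    by (simp only: real_norm_def power_even_abs_numeral even_numeral abs_of_nonneg zero_le_power_eq_numeral simp_thms)
       (rule order_trans[OF _ abs_ge_self], simp)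
  then show "AE \<omega> in M. norm ((f \<omega> + g \<omega>) ^ 4) \<le> norm (8 * (f \<omega>) ^ 4 + 8 * (g \<omega>) ^ 4)"
    by (intro AE_I2)
qed

section \<open>Independence and Gaussian moments of the increments\<close>

locale brownian_filtration =
  fixes M :: "'a measure" and F :: "real \<Rightarrow> 'a measure" and N :: nat
    and W :: "nat \<Rightarrow> real \<Rightarrow> 'a \<Rightarrow> real"
  assumes usual: "usual_filtration M F" and brownian: "brownian_motion M F N W"
begin

sublocale prob_space M
  by (rule conjunct1[OF usual[unfolded usual_filtration_def]])

lemma filtration:
  "\<forall>t\<ge>0. subalgebra M (F t)"
  "\<forall>s t. 0 \<le> s \<and> s \<le> t \<longrightarrow> sets (F s) \<subseteq> sets (F t)"
  "\<forall>A\<in>null_sets M. \<forall>B\<subseteq>A. B \<in> sets (F 0)"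
  by (insert usual[unfolded usual_filtration_def], elim conjE, assumption)+

lemma space_F: "0 \<le> t \<Longrightarrow> space (F t) = space M"
  using filtration(1) by (simp add: subalgebra_def)

lemma sets_F: "0 \<le> t \<Longrightarrow> sets (F t) \<subseteq> sets M"
  using filtration(1) by (simp add: subalgebra_def)

lemma sets_F_mono: "0 \<le> s \<Longrightarrow> s \<le> t \<Longrightarrow> sets (F s) \<subseteq> sets (F t)"
  using filtration(2) by blast

lemma measurable_F_mono:
  assumes "f \<in> borel_measurable (F s)" "0 \<le> s" "s \<le> t"
  shows "f \<in> borel_measurable (F t)"
  using measurable_from_subalg[of "F t" "F s" f borel] assms sets_F_mono[of s t] space_F[of s] space_F[of t]
  by (simp add: subalgebra_def)

lemma measurable_F_M:
  assumes "f \<in> borel_measurable (F t)" "0 \<le> t"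
  shows "f \<in> borel_measurable M"
  using measurable_from_subalg[of M "F t" f borel] assms sets_F[of t] space_F[of t]
  by (simp add: subalgebra_def)

lemma W_measurable: "i \<in> {1..N} \<Longrightarrow> 0 \<le> t \<Longrightarrow> W i t \<in> borel_measurable (F t)"
  using brownian unfolding brownian_motion_def continuous_adapted_def by blast

lemma W_measurable_M: "i \<in> {1..N} \<Longrightarrow> 0 \<le> t \<Longrightarrow> W i t \<in> borel_measurable M"
  using W_measurable measurable_F_M by blast

text \<open>\<open>Y\<close> and \<open>g\<close> of the increment vector generate
  sub-sigma-algebras of the two independent ones. Using the vector of all components, and not a
  single component, makes products of two components available.\<close>

lemma indep_increment:
  fixes Y :: "'a \<Rightarrow> real" and g :: "(nat \<Rightarrow> real) \<Rightarrow> real"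
  assumes st: "0 \<le> s" "s < t" and Y: "Y \<in> borel_measurable (F s)"
    and g: "g \<in> borel_measurable (Pi\<^sub>M {1..N} (\<lambda>_. borel))"
  shows "indep_var borel Y borel (\<lambda>\<omega>. g (\<lambda>i\<in>{1..N}. W i t \<omega> - W i s \<omega>))"
proof -
  let ?V = "\<lambda>\<omega>. \<lambda>i\<in>{1..N}. W i t \<omega> - W i s \<omega>"
  let ?A = "vimage_algebra (space M) ?V (Pi\<^sub>M {1..N} (\<lambda>_. borel :: real measure))"
  have ind: "indep_set (sets (F s)) (sets ?A)"
    using brownian st unfolding brownian_motion_def by blast
  have V: "?V \<in> measurable M (Pi\<^sub>M {1..N} (\<lambda>_. borel))"
    using st W_measurable_M by (intro measurable_restrict) (auto intro!: borel_measurable_diff)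
  have gV: "(\<lambda>\<omega>. g (?V \<omega>)) \<in> borel_measurable M"
    using measurable_compose[OF V g] .
  have YM: "Y \<in> borel_measurable M" using Y st measurable_F_M by blast
  have "{Y -` A \<inter> space M |A. A \<in> sets borel} \<subseteq> sets (F s)"
    using measurable_sets[OF Y] unfolding space_F[OF st(1)] by blast
  then have "sigma_sets (space M) {Y -` A \<inter> space M |A. A \<in> sets borel} \<subseteq> sets (F s)"
    using sets.sigma_sets_subset[of _ "F s"] unfolding space_F[OF st(1)] by blast
  moreover have "sigma_sets (space M) {(\<lambda>\<omega>. g (?V \<omega>)) -` A \<inter> space M |A. A \<in> sets borel} \<subseteq> sets ?A"
  proof -
    have m: "(\<lambda>\<omega>. g (?V \<omega>)) \<in> borel_measurable ?A"
      using measurable_compose[OF measurable_vimage_algebra1 g] V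
      by (auto simp: measurable_def)
    have "{(\<lambda>\<omega>. g (?V \<omega>)) -` A \<inter> space M |A. A \<in> sets borel} \<subseteq> sets ?A"
      using measurable_sets[OF m] by auto
    then show ?thesis using sets.sigma_sets_subset[of _ ?A] by simp
  qed
  ultimately have "indep_set (sigma_sets (space M) {Y -` A \<inter> space M |A. A \<in> sets borel})
      (sigma_sets (space M) {(\<lambda>\<omega>. g (?V \<omega>)) -` A \<inter> space M |A. A \<in> sets borel})"
    using ind unfolding indep_sets2_eq by blast
  then show ?thesis unfolding indep_var_eq using YM gV by simp
qed

lemma increment_mult:
  fixes Y :: "'a \<Rightarrow> real" and g :: "(nat \<Rightarrow> real) \<Rightarrow> real"
  assumes st: "0 \<le> s" "s < t" and Y: "Y \<in> borel_measurable (F s)" "integrable M Y"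
    and g: "g \<in> borel_measurable (Pi\<^sub>M {1..N} (\<lambda>_. borel))"
    and int: "integrable M (\<lambda>\<omega>. g (\<lambda>i\<in>{1..N}. W i t \<omega> - W i s \<omega>))"
  shows "integrable M (\<lambda>\<omega>. Y \<omega> * g (\<lambda>i\<in>{1..N}. W i t \<omega> - W i s \<omega>))"
    "expectation (\<lambda>\<omega>. Y \<omega> * g (\<lambda>i\<in>{1..N}. W i t \<omega> - W i s \<omega>))
      = expectation Y * expectation (\<lambda>\<omega>. g (\<lambda>i\<in>{1..N}. W i t \<omega> - W i s \<omega>))"
  using indep_var_integrable[OF indep_increment[OF st Y(1) g] Y(2) int]
    indep_var_lebesgue_integral[OF indep_increment[OF st Y(1) g] Y(2) int] by auto

lemma increment_distributed:
  assumes "i \<in> {1..N}" "0 \<le> s" "s < t"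
  shows "distributed M lborel (\<lambda>\<omega>. W i t \<omega> - W i s \<omega>) (\<lambda>x. ennreal (normal_density 0 (sqrt (t - s)) x))"
  using brownian assms unfolding brownian_motion_def by blast

lemma increment_moments:
  assumes "i \<in> {1..N}" "0 \<le> s" "s < t"
  defines "D \<equiv> \<lambda>\<omega>. W i t \<omega> - W i s \<omega>"
  shows "integrable M (\<lambda>\<omega>. D \<omega> ^ k)" "expectation D = 0" "expectation (\<lambda>\<omega>. (D \<omega>)\<^sup>2) = t - s"
    "expectation (\<lambda>\<omega>. D \<omega> ^ 3) = 0" "expectation (\<lambda>\<omega>. D \<omega> ^ 4) = 3 * (t - s)\<^sup>2"
proof -
  have pos: "sqrt (t - s) > 0" using assms by simp
  have dist: "distributed M lborel D (\<lambda>x. ennreal (normal_density 0 (sqrt (t - s)) x))"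
    unfolding D_def using increment_distributed assms by blast
  have e: "expectation (\<lambda>\<omega>. D \<omega> ^ k) = (\<integral>x. normal_density 0 (sqrt (t - s)) x * x ^ k \<partial>lborel)" for k
    using distributed_integral[OF dist, of "\<lambda>x. x ^ k"] pos by (simp add: normal_density_nonneg)
  show "integrable M (\<lambda>\<omega>. D \<omega> ^ k)"
    using distributed_integrable[OF dist, of "\<lambda>x. x ^ k"] integrable_normal_moment[OF pos, of 0 k] pos
    by (simp add: normal_density_nonneg)
  show "expectation D = 0" using e[of 1] integral_normal_moment_odd[OF pos, of 0 0] by simp
  show "expectation (\<lambda>\<omega>. (D \<omega>)\<^sup>2) = t - s"
    using e[of 2] integral_normal_moment_even[OF pos, of 0 1] assms by (simp add: fact_numeral)
  show "expectation (\<lambda>\<omega>. D \<omega> ^ 3) = 0" using e[of 3] integral_normal_moment_odd[OF pos, of 0 1] by simp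
  \<comment> \<open>The factor 3 is \<open>4! / (2^2 * 2!)\<close>, the fourth moment of a standard
    Gaussian.\<close>
  show "expectation (\<lambda>\<omega>. D \<omega> ^ 4) = 3 * (t - s)\<^sup>2"
    using e[of 4] integral_normal_moment_even[OF pos, of 0 2] assms
    by (simp add: fact_numeral power2_eq_square)
qed

lemma increment_mult_power:
  fixes Y :: "'a \<Rightarrow> real"
  assumes i: "i \<in> {1..N}" and st: "0 \<le> s" "s < t" and Y: "Y \<in> borel_measurable (F s)" "integrable M Y"
  shows "integrable M (\<lambda>\<omega>. Y \<omega> * (W i t \<omega> - W i s \<omega>) ^ k)"
    "expectation (\<lambda>\<omega>. Y \<omega> * (W i t \<omega> - W i s \<omega>) ^ k)
      = expectation Y * expectation (\<lambda>\<omega>. (W i t \<omega> - W i s \<omega>) ^ k)"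
proof -
  have g: "(\<lambda>v. v i ^ k) \<in> borel_measurable (Pi\<^sub>M {1..N} (\<lambda>_. borel :: real measure))"
    using i by (intro borel_measurable_power measurable_component_singleton)
  show "integrable M (\<lambda>\<omega>. Y \<omega> * (W i t \<omega> - W i s \<omega>) ^ k)"
    "expectation (\<lambda>\<omega>. Y \<omega> * (W i t \<omega> - W i s \<omega>) ^ k)
      = expectation Y * expectation (\<lambda>\<omega>. (W i t \<omega> - W i s \<omega>) ^ k)"
    using increment_mult[OF st Y g] increment_moments(1)[OF i st, of k] i by auto
qed

text \<open>Two independences act here: the pair of increments is independent of \<open>F s\<close>,
  which splits off \<open>Y\<close>, and the two components are independent of each other and
  centred.\<close>

lemma increment_mult_cross:
  fixes Y :: "'a \<Rightarrow> real"
  assumes i: "i \<in> {1..N}" and j: "j \<in> {1..N}" and "i \<noteq> j" and st: "0 \<le> s" "s < t"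
    and Y: "Y \<in> borel_measurable (F s)" "integrable M Y"
  shows "expectation (\<lambda>\<omega>. Y \<omega> * ((W i t \<omega> - W i s \<omega>) * (W j t \<omega> - W j s \<omega>))) = 0"
proof -
  have g: "(\<lambda>v. v i * v j) \<in> borel_measurable (Pi\<^sub>M {1..N} (\<lambda>_. borel :: real measure))"
    using i j by (intro borel_measurable_times measurable_component_singleton)
  have "indep_vars (\<lambda>_. borel) (\<lambda>i \<omega>. W i t \<omega> - W i s \<omega>) {1..N}"
    using brownian st unfolding brownian_motion_def by blast
  then have ind: "indep_vars (\<lambda>_. borel) (\<lambda>i \<omega>. W i t \<omega> - W i s \<omega>) {i, j}"
    by (rule indep_vars_subset) (use i j in auto)
  have int: "integrable M (\<lambda>\<omega>. W l t \<omega> - W l s \<omega>)" if "l \<in> {i, j}" for l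
    using increment_moments(1)[OF i st, of 1] increment_moments(1)[OF j st, of 1] that by auto
  have "integrable M (\<lambda>\<omega>. (W i t \<omega> - W i s \<omega>) * (W j t \<omega> - W j s \<omega>))"
    "expectation (\<lambda>\<omega>. (W i t \<omega> - W i s \<omega>) * (W j t \<omega> - W j s \<omega>)) = 0"
    using indep_vars_integrable[OF _ ind int] indep_vars_lebesgue_integral[OF _ ind int]
      increment_moments(2)[OF i st] \<open>i \<noteq> j\<close> by auto
  then show ?thesis using increment_mult(2)[OF st Y g] i j by auto
qed

end

section \<open>Moments of simple integrals\<close>

context brownian_filtration
begin

text \<open>Test variables: an equation or inequality weighted by every such \<open>Y\<close>
  replaces a conditional expectation given \<open>F s\<close>. Boundedness keeps all products with
  increments integrable.\<close>

definition bounded_F :: "real \<Rightarrow> ('a \<Rightarrow> real) \<Rightarrow> bool" where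
  "bounded_F s Y \<longleftrightarrow> Y \<in> borel_measurable (F s) \<and> (\<exists>C. \<forall>\<omega>\<in>space M. \<bar>Y \<omega>\<bar> \<le> C)"

lemma bounded_F_measurable: "bounded_F s Y \<Longrightarrow> Y \<in> borel_measurable (F s)"
  by (simp add: bounded_F_def)

lemma bounded_F_mono: "bounded_F s Y \<Longrightarrow> 0 \<le> s \<Longrightarrow> s \<le> t \<Longrightarrow> bounded_F t Y"
  using measurable_F_mono unfolding bounded_F_def by blast

lemma bounded_F_const: "bounded_F s (\<lambda>_. c)"
  by (auto simp: bounded_F_def)

lemma bounded_F_mult:
  assumes "bounded_F s Y" "bounded_F s Z"
  shows "bounded_F s (\<lambda>\<omega>. Y \<omega> * Z \<omega>)"
proof -
  obtain C D where CD: "\<And>\<omega>. \<omega> \<in> space M \<Longrightarrow> \<bar>Y \<omega>\<bar> \<le> C" "\<And>\<omega>. \<omega> \<in> space M \<Longrightarrow> \<bar>Z \<omega>\<bar> \<le> D"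
    using assms unfolding bounded_F_def by blast
  have "\<bar>Y \<omega> * Z \<omega>\<bar> \<le> C * D" if "\<omega> \<in> space M" for \<omega>
    unfolding abs_mult using CD[OF that] by (intro mult_mono) auto
  then show ?thesis using assms unfolding bounded_F_def by (auto intro!: borel_measurable_times)
qed

lemma bounded_F_power:
  assumes "bounded_F s Y"
  shows "bounded_F s (\<lambda>\<omega>. Y \<omega> ^ k)"
  by (induction k) (auto intro: bounded_F_const bounded_F_mult assms)

lemma bounded_F_integrable_mult:
  assumes "bounded_F s Y" "0 \<le> s" "integrable M f"
  shows "integrable M (\<lambda>\<omega>. Y \<omega> * f \<omega>)"
proof -
  obtain C where "\<And>\<omega>. \<omega> \<in> space M \<Longrightarrow> \<bar>Y \<omega>\<bar> \<le> C"
    using assms(1) unfolding bounded_F_def by blast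
  then show ?thesis
    using integrable_mult_bdd[OF assms(3) measurable_F_M[OF bounded_F_measurable[OF assms(1)] assms(2)]] by blast
qed

lemma bounded_F_integrable: "bounded_F s Y \<Longrightarrow> 0 \<le> s \<Longrightarrow> integrable M Y"
  using bounded_F_integrable_mult[of s Y "\<lambda>_. 1"] by simp

text \<open>The coefficient active at \<open>t\<close> starts at some \<open>\<tau> j < t\<close>,
  and \<open>\<tau> j\<close> does not lie strictly between \<open>s\<close> and \<open>t\<close>,
  so \<open>\<tau> j \<le> s\<close>. The value at the right endpoint is therefore already known at
  time \<open>s\<close>.\<close>

lemma simple_proc_bounded_F:
  assumes sd: "simple_data M F m \<tau> \<xi>" and st: "0 \<le> s" "s < t" "\<tau> ` {..m} \<inter> {s<..<t} = {}"
  shows "bounded_F s (simple_proc m \<tau> \<xi> t)"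
proof (rule simple_proc_cases[OF sd, of t])
  assume "\<And>\<xi>' :: nat \<Rightarrow> 'a \<Rightarrow> real. \<And>\<omega>. simple_proc m \<tau> \<xi>' t \<omega> = 0"
  then have "simple_proc m \<tau> \<xi> t = (\<lambda>_. 0)" by auto
  then show ?thesis using bounded_F_const by simp
next
  fix j assume j: "j < m" "\<tau> j < t" "t \<le> \<tau> (Suc j)"
    and eq: "\<And>\<xi>' :: nat \<Rightarrow> 'a \<Rightarrow> real. \<And>\<omega>. simple_proc m \<tau> \<xi>' t \<omega> = \<xi>' j \<omega>"
  have e: "simple_proc m \<tau> \<xi> t = \<xi> j" using eq by auto
  have "\<tau> j \<in> \<tau> ` {..m}" using j(1) by simp
  then have "\<tau> j \<notin> {s<..<t}" using st(3) by blast
  then have "\<tau> j \<le> s" using j(2) by simp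
  moreover have "bounded_F (\<tau> j) (\<xi> j)"
    using sd j(1) unfolding simple_data_def bounded_F_def by blast
  ultimately show ?thesis
    unfolding e using bounded_F_mono simple_data_nonneg[OF sd, of j] j(1) by simp
qed

lemma simple_integral_increment_measurable:
  assumes i: "i \<in> {1..N}" and sd: "simple_data M F m \<tau> \<xi>" and st: "0 \<le> s" "s < t"
  shows "(\<lambda>\<omega>. simple_integral (W i) m \<tau> \<xi> t \<omega> - simple_integral (W i) m \<tau> \<xi> s \<omega>) \<in> borel_measurable (F t)"
proof (rule interval_additive_induct[OF _ st(1) st(2), of "\<tau> ` {..m}"])
  fix s t :: real assume st: "0 \<le> s" "s < t" and e: "\<tau> ` {..m} \<inter> {s<..<t} = {}"
  have "simple_proc m \<tau> \<xi> t \<in> borel_measurable (F t)"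
    using simple_proc_bounded_F[OF sd st e] bounded_F_mono[of s _ t] st bounded_F_measurable by auto
  moreover have "W i s \<in> borel_measurable (F t)" "W i t \<in> borel_measurable (F t)"
    using measurable_F_mono[OF W_measurable[OF i st(1)] st(1), of t] W_measurable[OF i, of t] st by auto
  ultimately show "(\<lambda>\<omega>. simple_integral (W i) m \<tau> \<xi> t \<omega> - simple_integral (W i) m \<tau> \<xi> s \<omega>) \<in> borel_measurable (F t)"
    using simple_integral_diff[OF sd _ st(2), of "W i"] e by (simp add: Int_commute)
next
  fix s r t :: real
  let ?J = "simple_integral (W i) m \<tau> \<xi>"
  assume *: "0 \<le> s" "s < r" "r < t"
    "(\<lambda>\<omega>. ?J r \<omega> - ?J s \<omega>) \<in> borel_measurable (F r)" "(\<lambda>\<omega>. ?J t \<omega> - ?J r \<omega>) \<in> borel_measurable (F t)"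
  then have "(\<lambda>\<omega>. ?J r \<omega> - ?J s \<omega>) \<in> borel_measurable (F t)" using measurable_F_mono[of _ r t] by simp
  from borel_measurable_add[OF this *(5)]
  show "(\<lambda>\<omega>. ?J t \<omega> - ?J s \<omega>) \<in> borel_measurable (F t)" by simp
qed simp

lemma simple_integral_measurable:
  assumes "i \<in> {1..N}" "simple_data M F m \<tau> \<xi>" "0 \<le> t"
  shows "simple_integral (W i) m \<tau> \<xi> t \<in> borel_measurable (F t)"
proof (cases "t = 0")
  case True
  then have "simple_integral (W i) m \<tau> \<xi> t = (\<lambda>_. 0)" using simple_integral_0[OF assms(2)] by auto
  then show ?thesis by simp
next
  case False
  then show ?thesis
    using simple_integral_increment_measurable[OF assms(1,2), of 0 t] assms(3) simple_integral_0[OF assms(2)]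
    by simp
qed

section \<open>Martingale property, isometry and fourth moment of one simple integral\<close>

context
  fixes i m :: nat and \<tau> :: "nat \<Rightarrow> real" and \<xi> :: "nat \<Rightarrow> 'a \<Rightarrow> real"
    and h J :: "real \<Rightarrow> 'a \<Rightarrow> real"
  assumes i: "i \<in> {1..N}" and sd: "simple_data M F m \<tau> \<xi>"
    and h: "h = simple_proc m \<tau> \<xi>" and J: "J = simple_integral (W i) m \<tau> \<xi>"
begin

lemma J_local:
  assumes "s < t" "\<tau> ` {..m} \<inter> {s<..<t} = {}"
  shows "J t \<omega> - J s \<omega> = h t \<omega> * (W i t \<omega> - W i s \<omega>)"
  using simple_integral_diff[OF sd, of s t "W i"] assms unfolding h J by (simp add: Int_commute)

lemma h_local:
  assumes "0 \<le> s" "s < t" "\<tau> ` {..m} \<inter> {s<..<t} = {}"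
  shows "bounded_F s (h t)"
  unfolding h using simple_proc_bounded_F[OF sd] assms by blast

lemma J_increment_measurable: "0 \<le> s \<Longrightarrow> s < t \<Longrightarrow> (\<lambda>\<omega>. J t \<omega> - J s \<omega>) \<in> borel_measurable (F t)"
  unfolding J using simple_integral_increment_measurable[OF i sd] by blast

lemma J_increment_measurable_M: "0 \<le> s \<Longrightarrow> s < t \<Longrightarrow> (\<lambda>\<omega>. J t \<omega> - J s \<omega>) \<in> borel_measurable M"
  using measurable_F_M[OF J_increment_measurable] by simp

lemma J_increment_power4:
  assumes st: "0 \<le> s" "s < t"
  shows "integrable M (\<lambda>\<omega>. (J t \<omega> - J s \<omega>) ^ 4)"
proof (rule interval_additive_induct[OF _ st(1) st(2), of "\<tau> ` {..m}"])
  fix s t :: real assume st: "0 \<le> s" "s < t" and e: "\<tau> ` {..m} \<inter> {s<..<t} = {}"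
  show "integrable M (\<lambda>\<omega>. (J t \<omega> - J s \<omega>) ^ 4)"
    unfolding J_local[OF st(2) e] power_mult_distrib
    by (rule bounded_F_integrable_mult[OF bounded_F_power[OF h_local[OF st e]] st(1) increment_moments(1)[OF i st]])
next
  fix s r t :: real
  assume *: "0 \<le> s" "s < r" "r < t"
    "integrable M (\<lambda>\<omega>. (J r \<omega> - J s \<omega>) ^ 4)" "integrable M (\<lambda>\<omega>. (J t \<omega> - J r \<omega>) ^ 4)"
  show "integrable M (\<lambda>\<omega>. (J t \<omega> - J s \<omega>) ^ 4)"
    using integrable_add_power4[OF J_increment_measurable_M J_increment_measurable_M *(4,5)] * by simp
qed simp

lemma J_increment_power: "0 \<le> s \<Longrightarrow> s < t \<Longrightarrow> k \<le> 4 \<Longrightarrow> integrable M (\<lambda>\<omega>. (J t \<omega> - J s \<omega>) ^ k)"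
  using integrable_power_le_4[OF J_increment_measurable_M J_increment_power4] by blast

text \<open>On a piece free of partition points \<open>h t * Y\<close> is
  \<open>F s\<close>-measurable and the Brownian increment is centred and independent of it.
  \<open>Y\<close> is merely integrable so that the product of a test variable with an earlier
  increment, which is unbounded, can be inserted later.\<close>

lemma J_martingale:
  assumes st: "0 \<le> s" "s < t" and Y: "Y \<in> borel_measurable (F s)" "integrable M Y"
  shows "integrable M (\<lambda>\<omega>. Y \<omega> * (J t \<omega> - J s \<omega>)) \<and> expectation (\<lambda>\<omega>. Y \<omega> * (J t \<omega> - J s \<omega>)) = 0"
proof -
  have "\<forall>Y. Y \<in> borel_measurable (F s) \<and> integrable M Y \<longrightarrow>
    integrable M (\<lambda>\<omega>. Y \<omega> * (J t \<omega> - J s \<omega>)) \<and> expectation (\<lambda>\<omega>. Y \<omega> * (J t \<omega> - J s \<omega>)) = 0"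
    (is "?Q s t")
  proof (rule interval_additive_induct[of "\<tau> ` {..m}" 0 s t ?Q, OF _ st], simp, intro allI impI)
    fix s t :: real and Y :: "'a \<Rightarrow> real"
    assume st: "0 \<le> s" "s < t" and e: "\<tau> ` {..m} \<inter> {s<..<t} = {}"
      and Y: "Y \<in> borel_measurable (F s) \<and> integrable M Y"
    have "integrable M (\<lambda>\<omega>. h t \<omega> * Y \<omega>)"
      using bounded_F_integrable_mult[OF h_local[OF st e] st(1)] Y by blast
    moreover have "(\<lambda>\<omega>. h t \<omega> * Y \<omega>) \<in> borel_measurable (F s)"
      using bounded_F_measurable[OF h_local[OF st e]] Y by (intro borel_measurable_times) auto
    ultimately have p: "integrable M (\<lambda>\<omega>. h t \<omega> * Y \<omega> * (W i t \<omega> - W i s \<omega>) ^ 1)"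
      "expectation (\<lambda>\<omega>. h t \<omega> * Y \<omega> * (W i t \<omega> - W i s \<omega>) ^ 1) = 0"
      using increment_mult_power[OF i st, of "\<lambda>\<omega>. h t \<omega> * Y \<omega>" 1] increment_moments(2)[OF i st] by simp_all
    have eq: "(\<lambda>\<omega>. Y \<omega> * (J t \<omega> - J s \<omega>)) = (\<lambda>\<omega>. h t \<omega> * Y \<omega> * (W i t \<omega> - W i s \<omega>) ^ 1)"
      by (simp add: J_local[OF st(2) e] mult_ac)
    show "integrable M (\<lambda>\<omega>. Y \<omega> * (J t \<omega> - J s \<omega>)) \<and> expectation (\<lambda>\<omega>. Y \<omega> * (J t \<omega> - J s \<omega>)) = 0"
      unfolding eq by (intro conjI p)
  next
    fix s r t :: real
    assume *: "0 \<le> s" "s < r" "r < t" and IH1: "?Q s r" and IH2: "?Q r t"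
    show "?Q s t"
    proof (intro allI impI)
      fix Y :: "'a \<Rightarrow> real" assume Y: "Y \<in> borel_measurable (F s) \<and> integrable M Y"
      have Yr: "Y \<in> borel_measurable (F r)" using measurable_F_mono[OF conjunct1[OF Y] *(1)] *(2) by simp
      have 1: "integrable M (\<lambda>\<omega>. Y \<omega> * (J r \<omega> - J s \<omega>))" "integrable M (\<lambda>\<omega>. Y \<omega> * (J t \<omega> - J r \<omega>))"
        "expectation (\<lambda>\<omega>. Y \<omega> * (J r \<omega> - J s \<omega>)) = 0" "expectation (\<lambda>\<omega>. Y \<omega> * (J t \<omega> - J r \<omega>)) = 0"
        using IH1[rule_format, OF Y] IH2[rule_format, OF conjI[OF Yr conjunct2[OF Y]]] by auto
      have "(\<lambda>\<omega>. Y \<omega> * (J t \<omega> - J s \<omega>)) = (\<lambda>\<omega>. Y \<omega> * (J r \<omega> - J s \<omega>) + Y \<omega> * (J t \<omega> - J r \<omega>))"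
        by (simp add: algebra_simps)
      then show "integrable M (\<lambda>\<omega>. Y \<omega> * (J t \<omega> - J s \<omega>)) \<and> expectation (\<lambda>\<omega>. Y \<omega> * (J t \<omega> - J s \<omega>)) = 0"
        using 1 by simp
    qed
  qed
  then show ?thesis using Y by blast
qed

lemma h_sq_integral_measurable:
  "(\<lambda>\<omega>. \<integral>\<^sup>+ r. ennreal ((h r \<omega>)\<^sup>2) * indicator {s<..t} r \<partial>lborel) \<in> borel_measurable M"
proof -
  have \<xi>: "\<xi> j \<in> borel_measurable M" if "j \<in> {..<m}" for j
  proof -
    have "\<xi> j \<in> borel_measurable (F (\<tau> j))" using sd that unfolding simple_data_def by blast
    then show ?thesis by (rule measurable_F_M) (use simple_data_nonneg[OF sd, of j] that in simp)
  qed
  have hm: "(\<lambda>x. h (snd x) (fst x)) \<in> borel_measurable (M \<Otimes>\<^sub>M lborel)"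
    unfolding h simple_proc_def
    by (intro borel_measurable_sum borel_measurable_times measurable_compose[OF measurable_fst \<xi>]
        measurable_compose[OF measurable_snd borel_measurable_indicator]) auto
  have "(\<lambda>x. ennreal ((h (snd x) (fst x))\<^sup>2) * indicator {s<..t} (snd x)) \<in> borel_measurable (M \<Otimes>\<^sub>M lborel)"
    by (intro borel_measurable_times_ennreal measurable_compose[OF _ measurable_ennreal] borel_measurable_power hm
        measurable_compose[OF measurable_snd borel_measurable_indicator]) auto
  from this[folded split_beta'[where f = "\<lambda>\<omega> r. ennreal ((h r \<omega>)\<^sup>2) * indicator {s<..t} r"]]
  show ?thesis
    by (rule lborel.borel_measurable_nn_integral[where f = "\<lambda>\<omega> r. ennreal ((h r \<omega>)\<^sup>2) * indicator {s<..t} r"])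
qed

text \<open>The conditional Ito isometry, with \<open>Y\<close> as weight. Where two intervals meet,
  the cross term is a later increment times an \<open>F r\<close>-measurable factor and vanishes by
  \<open>J_martingale\<close>, so only the two squares remain.\<close>

lemma J_isometry:
  assumes st: "0 \<le> s" "s < t" and Y: "bounded_F s Y" "\<And>\<omega>. \<omega> \<in> space M \<Longrightarrow> 0 \<le> Y \<omega>"
  shows "ennreal (expectation (\<lambda>\<omega>. Y \<omega> * (J t \<omega> - J s \<omega>)\<^sup>2))
    = (\<integral>\<^sup>+\<omega>. ennreal (Y \<omega>) * (\<integral>\<^sup>+r. ennreal ((h r \<omega>)\<^sup>2) * indicator {s<..t} r \<partial>lborel) \<partial>M)"
proof -
  have "\<forall>Y. bounded_F s Y \<and> (\<forall>\<omega>\<in>space M. 0 \<le> Y \<omega>) \<longrightarrow>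
    ennreal (expectation (\<lambda>\<omega>. Y \<omega> * (J t \<omega> - J s \<omega>)\<^sup>2))
    = (\<integral>\<^sup>+\<omega>. ennreal (Y \<omega>) * (\<integral>\<^sup>+r. ennreal ((h r \<omega>)\<^sup>2) * indicator {s<..t} r \<partial>lborel) \<partial>M)"
    (is "?Q s t")
  proof (rule interval_additive_induct[of "\<tau> ` {..m}" 0 s t ?Q, OF _ st], simp, intro allI impI)
    fix s t :: real and Y :: "'a \<Rightarrow> real"
    assume st: "0 \<le> s" "s < t" and e: "\<tau> ` {..m} \<inter> {s<..<t} = {}"
      and Y: "bounded_F s Y \<and> (\<forall>\<omega>\<in>space M. 0 \<le> Y \<omega>)"
    have inner: "(\<integral>\<^sup>+r. ennreal ((h r \<omega>)\<^sup>2) * indicator {s<..t} r \<partial>lborel) = ennreal ((h t \<omega>)\<^sup>2 * (t - s))" for \<omega>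
    proof -
      have c: "h r \<omega> = h t \<omega>" if "r \<in> {s<..t}" for r
        unfolding h by (rule simple_proc_const[of s t \<tau> m]) (use e that in \<open>auto simp: Int_commute\<close>)
      have "(\<integral>\<^sup>+r. ennreal ((h r \<omega>)\<^sup>2) * indicator {s<..t} r \<partial>lborel)
        = (\<integral>\<^sup>+r. ennreal ((h t \<omega>)\<^sup>2) * indicator {s<..t} r \<partial>lborel)"
      proof (rule nn_integral_cong)
        fix r show "ennreal ((h r \<omega>)\<^sup>2) * indicator {s<..t} r = ennreal ((h t \<omega>)\<^sup>2) * indicator {s<..t} r"
        proof (cases "r \<in> {s<..t}")
          case True
          then show ?thesis by (simp only: c[OF True])
        next
          case False
          then show ?thesis by (simp only: indicator_simps(2)[OF False] mult_zero_right)
        qed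
      qed
      then show ?thesis using st by (simp add: nn_integral_cmult_indicator ennreal_mult')
    qed
    have b: "bounded_F s (\<lambda>\<omega>. Y \<omega> * (h t \<omega>)\<^sup>2)"
      using Y bounded_F_mult[OF _ bounded_F_power[OF h_local[OF st e]]] by blast
    have "expectation (\<lambda>\<omega>. Y \<omega> * (J t \<omega> - J s \<omega>)\<^sup>2) = expectation (\<lambda>\<omega>. Y \<omega> * (h t \<omega>)\<^sup>2) * (t - s)"
      using increment_mult_power(2)[OF i st bounded_F_measurable[OF b] bounded_F_integrable[OF b st(1)], of 2]
        increment_moments(3)[OF i st]
      unfolding J_local[OF st(2) e] by (simp add: power_mult_distrib mult_ac)
    also have "\<dots> = expectation (\<lambda>\<omega>. Y \<omega> * ((h t \<omega>)\<^sup>2 * (t - s)))" by (simp add: mult.assoc[symmetric])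
    also have "ennreal \<dots> = (\<integral>\<^sup>+\<omega>. ennreal (Y \<omega> * ((h t \<omega>)\<^sup>2 * (t - s))) \<partial>M)"
      using Y st bounded_F_integrable[OF b st(1)]
      by (intro nn_integral_eq_integral[symmetric]) (auto simp: mult.assoc[symmetric] intro!: AE_I2)
    also have "\<dots> = (\<integral>\<^sup>+\<omega>. ennreal (Y \<omega>) * ennreal ((h t \<omega>)\<^sup>2 * (t - s)) \<partial>M)"
      using Y st by (intro nn_integral_cong) (simp add: ennreal_mult)
    finally show "ennreal (expectation (\<lambda>\<omega>. Y \<omega> * (J t \<omega> - J s \<omega>)\<^sup>2))
      = (\<integral>\<^sup>+\<omega>. ennreal (Y \<omega>) * (\<integral>\<^sup>+r. ennreal ((h r \<omega>)\<^sup>2) * indicator {s<..t} r \<partial>lborel) \<partial>M)"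
      unfolding inner .
  next
    fix s r t :: real
    let ?I = "\<lambda>s t \<omega>. \<integral>\<^sup>+r. ennreal ((h r \<omega>)\<^sup>2) * indicator {s<..t} r \<partial>lborel"
    assume *: "0 \<le> s" "s < r" "r < t" and IH1: "?Q s r" and IH2: "?Q r t"
    show "?Q s t"
    proof (intro allI impI)
      fix Y :: "'a \<Rightarrow> real" assume Y: "bounded_F s Y \<and> (\<forall>\<omega>\<in>space M. 0 \<le> Y \<omega>)"
      then have Yr: "bounded_F r Y" using bounded_F_mono[of s Y r] * by simp
      have r0: "0 \<le> r" using * by simp
      have ad: "(\<lambda>\<omega>. Y \<omega> * (J r \<omega> - J s \<omega>)) \<in> borel_measurable (F r)"
        using bounded_F_measurable[OF Yr] J_increment_measurable[OF *(1,2)] by simp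
      have ai: "integrable M (\<lambda>\<omega>. Y \<omega> * (J r \<omega> - J s \<omega>))"
        using bounded_F_integrable_mult[OF Yr r0 J_increment_power[OF *(1,2), of 1, simplified]] .
      note cr = J_martingale[OF r0 *(3) ad ai]
      have i1: "integrable M (\<lambda>\<omega>. Y \<omega> * (J r \<omega> - J s \<omega>)\<^sup>2)" "integrable M (\<lambda>\<omega>. Y \<omega> * (J t \<omega> - J r \<omega>)\<^sup>2)"
        using bounded_F_integrable_mult[OF Yr r0] J_increment_power[of _ _ 2] * r0 by auto
      have "(\<lambda>\<omega>. Y \<omega> * (J t \<omega> - J s \<omega>)\<^sup>2) = (\<lambda>\<omega>. Y \<omega> * (J r \<omega> - J s \<omega>)\<^sup>2
          + Y \<omega> * (J t \<omega> - J r \<omega>)\<^sup>2 + 2 * (Y \<omega> * (J r \<omega> - J s \<omega>) * (J t \<omega> - J r \<omega>)))"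
        by (simp add: power2_eq_square algebra_simps)
      then have "expectation (\<lambda>\<omega>. Y \<omega> * (J t \<omega> - J s \<omega>)\<^sup>2) = expectation (\<lambda>\<omega>. Y \<omega> * (J r \<omega> - J s \<omega>)\<^sup>2)
          + expectation (\<lambda>\<omega>. Y \<omega> * (J t \<omega> - J r \<omega>)\<^sup>2)"
        using cr i1 by simp
      also have "ennreal \<dots> = ennreal (expectation (\<lambda>\<omega>. Y \<omega> * (J r \<omega> - J s \<omega>)\<^sup>2))
          + ennreal (expectation (\<lambda>\<omega>. Y \<omega> * (J t \<omega> - J r \<omega>)\<^sup>2))"
        using Y by (intro ennreal_plus integral_nonneg_AE) (auto intro!: AE_I2)
      also have "\<dots> = (\<integral>\<^sup>+\<omega>. ennreal (Y \<omega>) * ?I s r \<omega> \<partial>M) + (\<integral>\<^sup>+\<omega>. ennreal (Y \<omega>) * ?I r t \<omega> \<partial>M)"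
        using IH1 IH2 Y Yr by simp
      also have "\<dots> = (\<integral>\<^sup>+\<omega>. ennreal (Y \<omega>) * ?I s r \<omega> + ennreal (Y \<omega>) * ?I r t \<omega> \<partial>M)"
        using h_sq_integral_measurable measurable_F_M[OF bounded_F_measurable[OF Yr] r0]
        by (intro nn_integral_add[symmetric]) auto
      also have "\<dots> = (\<integral>\<^sup>+\<omega>. ennreal (Y \<omega>) * ?I s t \<omega> \<partial>M)"
      proof (intro nn_integral_cong)
        fix \<omega>
        have hm: "(\<lambda>r. h r \<omega>) \<in> borel_measurable lborel"
          unfolding h simple_proc_def by measurable
        have "?I s t \<omega> = ?I s r \<omega> + ?I r t \<omega>"
          using hm * by (subst nn_integral_add[symmetric]) (auto intro!: nn_integral_cong simp: indicator_def)
        then show "ennreal (Y \<omega>) * ?I s r \<omega> + ennreal (Y \<omega>) * ?I r t \<omega> = ennreal (Y \<omega>) * ?I s t \<omega>"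
          by (simp add: distrib_left)
      qed
      finally show "ennreal (expectation (\<lambda>\<omega>. Y \<omega> * (J t \<omega> - J s \<omega>)\<^sup>2)) = (\<integral>\<^sup>+\<omega>. ennreal (Y \<omega>) * ?I s t \<omega> \<partial>M)" .
    qed
  qed
  then show ?thesis using Y by blast
qed

lemma J_second_moment:
  assumes st: "0 \<le> s" "s < t" and Y: "bounded_F s Y" "\<And>\<omega>. \<omega> \<in> space M \<Longrightarrow> 0 \<le> Y \<omega>"
    and S: "\<And>r \<omega>. \<omega> \<in> space M \<Longrightarrow> \<bar>h r \<omega>\<bar> \<le> S"
  shows "expectation (\<lambda>\<omega>. Y \<omega> * (J t \<omega> - J s \<omega>)\<^sup>2) \<le> S\<^sup>2 * (t - s) * expectation Y"
proof -
  have "ennreal (expectation (\<lambda>\<omega>. Y \<omega> * (J t \<omega> - J s \<omega>)\<^sup>2))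
    = (\<integral>\<^sup>+\<omega>. ennreal (Y \<omega>) * (\<integral>\<^sup>+r. ennreal ((h r \<omega>)\<^sup>2) * indicator {s<..t} r \<partial>lborel) \<partial>M)"
    by (rule J_isometry[OF st Y])
  also have "\<dots> \<le> (\<integral>\<^sup>+\<omega>. ennreal (Y \<omega>) * (\<integral>\<^sup>+r. ennreal (S\<^sup>2) * indicator {s<..t} r \<partial>lborel) \<partial>M)"
    using S by (intro nn_integral_mono mult_left_mono mult_right_mono ennreal_leI) (auto simp: abs_le_square_iff[symmetric] intro: order_trans[OF _ abs_ge_self])
  also have "\<dots> = (\<integral>\<^sup>+\<omega>. ennreal (S\<^sup>2 * (t - s) * Y \<omega>) \<partial>M)"
  proof (intro nn_integral_cong)
    fix \<omega> assume "\<omega> \<in> space M"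
    have "(\<integral>\<^sup>+r. ennreal (S\<^sup>2) * indicator {s<..t} r \<partial>lborel) = ennreal (S\<^sup>2 * (t - s))"
      using st by (simp add: nn_integral_cmult_indicator ennreal_mult')
    then show "ennreal (Y \<omega>) * (\<integral>\<^sup>+r. ennreal (S\<^sup>2) * indicator {s<..t} r \<partial>lborel) = ennreal (S\<^sup>2 * (t - s) * Y \<omega>)"
      using st Y(2)[OF \<open>\<omega> \<in> space M\<close>] by (simp add: ennreal_mult'[symmetric] mult.commute)
  qed
  also have "\<dots> = ennreal (expectation (\<lambda>\<omega>. S\<^sup>2 * (t - s) * Y \<omega>))"
    using bounded_F_integrable[OF Y(1) st(1)] Y(2) st by (intro nn_integral_eq_integral) (auto intro!: AE_I2)
  finally have "expectation (\<lambda>\<omega>. Y \<omega> * (J t \<omega> - J s \<omega>)\<^sup>2) \<le> expectation (\<lambda>\<omega>. S\<^sup>2 * (t - s) * Y \<omega>)"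
    using Y(2) st by (subst (asm) ennreal_le_iff) (auto intro!: integral_nonneg_AE AE_I2)
  then show ?thesis by simp
qed

text \<open>Expand \<open>(x + y * d)^4\<close> at the last partition point \<open>r\<close>, where
  \<open>d\<close> is the Brownian increment over \<open>(r, t]\<close>. The odd powers of
  \<open>d\<close> have mean zero, and the mixed squares contribute at most
  \<open>6 * S^4 * (r - s) * (t - r)\<close>. Then
  \<open>3 u^2 + 6 u v + 3 v^2 = 3 (u + v)^2\<close> closes the induction with the same constant 3.
  The expansion relies on the last interval being free of partition points, so that
  \<open>h t\<close> is known at time \<open>r\<close>.\<close>

lemma J_fourth_moment:
  assumes st: "0 \<le> s" "s < t" and S: "\<And>r \<omega>. \<omega> \<in> space M \<Longrightarrow> \<bar>h r \<omega>\<bar> \<le> S"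
  shows "expectation (\<lambda>\<omega>. (J t \<omega> - J s \<omega>) ^ 4) \<le> 3 * S ^ 4 * (t - s)\<^sup>2"
proof (rule interval_additive_induct[OF _ st(1) st(2), of "\<tau> ` {..m}"])
  have S0: "0 \<le> S" using S[of _ 0] not_empty by fastforce
  have hp: "h r \<omega> ^ k \<le> S ^ k" if "\<omega> \<in> space M" "even k" for r k \<omega>
    using power_mono[OF S[OF that(1), of r], of k] that(2) by (simp add: power_even_abs)
  have free: "expectation (\<lambda>\<omega>. (J t \<omega> - J s \<omega>) ^ 4) \<le> 3 * S ^ 4 * (t - s)\<^sup>2"
    if st: "0 \<le> s" "s < t" and e: "\<tau> ` {..m} \<inter> {s<..<t} = {}" for s t
  proof -
    note b = bounded_F_power[OF h_local[OF st e], of 4]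
    have "expectation (\<lambda>\<omega>. (J t \<omega> - J s \<omega>) ^ 4) = expectation (\<lambda>\<omega>. h t \<omega> ^ 4) * (3 * (t - s)\<^sup>2)"
      unfolding J_local[OF st(2) e] power_mult_distrib
      using increment_mult_power(2)[OF i st bounded_F_measurable[OF b] bounded_F_integrable[OF b st(1)], of 4]
        increment_moments(5)[OF i st] by simp
    also have "expectation (\<lambda>\<omega>. h t \<omega> ^ 4) \<le> S ^ 4"
      using integral_mono[OF bounded_F_integrable[OF b st(1)], of "\<lambda>_. S ^ 4"] hp by (simp add: prob_space)
    finally show ?thesis by (simp add: mult_right_mono mult_ac)
  qed
  show "expectation (\<lambda>\<omega>. (J t \<omega> - J s \<omega>) ^ 4) \<le> 3 * S ^ 4 * (t - s)\<^sup>2"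
    if "0 \<le> s" "s < t" "\<tau> ` {..m} \<inter> {s<..<t} = {}" for s t
    using free that by blast
  fix s r t :: real
  assume *: "0 \<le> s" "s < r" "r < t" and e: "\<tau> ` {..m} \<inter> {r<..<t} = {}"
    and IH1: "expectation (\<lambda>\<omega>. (J r \<omega> - J s \<omega>) ^ 4) \<le> 3 * S ^ 4 * (r - s)\<^sup>2"
  then have rt: "0 \<le> r" "r < t" by auto
  let ?a = "\<lambda>\<omega>. J r \<omega> - J s \<omega>" and ?D = "\<lambda>\<omega>. W i t \<omega> - W i r \<omega>"
  have hb: "bounded_F r (\<lambda>\<omega>. h t \<omega> ^ k)" for k by (rule bounded_F_power[OF h_local[OF rt e]])
  have m: "(\<lambda>\<omega>. h t \<omega> ^ k * ?a \<omega> ^ l) \<in> borel_measurable (F r)" for k l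
    using bounded_F_measurable[OF hb] J_increment_measurable[OF *(1,2)] by simp
  have int: "integrable M (\<lambda>\<omega>. h t \<omega> ^ k * ?a \<omega> ^ l)" if "l \<le> 4" for k l
    using bounded_F_integrable_mult[OF hb rt(1) J_increment_power[OF *(1,2) that]] .
  note prod = increment_mult_power[OF i rt m int]
  have "(\<lambda>\<omega>. (J t \<omega> - J s \<omega>) ^ 4) = (\<lambda>\<omega>. ?a \<omega> ^ 4 + 4 * ((h t \<omega> ^ 1 * ?a \<omega> ^ 3) * ?D \<omega> ^ 1)
    + 6 * ((h t \<omega> ^ 2 * ?a \<omega> ^ 2) * ?D \<omega> ^ 2) + 4 * ((h t \<omega> ^ 3 * ?a \<omega> ^ 1) * ?D \<omega> ^ 3)
    + (J t \<omega> - J r \<omega>) ^ 4)"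
  proof (rule ext)
    fix \<omega>
    have "J t \<omega> - J s \<omega> = ?a \<omega> + h t \<omega> * ?D \<omega>" using J_local[OF rt(2) e, of \<omega>] by simp
    moreover have "(x + y * d) ^ 4 = x ^ 4 + 4 * ((y ^ 1 * x ^ 3) * d ^ 1) + 6 * ((y ^ 2 * x ^ 2) * d ^ 2)
      + 4 * ((y ^ 3 * x ^ 1) * d ^ 3) + (y * d) ^ 4" for x y d :: real
      by (simp add: power4_eq_xxxx power3_eq_cube power2_eq_square algebra_simps)
    ultimately show "(J t \<omega> - J s \<omega>) ^ 4 = ?a \<omega> ^ 4 + 4 * ((h t \<omega> ^ 1 * ?a \<omega> ^ 3) * ?D \<omega> ^ 1)
    + 6 * ((h t \<omega> ^ 2 * ?a \<omega> ^ 2) * ?D \<omega> ^ 2) + 4 * ((h t \<omega> ^ 3 * ?a \<omega> ^ 1) * ?D \<omega> ^ 3)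
    + (J t \<omega> - J r \<omega>) ^ 4"
      using J_local[OF rt(2) e, of \<omega>] by presburger
  qed
  then have "expectation (\<lambda>\<omega>. (J t \<omega> - J s \<omega>) ^ 4) = expectation (\<lambda>\<omega>. ?a \<omega> ^ 4)
      + 4 * expectation (\<lambda>\<omega>. (h t \<omega> ^ 1 * ?a \<omega> ^ 3) * ?D \<omega> ^ 1)
      + 6 * expectation (\<lambda>\<omega>. (h t \<omega> ^ 2 * ?a \<omega> ^ 2) * ?D \<omega> ^ 2)
      + 4 * expectation (\<lambda>\<omega>. (h t \<omega> ^ 3 * ?a \<omega> ^ 1) * ?D \<omega> ^ 3) + expectation (\<lambda>\<omega>. (J t \<omega> - J r \<omega>) ^ 4)"
    using prod(1)[of 3 1 1] prod(1)[of 2 2 2] prod(1)[of 1 3 3] J_increment_power4[OF *(1,2)] J_increment_power4[OF rt]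
    by (simp del: power_one_right)
  also have "expectation (\<lambda>\<omega>. (h t \<omega> ^ 1 * ?a \<omega> ^ 3) * ?D \<omega> ^ 1) = 0"
    using prod(2)[of 3 1 1] increment_moments(2)[OF i rt] by simp
  also have "expectation (\<lambda>\<omega>. (h t \<omega> ^ 3 * ?a \<omega> ^ 1) * ?D \<omega> ^ 3) = 0"
    using prod(2)[of 1 3 3] increment_moments(4)[OF i rt] by simp
  also have "expectation (\<lambda>\<omega>. (h t \<omega> ^ 2 * ?a \<omega> ^ 2) * ?D \<omega> ^ 2) \<le> S ^ 4 * (r - s) * (t - r)"
  proof -
    have "expectation (\<lambda>\<omega>. h t \<omega> ^ 2 * ?a \<omega> ^ 2) \<le> expectation (\<lambda>\<omega>. S\<^sup>2 * ?a \<omega> ^ 2)"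
      using int[of 2 2] J_increment_power[OF *(1,2), of 2] hp[of _ 2] by (intro integral_mono mult_right_mono) auto
    also have "\<dots> = S\<^sup>2 * expectation (\<lambda>\<omega>. ?a \<omega> ^ 2)" by simp
    also have "\<dots> \<le> S\<^sup>2 * (S\<^sup>2 * (r - s))"
      using J_second_moment[OF *(1,2) bounded_F_const[of _ 1] _ S]
      by (intro mult_left_mono) (simp_all add: prob_space)
    finally have "expectation (\<lambda>\<omega>. h t \<omega> ^ 2 * ?a \<omega> ^ 2) \<le> S ^ 4 * (r - s)"
      by (simp add: power4_eq_xxxx power2_eq_square mult_ac)
    then show ?thesis using prod(2)[of 2 2 2] increment_moments(3)[OF i rt] rt by (simp add: mult_right_mono)
  qed
  also have "expectation (\<lambda>\<omega>. (J t \<omega> - J r \<omega>) ^ 4) \<le> 3 * S ^ 4 * (t - r)\<^sup>2" using free[OF rt e] .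
  also note IH1
  finally show "expectation (\<lambda>\<omega>. (J t \<omega> - J s \<omega>) ^ 4) \<le> 3 * S ^ 4 * (t - s)\<^sup>2"
    by (simp add: power2_eq_square algebra_simps)
qed simp

end

text \<open>Induction over the union of both partitions freezes both integrands on every piece.
  Where two intervals meet, two products of an earlier and a later increment arise; each vanishes
  because its later factor is a martingale increment.\<close>

lemma simple_integral_cross:
  assumes i: "i \<in> {1..N}" and j: "j \<in> {1..N}" and "i \<noteq> j"
    and sd: "simple_data M F m \<tau> \<xi>" and sd': "simple_data M F m' \<tau>' \<xi>'"
    and st: "0 \<le> s" "s < t" and Y: "bounded_F s Y"
  shows "expectation (\<lambda>\<omega>. Y \<omega> * ((simple_integral (W i) m \<tau> \<xi> t \<omega> - simple_integral (W i) m \<tau> \<xi> s \<omega>) *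
    (simple_integral (W j) m' \<tau>' \<xi>' t \<omega> - simple_integral (W j) m' \<tau>' \<xi>' s \<omega>))) = 0"
proof -
  let ?J = "simple_integral (W i) m \<tau> \<xi>" and ?K = "simple_integral (W j) m' \<tau>' \<xi>'"
  let ?h = "simple_proc m \<tau> \<xi>" and ?k = "simple_proc m' \<tau>' \<xi>'"
  have "\<forall>Y. bounded_F s Y \<longrightarrow> expectation (\<lambda>\<omega>. Y \<omega> * ((?J t \<omega> - ?J s \<omega>) * (?K t \<omega> - ?K s \<omega>))) = 0"
    (is "?Q s t")
  proof (rule interval_additive_induct[of "\<tau> ` {..m} \<union> \<tau>' ` {..m'}" 0 s t ?Q, OF _ st], simp, intro allI impI)
    fix s t :: real and Y :: "'a \<Rightarrow> real"
    assume st: "0 \<le> s" "s < t" and e: "(\<tau> ` {..m} \<union> \<tau>' ` {..m'}) \<inter> {s<..<t} = {}"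
      and Y: "bounded_F s Y"
    from e have e1: "\<tau> ` {..m} \<inter> {s<..<t} = {}" and e2: "\<tau>' ` {..m'} \<inter> {s<..<t} = {}" by auto
    have b: "bounded_F s (\<lambda>\<omega>. Y \<omega> * (?h t \<omega> * ?k t \<omega>))"
      by (intro bounded_F_mult Y simple_proc_bounded_F[OF sd st e1] simple_proc_bounded_F[OF sd' st e2])
    show "expectation (\<lambda>\<omega>. Y \<omega> * ((?J t \<omega> - ?J s \<omega>) * (?K t \<omega> - ?K s \<omega>))) = 0"
      using increment_mult_cross[OF i j \<open>i \<noteq> j\<close> st bounded_F_measurable[OF b] bounded_F_integrable[OF b st(1)]]
      unfolding J_local[OF i sd refl refl st(2) e1] J_local[OF j sd' refl refl st(2) e2] by (simp add: mult_ac)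
  next
    fix s r t :: real
    assume *: "0 \<le> s" "s < r" "r < t" and IH1: "?Q s r" and IH2: "?Q r t"
    show "?Q s t"
    proof (intro allI impI)
      fix Y :: "'a \<Rightarrow> real" assume Y: "bounded_F s Y"
      then have Yr: "bounded_F r Y" using bounded_F_mono[of s Y r] * by simp
      have rt: "0 \<le> r" "r < t" using * by auto
      note J1 = J_increment_power[OF i sd refl refl *(1,2)] and J2 = J_increment_power[OF i sd refl refl rt]
      note K1 = J_increment_power[OF j sd' refl refl *(1,2)] and K2 = J_increment_power[OF j sd' refl refl rt]
      note mJ = J_increment_measurable[OF i sd refl refl] J_increment_measurable_M[OF i sd refl refl]
      note mK = J_increment_measurable[OF j sd' refl refl] J_increment_measurable_M[OF j sd' refl refl]
      have aj: "integrable M (\<lambda>\<omega>. Y \<omega> * (?J r \<omega> - ?J s \<omega>))" "(\<lambda>\<omega>. Y \<omega> * (?J r \<omega> - ?J s \<omega>)) \<in> borel_measurable (F r)"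
        using bounded_F_integrable_mult[OF Yr rt(1) J1[of 1, simplified]] mJ(1)[OF *(1,2)] bounded_F_measurable[OF Yr] by auto
      have ak: "integrable M (\<lambda>\<omega>. Y \<omega> * (?K r \<omega> - ?K s \<omega>))" "(\<lambda>\<omega>. Y \<omega> * (?K r \<omega> - ?K s \<omega>)) \<in> borel_measurable (F r)"
        using bounded_F_integrable_mult[OF Yr rt(1) K1[of 1, simplified]] mK(1)[OF *(1,2)] bounded_F_measurable[OF Yr] by auto
      note c1 = J_martingale[OF j sd' refl refl rt aj(2,1)] and c2 = J_martingale[OF i sd refl refl rt ak(2,1)]
      have p1: "integrable M (\<lambda>\<omega>. Y \<omega> * ((?J r \<omega> - ?J s \<omega>) * (?K r \<omega> - ?K s \<omega>)))"
        by (intro bounded_F_integrable_mult[OF Yr rt(1)] integrable_mult_of_squares mJ mK J1 K1 *) simp_all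
      have p2: "integrable M (\<lambda>\<omega>. Y \<omega> * ((?J t \<omega> - ?J r \<omega>) * (?K t \<omega> - ?K r \<omega>)))"
        by (intro bounded_F_integrable_mult[OF Yr rt(1)] integrable_mult_of_squares mJ mK J2 K2 rt) simp_all
      have "(\<lambda>\<omega>. Y \<omega> * ((?J t \<omega> - ?J s \<omega>) * (?K t \<omega> - ?K s \<omega>))) =
        (\<lambda>\<omega>. Y \<omega> * ((?J r \<omega> - ?J s \<omega>) * (?K r \<omega> - ?K s \<omega>)) + Y \<omega> * ((?J t \<omega> - ?J r \<omega>) * (?K t \<omega> - ?K r \<omega>))
          + Y \<omega> * (?J r \<omega> - ?J s \<omega>) * (?K t \<omega> - ?K r \<omega>) + Y \<omega> * (?K r \<omega> - ?K s \<omega>) * (?J t \<omega> - ?J r \<omega>))"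
        by (simp add: algebra_simps)
      then show "expectation (\<lambda>\<omega>. Y \<omega> * ((?J t \<omega> - ?J s \<omega>) * (?K t \<omega> - ?K s \<omega>))) = 0"
        using c1 c2 p1 p2 IH1 IH2 Y Yr by simp
    qed
  qed
  then show ?thesis using Y by blast
qed

end

section \<open>Moments of Ito integrals\<close>

text \<open>At most one coefficient is active at a time, so \<open>f\<close> acts on the value
  itself; \<open>f 0 = 0\<close> takes care of the times at which none is active.\<close>

lemma simple_proc_compose:
  fixes \<xi> :: "nat \<Rightarrow> 'a \<Rightarrow> real"
  assumes "simple_data M F m \<tau> \<xi>" "f 0 = 0"
  shows "simple_proc m \<tau> (\<lambda>j \<omega>. f (\<xi> j \<omega>)) s \<omega> = f (simple_proc m \<tau> \<xi> s \<omega>)"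
proof (rule simple_proc_cases[OF assms(1), of s])
  assume "\<And>\<xi>' :: nat \<Rightarrow> 'a \<Rightarrow> real. \<And>\<omega>. simple_proc m \<tau> \<xi>' s \<omega> = 0"
  then show ?thesis using assms(2) by simp
next
  fix j assume "\<And>\<xi>' :: nat \<Rightarrow> 'a \<Rightarrow> real. \<And>\<omega>. simple_proc m \<tau> \<xi>' s \<omega> = \<xi>' j \<omega>"
  then show ?thesis by simp
qed

lemma simple_integral_diff_integrand:
  "simple_integral B m \<tau> (\<lambda>j \<omega>. \<xi>' j \<omega> - \<xi> j \<omega>) t \<omega>
    = simple_integral B m \<tau> \<xi>' t \<omega> - simple_integral B m \<tau> \<xi> t \<omega>"
  unfolding simple_integral_def sum_subtractf[symmetric] by (simp only: left_diff_distrib)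

section \<open>Mean-square limits\<close>

lemma sum_squares_bound2: "(a + b)\<^sup>2 \<le> 2 * a\<^sup>2 + 2 * b\<^sup>2" for a b :: real
  using zero_le_power2[of "a - b"] by (simp add: power2_eq_square algebra_simps)

lemma nn_integral_square_add_le:
  fixes f g :: "'a \<Rightarrow> real"
  assumes [measurable]: "f \<in> borel_measurable M" "g \<in> borel_measurable M"
  shows "(\<integral>\<^sup>+\<omega>. ennreal ((f \<omega> + g \<omega>)\<^sup>2) \<partial>M)
    \<le> 2 * (\<integral>\<^sup>+\<omega>. ennreal ((f \<omega>)\<^sup>2) \<partial>M) + 2 * (\<integral>\<^sup>+\<omega>. ennreal ((g \<omega>)\<^sup>2) \<partial>M)"
proof -
  have "(\<integral>\<^sup>+\<omega>. ennreal ((f \<omega> + g \<omega>)\<^sup>2) \<partial>M) \<le> (\<integral>\<^sup>+\<omega>. 2 * ennreal ((f \<omega>)\<^sup>2) + 2 * ennreal ((g \<omega>)\<^sup>2) \<partial>M)"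
  proof (rule nn_integral_mono)
    fix \<omega>
    have "ennreal ((f \<omega> + g \<omega>)\<^sup>2) \<le> ennreal (2 * (f \<omega>)\<^sup>2 + 2 * (g \<omega>)\<^sup>2)"
      by (rule ennreal_leI[OF sum_squares_bound2])
    also have "\<dots> = 2 * ennreal ((f \<omega>)\<^sup>2) + 2 * ennreal ((g \<omega>)\<^sup>2)"
      by (simp add: ennreal_mult)
    finally show "ennreal ((f \<omega> + g \<omega>)\<^sup>2) \<le> 2 * ennreal ((f \<omega>)\<^sup>2) + 2 * ennreal ((g \<omega>)\<^sup>2)" .
  qed
  then show ?thesis by (simp add: nn_integral_add nn_integral_cmult)
qed

text \<open>Square integrability is part of the notion because the Bochner integral of a
  non-integrable function is 0 by default, so that the limit of integrals alone would not express
  convergence.\<close>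

definition L2_tendsto :: "'a measure \<Rightarrow> (nat \<Rightarrow> 'a \<Rightarrow> real) \<Rightarrow> ('a \<Rightarrow> real) \<Rightarrow> bool" where
  "L2_tendsto M f g \<longleftrightarrow> (\<forall>n. f n \<in> borel_measurable M \<and> integrable M (\<lambda>\<omega>. (f n \<omega>)\<^sup>2)) \<and>
    g \<in> borel_measurable M \<and> integrable M (\<lambda>\<omega>. (g \<omega>)\<^sup>2) \<and>
    (\<lambda>n. \<integral>\<omega>. (f n \<omega> - g \<omega>)\<^sup>2 \<partial>M) \<longlonglongrightarrow> 0"

lemma integrable_square_diff:
  fixes f g :: "'a \<Rightarrow> real"
  assumes "f \<in> borel_measurable M" "g \<in> borel_measurable M"
    "integrable M (\<lambda>\<omega>. (f \<omega>)\<^sup>2)" "integrable M (\<lambda>\<omega>. (g \<omega>)\<^sup>2)"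
  shows "integrable M (\<lambda>\<omega>. (f \<omega> - g \<omega>)\<^sup>2)"
  unfolding power2_diff mult.assoc using assms integrable_mult_of_squares[OF assms] by simp

lemma L2_tendstoI:
  assumes f: "\<And>n. f n \<in> borel_measurable M" "\<And>n. integrable M (\<lambda>\<omega>. (f n \<omega>)\<^sup>2)"
    and g: "g \<in> borel_measurable M"
    and lim: "(\<lambda>n. \<integral>\<^sup>+\<omega>. ennreal ((f n \<omega> - g \<omega>)\<^sup>2) \<partial>M) \<longlonglongrightarrow> 0"
  shows "L2_tendsto M f g"
proof -
  \<comment> \<open>Some \<open>f n\<close> has finite distance to \<open>g\<close>; then
    \<open>g = f n - (f n - g)\<close> is square integrable, although nothing was assumed about the
    size of \<open>g\<close>.\<close>
  have "eventually (\<lambda>n. (\<integral>\<^sup>+\<omega>. ennreal ((f n \<omega> - g \<omega>)\<^sup>2) \<partial>M) < 1) sequentially"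
    using lim by (rule order_tendstoD) simp
  then obtain n where n: "(\<integral>\<^sup>+\<omega>. ennreal ((f n \<omega> - g \<omega>)\<^sup>2) \<partial>M) < 1"
    using eventually_happens by force
  have "integrable M (\<lambda>\<omega>. (f n \<omega> - g \<omega>)\<^sup>2)"
    by (rule integrableI_bounded) (use n f g in \<open>auto simp: order.strict_trans[OF n]\<close>)
  from integrable_square_diff[OF _ _ f(2)[of n] this] f(1) g
  have g2: "integrable M (\<lambda>\<omega>. (g \<omega>)\<^sup>2)" by simp
  have int: "integrable M (\<lambda>\<omega>. (f n \<omega> - g \<omega>)\<^sup>2)" for n
    by (rule integrable_square_diff[OF f(1) g f(2) g2])
  have "(\<integral>\<^sup>+\<omega>. ennreal ((f n \<omega> - g \<omega>)\<^sup>2) \<partial>M) = ennreal (\<integral>\<omega>. (f n \<omega> - g \<omega>)\<^sup>2 \<partial>M)" for n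
    by (rule nn_integral_eq_integral[OF int]) simp
  with lim have "(\<lambda>n. ennreal (\<integral>\<omega>. (f n \<omega> - g \<omega>)\<^sup>2 \<partial>M)) \<longlonglongrightarrow> ennreal 0" by simp
  then have "(\<lambda>n. \<integral>\<omega>. (f n \<omega> - g \<omega>)\<^sup>2 \<partial>M) \<longlonglongrightarrow> 0"
    by (subst (asm) tendsto_ennreal_iff) auto
  then show ?thesis using f g g2 by (simp add: L2_tendsto_def)
qed

text \<open>Young's inequality, from \<open>(\<kappa> * |a| - |b|)^2 \<ge> 0\<close>. The weight
  \<kappa> is left free in order to balance a small factor against a merely bounded one.\<close>

lemma abs_mult_le_weighted:
  fixes a b \<kappa> :: real
  assumes "\<kappa> > 0"
  shows "\<bar>a * b\<bar> \<le> (\<kappa> * a\<^sup>2 + b\<^sup>2 / \<kappa>) / 2"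
proof -
  have "0 \<le> (\<kappa> * \<bar>a\<bar> - \<bar>b\<bar>)\<^sup>2" by simp
  then have "2 * (\<kappa> * \<bar>a * b\<bar>) \<le> \<kappa> * (\<kappa> * a\<^sup>2) + b\<^sup>2"
    by (simp add: power2_diff power_mult_distrib abs_mult) (simp add: power2_eq_square mult_ac)
  then have "2 * (\<kappa> * \<bar>a * b\<bar>) / \<kappa> \<le> (\<kappa> * (\<kappa> * a\<^sup>2) + b\<^sup>2) / \<kappa>"
    using assms by (intro divide_right_mono) auto
  then show ?thesis using assms by (simp add: add_divide_distrib)
qed

text \<open>With \<open>u = f - f'\<close> and \<open>v = g - g'\<close> the error is
  \<open>u v + f' v + g' u\<close>. The first product is small by itself; in the other two a small
  factor meets a fixed one, and the weighted Young inequality with a vanishing weight does the work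
  of Cauchy-Schwarz.\<close>

lemma L2_tendsto_integral_mult:
  assumes f: "L2_tendsto M f f'" and g: "L2_tendsto M g g'"
    and Y: "Y \<in> borel_measurable M" "\<And>\<omega>. \<omega> \<in> space M \<Longrightarrow> \<bar>Y \<omega>\<bar> \<le> C"
  shows "(\<lambda>n. \<integral>\<omega>. Y \<omega> * (f n \<omega> * g n \<omega>) \<partial>M) \<longlonglongrightarrow> (\<integral>\<omega>. Y \<omega> * (f' \<omega> * g' \<omega>) \<partial>M)"
proof -
  define A where "A n = (\<integral>\<omega>. (f n \<omega> - f' \<omega>)\<^sup>2 \<partial>M) + (\<integral>\<omega>. (g n \<omega> - g' \<omega>)\<^sup>2 \<partial>M)" for n
  define B where "B = (\<integral>\<omega>. (f' \<omega>)\<^sup>2 \<partial>M) + (\<integral>\<omega>. (g' \<omega>)\<^sup>2 \<partial>M)"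
  \<comment> \<open>The weight has to tend to 0 while \<open>A n / \<kappa> n\<close> tends to 0 as
    well, which the square root achieves; the term \<open>1 / Suc n\<close> keeps it positive when
    \<open>A n = 0\<close>.\<close>
  define \<kappa> where "\<kappa> n = sqrt (A n) + 1 / real (Suc n)" for n
  have A: "A \<longlonglongrightarrow> 0" "\<And>n. 0 \<le> A n"
    using tendsto_add[of "\<lambda>n. \<integral>\<omega>. (f n \<omega> - f' \<omega>)\<^sup>2 \<partial>M" 0 sequentially "\<lambda>n. \<integral>\<omega>. (g n \<omega> - g' \<omega>)\<^sup>2 \<partial>M" 0] f g
    unfolding A_def L2_tendsto_def by auto
  have \<kappa>: "\<kappa> n > 0" for n unfolding \<kappa>_def using A(2)[of n] by (intro add_nonneg_pos) auto
  have sqA: "(\<lambda>n. sqrt (A n)) \<longlonglongrightarrow> 0" using tendsto_real_sqrt[OF A(1)] by simp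
  then have \<kappa>0: "\<kappa> \<longlonglongrightarrow> 0" unfolding \<kappa>_def
    using tendsto_add[OF _ LIMSEQ_inverse_real_of_nat, of "\<lambda>n. sqrt (A n)" 0] by (simp add: inverse_eq_divide)
  have A\<kappa>: "A n / \<kappa> n \<le> sqrt (A n)" for n
  proof -
    have "A n = sqrt (A n) * sqrt (A n)" using A(2)[of n] by simp
    also have "\<dots> \<le> sqrt (A n) * \<kappa> n" using A(2)[of n] by (intro mult_left_mono) (auto simp: \<kappa>_def)
    finally show ?thesis using \<kappa>[of n] by (simp add: divide_le_eq)
  qed
  have meas: "f n \<in> borel_measurable M" "g n \<in> borel_measurable M" "f' \<in> borel_measurable M" "g' \<in> borel_measurable M"
    and i: "integrable M (\<lambda>\<omega>. (f n \<omega>)\<^sup>2)" "integrable M (\<lambda>\<omega>. (g n \<omega>)\<^sup>2)"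
    "integrable M (\<lambda>\<omega>. (f' \<omega>)\<^sup>2)" "integrable M (\<lambda>\<omega>. (g' \<omega>)\<^sup>2)" for n
    using f g by (auto simp: L2_tendsto_def)
  have d: "integrable M (\<lambda>\<omega>. (f n \<omega> - f' \<omega>)\<^sup>2)" "integrable M (\<lambda>\<omega>. (g n \<omega> - g' \<omega>)\<^sup>2)" for n
    by (rule integrable_square_diff; fact meas i)+
  have p: "integrable M (\<lambda>\<omega>. Y \<omega> * (f n \<omega> * g n \<omega>))" "integrable M (\<lambda>\<omega>. Y \<omega> * (f' \<omega> * g' \<omega>))" for n
    by (intro integrable_mult_bdd[OF _ Y] integrable_mult_of_squares meas i; simp)+
  have bound: "norm ((\<integral>\<omega>. Y \<omega> * (f n \<omega> * g n \<omega>) \<partial>M) - (\<integral>\<omega>. Y \<omega> * (f' \<omega> * g' \<omega>) \<partial>M))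
      \<le> \<bar>C\<bar> * (A n / 2 + (\<kappa> n * B + sqrt (A n)) / 2)" for n
  proof -
    let ?u = "\<lambda>\<omega>. f n \<omega> - f' \<omega>" and ?v = "\<lambda>\<omega>. g n \<omega> - g' \<omega>"
    let ?b = "\<lambda>\<omega>. \<bar>C\<bar> * (((?u \<omega>)\<^sup>2 + (?v \<omega>)\<^sup>2) / 2
      + (\<kappa> n * ((f' \<omega>)\<^sup>2 + (g' \<omega>)\<^sup>2) + ((?u \<omega>)\<^sup>2 + (?v \<omega>)\<^sup>2) / \<kappa> n) / 2)"
    have "norm (\<integral>\<omega>. Y \<omega> * (f n \<omega> * g n \<omega>) - Y \<omega> * (f' \<omega> * g' \<omega>) \<partial>M) \<le> (\<integral>\<omega>. ?b \<omega> \<partial>M)"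
    proof (rule order_trans[OF integral_norm_bound integral_mono])
      show "integrable M (\<lambda>\<omega>. norm (Y \<omega> * (f n \<omega> * g n \<omega>) - Y \<omega> * (f' \<omega> * g' \<omega>)))" using p by simp
      show "integrable M ?b" using i(3,4) d[of n] by simp
      fix \<omega> assume "\<omega> \<in> space M"
      then have "\<bar>Y \<omega>\<bar> \<le> \<bar>C\<bar>" using Y(2)[of \<omega>] by linarith
      have "f n \<omega> * g n \<omega> - f' \<omega> * g' \<omega> = ?u \<omega> * ?v \<omega> + f' \<omega> * ?v \<omega> + g' \<omega> * ?u \<omega>"
        by (simp add: algebra_simps)
      then have "\<bar>f n \<omega> * g n \<omega> - f' \<omega> * g' \<omega>\<bar> \<le> \<bar>?u \<omega> * ?v \<omega>\<bar> + \<bar>f' \<omega> * ?v \<omega>\<bar> + \<bar>g' \<omega> * ?u \<omega>\<bar>"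
        by linarith
      also have "\<dots> \<le> ((?u \<omega>)\<^sup>2 + (?v \<omega>)\<^sup>2) / 2
      + (\<kappa> n * ((f' \<omega>)\<^sup>2 + (g' \<omega>)\<^sup>2) + ((?u \<omega>)\<^sup>2 + (?v \<omega>)\<^sup>2) / \<kappa> n) / 2"
        using abs_mult_le_weighted[of 1 "?u \<omega>" "?v \<omega>"] abs_mult_le_weighted[OF \<kappa>[of n], of "f' \<omega>" "?v \<omega>"]
          abs_mult_le_weighted[OF \<kappa>[of n], of "g' \<omega>" "?u \<omega>"]
        by (simp add: add_divide_distrib distrib_left)
      finally have "\<bar>Y \<omega>\<bar> * \<bar>f n \<omega> * g n \<omega> - f' \<omega> * g' \<omega>\<bar> \<le> ?b \<omega>"
        using \<open>\<bar>Y \<omega>\<bar> \<le> \<bar>C\<bar>\<close> by (intro mult_mono) auto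
      then show "norm (Y \<omega> * (f n \<omega> * g n \<omega>) - Y \<omega> * (f' \<omega> * g' \<omega>)) \<le> ?b \<omega>"
        unfolding real_norm_def right_diff_distrib[symmetric] abs_mult .
    qed
    also have "(\<integral>\<omega>. ?b \<omega> \<partial>M) = \<bar>C\<bar> * (A n / 2 + (\<kappa> n * B + A n / \<kappa> n) / 2)"
      using i(3,4) d[of n] unfolding A_def B_def by simp
    also have "\<dots> \<le> \<bar>C\<bar> * (A n / 2 + (\<kappa> n * B + sqrt (A n)) / 2)"
      by (intro mult_left_mono add_mono divide_right_mono order_refl A\<kappa>) auto
    finally show ?thesis using p by simp
  qed
  have "(\<lambda>n. \<bar>C\<bar> * (A n / 2 + (\<kappa> n * B + sqrt (A n)) / 2)) \<longlonglongrightarrow> \<bar>C\<bar> * (0 / 2 + (0 * B + 0) / 2)"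
    by (intro tendsto_intros A \<kappa>0 sqA) auto
  then have "(\<lambda>n. \<bar>C\<bar> * (A n / 2 + (\<kappa> n * B + sqrt (A n)) / 2)) \<longlonglongrightarrow> 0" by simp
  then have "(\<lambda>n. (\<integral>\<omega>. Y \<omega> * (f n \<omega> * g n \<omega>) \<partial>M) - (\<integral>\<omega>. Y \<omega> * (f' \<omega> * g' \<omega>) \<partial>M)) \<longlonglongrightarrow> 0"
    by (rule Lim_null_comparison[rotated]) (use bound in simp)
  then show ?thesis using LIM_zero_iff by blast
qed

text \<open>Mean-square convergence does not control fourth moments. But a subsequence converges
  almost everywhere, and Fatou's lemma along it carries the uniform bound over to the limit.\<close>

lemma (in prob_space) L2_tendsto_power4:
  assumes f: "L2_tendsto M f g" and int: "\<And>n. integrable M (\<lambda>\<omega>. (f n \<omega>) ^ 4)"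
    and bound: "\<And>n. expectation (\<lambda>\<omega>. (f n \<omega>) ^ 4) \<le> K"
  shows "integrable M (\<lambda>\<omega>. (g \<omega>) ^ 4)" "expectation (\<lambda>\<omega>. (g \<omega>) ^ 4) \<le> K"
proof -
  have meas: "\<And>n. f n \<in> borel_measurable M" "g \<in> borel_measurable M"
    and i: "\<And>n. integrable M (\<lambda>\<omega>. (f n \<omega>)\<^sup>2)" "integrable M (\<lambda>\<omega>. (g \<omega>)\<^sup>2)"
    and lim: "(\<lambda>n. \<integral>\<omega>. (f n \<omega> - g \<omega>)\<^sup>2 \<partial>M) \<longlonglongrightarrow> 0"
    using f by (auto simp: L2_tendsto_def)
  have "0 \<le> expectation (\<lambda>\<omega>. (f 0 \<omega>) ^ 4)" by simp
  then have K: "0 \<le> K" using bound[of 0] by linarith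
  have "\<exists>r. strict_mono r \<and> (AE \<omega> in M. (\<lambda>n. (f (r n) \<omega> - g \<omega>)\<^sup>2) \<longlonglongrightarrow> 0)"
  proof (rule tendsto_L1_AE_subseq)
    show "integrable M (\<lambda>\<omega>. (f n \<omega> - g \<omega>)\<^sup>2)" for n
      by (rule integrable_square_diff[OF meas i])
    show "(\<lambda>n. \<integral>\<omega>. norm ((f n \<omega> - g \<omega>)\<^sup>2) \<partial>M) \<longlonglongrightarrow> 0" using lim by simp
  qed
  then obtain r :: "nat \<Rightarrow> nat" where r: "AE \<omega> in M. (\<lambda>n. (f (r n) \<omega> - g \<omega>)\<^sup>2) \<longlonglongrightarrow> 0"
    by blast
  have "(\<integral>\<^sup>+\<omega>. ennreal ((g \<omega>) ^ 4) \<partial>M) = (\<integral>\<^sup>+\<omega>. liminf (\<lambda>n. ennreal ((f (r n) \<omega>) ^ 4)) \<partial>M)"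
  proof (rule nn_integral_cong_AE)
    show "AE \<omega> in M. ennreal ((g \<omega>) ^ 4) = liminf (\<lambda>n. ennreal ((f (r n) \<omega>) ^ 4))"
      using r
    proof eventually_elim
      case (elim \<omega>)
      have "(\<lambda>n. \<bar>f (r n) \<omega> - g \<omega>\<bar>) \<longlonglongrightarrow> 0" using tendsto_real_sqrt[OF elim] by simp
      then have "(\<lambda>n. f (r n) \<omega>) \<longlonglongrightarrow> g \<omega>" using tendsto_rabs_zero_cancel LIM_zero_iff by blast
      then have "(\<lambda>n. ennreal ((f (r n) \<omega>) ^ 4)) \<longlonglongrightarrow> ennreal ((g \<omega>) ^ 4)"
        by (intro tendsto_ennrealI tendsto_power)
      then show ?case using lim_imp_Liminf[OF sequentially_bot] by metis
    qed
  qed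
  also have "\<dots> \<le> liminf (\<lambda>n. \<integral>\<^sup>+\<omega>. ennreal ((f (r n) \<omega>) ^ 4) \<partial>M)"
    using meas by (intro nn_integral_liminf) auto
  also have "\<dots> \<le> liminf (\<lambda>n::nat. ennreal K)"
  proof (intro Liminf_mono always_eventually allI)
    fix n
    have "(\<integral>\<^sup>+\<omega>. ennreal ((f (r n) \<omega>) ^ 4) \<partial>M) = ennreal (expectation (\<lambda>\<omega>. (f (r n) \<omega>) ^ 4))"
      by (intro nn_integral_eq_integral int) simp
    also have "\<dots> \<le> ennreal K" by (rule ennreal_leI[OF bound])
    finally show "(\<integral>\<^sup>+\<omega>. ennreal ((f (r n) \<omega>) ^ 4) \<partial>M) \<le> ennreal K" .
  qed
  finally have le: "(\<integral>\<^sup>+\<omega>. ennreal ((g \<omega>) ^ 4) \<partial>M) \<le> ennreal K" by (simp add: Liminf_const)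
  show int4: "integrable M (\<lambda>\<omega>. (g \<omega>) ^ 4)"
    using meas(2) order.strict_trans1[OF le ennreal_less_top] by (intro integrableI_bounded) auto
  have "ennreal (expectation (\<lambda>\<omega>. (g \<omega>) ^ 4)) \<le> ennreal K"
    using le nn_integral_eq_integral[OF int4] by simp
  then show "expectation (\<lambda>\<omega>. (g \<omega>) ^ 4) \<le> K" using K by (simp add: ennreal_le_iff)
qed

lemma simple_data_map:
  assumes sd: "simple_data M F m \<tau> \<xi>" and f: "f \<in> borel_measurable borel" "\<And>x. \<bar>f x\<bar> \<le> \<bar>x\<bar>"
  shows "simple_data M F m \<tau> (\<lambda>j \<omega>. f (\<xi> j \<omega>))"
proof -
  obtain C where C: "\<forall>j<m. \<forall>\<omega>\<in>space M. \<bar>\<xi> j \<omega>\<bar> \<le> C"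
    using sd unfolding simple_data_def by blast
  have "\<forall>j<m. \<forall>\<omega>\<in>space M. \<bar>f (\<xi> j \<omega>)\<bar> \<le> C"
    using C f(2) order_trans by blast
  moreover have "\<forall>j<m. (\<lambda>\<omega>. f (\<xi> j \<omega>)) \<in> borel_measurable (F (\<tau> j))"
    using sd measurable_compose[OF _ f(1)] unfolding simple_data_def by blast
  ultimately show ?thesis using sd unfolding simple_data_def by blast
qed

section \<open>Approximation of Ito integrals by bounded simple integrals\<close>

context brownian_filtration
begin

text \<open>Progressive measurability concerns \<open>[0, t]\<close> only. Sending all other times
  to 0 yields a function on the full product space, where Tonelli's theorem can be applied.\<close>

lemma progressively_measurable_pair:
  assumes "progressively_measurable F H" "0 \<le> t"
  shows "(\<lambda>x. H (if snd x \<in> {0..t} then snd x else 0) (fst x)) \<in> borel_measurable (M \<Otimes>\<^sub>M lborel)"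
proof -
  have id: "(\<lambda>\<omega>. \<omega>) \<in> measurable M (F t)"
  proof (rule measurableI)
    fix A assume "A \<in> sets (F t)"
    then have "A \<in> sets M" using sets_F[OF assms(2)] by blast
    then show "(\<lambda>\<omega>. \<omega>) -` A \<inter> space M \<in> sets M" by simp
  qed (simp add: space_F[OF assms(2)])
  have c: "(\<lambda>x. if snd x \<in> {0..t} then snd x else 0) \<in> measurable (M \<Otimes>\<^sub>M lborel) (restrict_space borel {0..t})"
    using assms(2) by (intro measurable_restrict_space2) auto
  have "(\<lambda>x. (if snd x \<in> {0..t} then snd x else 0, fst x))
      \<in> measurable (M \<Otimes>\<^sub>M lborel) (restrict_space borel {0..t} \<Otimes>\<^sub>M F t)"
    by (intro measurable_Pair c measurable_compose[OF measurable_fst id])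
  moreover have "(\<lambda>(s, \<omega>). H s \<omega>) \<in> borel_measurable (restrict_space borel {0..t} \<Otimes>\<^sub>M F t)"
    using assms unfolding progressively_measurable_def by blast
  ultimately show ?thesis using measurable_compose by fastforce
qed

text \<open>The bound \<open>S\<close> is uniform in \<open>n\<close>, so the moment bounds for
  simple integrals hold with constants independent of \<open>n\<close> and survive the
  limit.\<close>

definition ito_L2_approximation :: "nat \<Rightarrow> (real \<Rightarrow> 'a \<Rightarrow> real) \<Rightarrow> (real \<Rightarrow> 'a \<Rightarrow> real) \<Rightarrow> real \<Rightarrow> real \<Rightarrow> real \<Rightarrow>
    (nat \<Rightarrow> nat) \<Rightarrow> (nat \<Rightarrow> nat \<Rightarrow> real) \<Rightarrow> (nat \<Rightarrow> nat \<Rightarrow> 'a \<Rightarrow> real) \<Rightarrow> bool" where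
  "ito_L2_approximation i H I S s t m \<tau> \<xi> \<longleftrightarrow>
    (\<forall>n. simple_data M F (m n) (\<tau> n) (\<xi> n)) \<and>
    (\<forall>n r. \<forall>\<omega>\<in>space M. \<bar>simple_proc (m n) (\<tau> n) (\<xi> n) r \<omega>\<bar> \<le> S) \<and>
    (\<lambda>n. \<integral>\<^sup>+ \<omega>. (\<integral>\<^sup>+ s\<in>{0..t}.
      ennreal ((simple_proc (m n) (\<tau> n) (\<xi> n) s \<omega> - H s \<omega>)\<^sup>2) \<partial>lborel) \<partial>M) \<longlonglongrightarrow> 0 \<and>
    L2_tendsto M (\<lambda>n \<omega>. simple_integral (W i) (m n) (\<tau> n) (\<xi> n) t \<omega> - simple_integral (W i) (m n) (\<tau> n) (\<xi> n) s \<omega>)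
      (\<lambda>\<omega>. I t \<omega> - I s \<omega>)"

lemma ito_L2_approximationD:
  assumes "ito_L2_approximation i H I S s t m \<tau> \<xi>"
  shows "simple_data M F (m n) (\<tau> n) (\<xi> n)"
    "\<omega> \<in> space M \<Longrightarrow> \<bar>simple_proc (m n) (\<tau> n) (\<xi> n) r \<omega>\<bar> \<le> S"
    "(\<lambda>n. \<integral>\<^sup>+ \<omega>. (\<integral>\<^sup>+ s\<in>{0..t}.
      ennreal ((simple_proc (m n) (\<tau> n) (\<xi> n) s \<omega> - H s \<omega>)\<^sup>2) \<partial>lborel) \<partial>M) \<longlonglongrightarrow> 0"
    "L2_tendsto M (\<lambda>n \<omega>. simple_integral (W i) (m n) (\<tau> n) (\<xi> n) t \<omega> - simple_integral (W i) (m n) (\<tau> n) (\<xi> n) s \<omega>)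
      (\<lambda>\<omega>. I t \<omega> - I s \<omega>)"
  using assms unfolding ito_L2_approximation_def by blast+

context
  fixes i :: nat and H I :: "real \<Rightarrow> 'a \<Rightarrow> real" and L S :: real
  assumes i: "i \<in> {1..N}" and ito: "ito_integral M F (W i) H I" and S: "0 \<le> S" and L: "0 \<le> L"
    and HS: "\<And>s \<omega>. 0 \<le> s \<Longrightarrow> \<omega> \<in> space M \<Longrightarrow> \<bar>H s \<omega>\<bar> \<le> S"
    and HL: "\<And>s \<omega>. 0 \<le> s \<Longrightarrow> \<omega> \<in> space M \<Longrightarrow> L \<le> (H s \<omega>)\<^sup>2"
begin

lemma ito_measurable: "0 \<le> t \<Longrightarrow> I t \<in> borel_measurable (F t)"
  using ito unfolding ito_integral_def continuous_adapted_def by blast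

lemma ito_measurable_M: "0 \<le> t \<Longrightarrow> I t \<in> borel_measurable M"
  using measurable_F_M[OF ito_measurable] by blast

text \<open>Truncating the integrands at the level \<open>S\<close> preserves the convergence and makes the
  approximating simple processes uniformly bounded.\<close>

lemma ito_bounded_approx:
  "\<exists>m \<tau> \<xi>. (\<forall>n. simple_data M F (m n) (\<tau> n) (\<xi> n)) \<and>
    (\<forall>n r. \<forall>\<omega>\<in>space M. \<bar>simple_proc (m n) (\<tau> n) (\<xi> n) r \<omega>\<bar> \<le> S) \<and>
    (\<forall>T\<ge>0. (\<lambda>n. \<integral>\<^sup>+ \<omega>. (\<integral>\<^sup>+ s\<in>{0..T}.
      ennreal ((simple_proc (m n) (\<tau> n) (\<xi> n) s \<omega> - H s \<omega>)\<^sup>2) \<partial>lborel) \<partial>M) \<longlonglongrightarrow> 0) \<and>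
    (\<forall>t\<ge>0. (\<lambda>n. \<integral>\<^sup>+ \<omega>. ennreal ((simple_integral (W i) (m n) (\<tau> n) (\<xi> n) t \<omega> - I t \<omega>)\<^sup>2) \<partial>M) \<longlonglongrightarrow> 0)"
proof -
  obtain m \<tau> \<xi> where sd: "\<And>n. simple_data M F (m n) (\<tau> n) (\<xi> n)"
    and e: "\<And>T. 0 \<le> T \<Longrightarrow> (\<lambda>n. \<integral>\<^sup>+ \<omega>. (\<integral>\<^sup>+ s\<in>{0..T}.
      ennreal ((simple_proc (m n) (\<tau> n) (\<xi> n) s \<omega> - H s \<omega>)\<^sup>2) \<partial>lborel) \<partial>M) \<longlonglongrightarrow> 0"
    and c: "\<And>t. 0 \<le> t \<Longrightarrow> (\<lambda>n. \<integral>\<^sup>+ \<omega>.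
      ennreal ((simple_integral (W i) (m n) (\<tau> n) (\<xi> n) t \<omega> - I t \<omega>)\<^sup>2) \<partial>M) \<longlonglongrightarrow> 0"
    using ito unfolding ito_integral_def by blast
  define clip where "clip x = max (-S) (min S x)" for x :: real
  define \<xi>c where "\<xi>c n = (\<lambda>j \<omega>. clip (\<xi> n j \<omega>))" for n
  define \<xi>d where "\<xi>d n = (\<lambda>j \<omega>. \<xi>c n j \<omega> - \<xi> n j \<omega>)" for n
  have clip: "clip 0 = 0" "\<bar>clip x\<bar> \<le> S" "\<bar>clip x\<bar> \<le> \<bar>x\<bar>" "\<bar>clip x - x\<bar> \<le> \<bar>x\<bar>" for x
    using S unfolding clip_def by linarith+
  \<comment> \<open>For \<open>y\<close> in \<open>[-S, S]\<close>, clipping moves \<open>x\<close>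
    towards \<open>y\<close>: neither the remaining distance nor the displacement exceeds
    \<open>|x - y|\<close>. The first bound gives convergence of the clipped integrands, the second
    that of their integrals.\<close>
  have clip2: "\<bar>clip x - y\<bar> \<le> \<bar>x - y\<bar>" "\<bar>clip x - x\<bar> \<le> \<bar>x - y\<bar>" if "\<bar>y\<bar> \<le> S" for x y
    using S that unfolding clip_def by linarith+
  have m: "clip \<in> borel_measurable borel" "(\<lambda>x. clip x - x) \<in> borel_measurable borel"
    unfolding clip_def by measurable
  have sdc: "simple_data M F (m n) (\<tau> n) (\<xi>c n)" for n
    unfolding \<xi>c_def by (rule simple_data_map[OF sd m(1) clip(3)])
  have sdd: "simple_data M F (m n) (\<tau> n) (\<xi>d n)" for n
    unfolding \<xi>c_def \<xi>d_def by (rule simple_data_map[OF sd m(2) clip(4)])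
  let ?h = "\<lambda>n. simple_proc (m n) (\<tau> n) (\<xi> n)"
  let ?J = "\<lambda>n. simple_integral (W i) (m n) (\<tau> n) (\<xi> n)"
  let ?Jc = "\<lambda>n. simple_integral (W i) (m n) (\<tau> n) (\<xi>c n)"
  let ?Jd = "\<lambda>n. simple_integral (W i) (m n) (\<tau> n) (\<xi>d n)"
  have hc: "simple_proc (m n) (\<tau> n) (\<xi>c n) r \<omega> = clip (?h n r \<omega>)" for n r \<omega>
    unfolding \<xi>c_def by (rule simple_proc_compose[where f = clip, OF sd clip(1)])
  have hd: "simple_proc (m n) (\<tau> n) (\<xi>d n) r \<omega> = clip (?h n r \<omega>) - ?h n r \<omega>" for n r \<omega>
    unfolding \<xi>d_def \<xi>c_def by (rule simple_proc_compose[where f = "\<lambda>x. clip x - x", OF sd]) (simp add: clip)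
  have ec: "(\<lambda>n. \<integral>\<^sup>+ \<omega>. (\<integral>\<^sup>+ s\<in>{0..T}.
      ennreal ((simple_proc (m n) (\<tau> n) (\<xi>c n) s \<omega> - H s \<omega>)\<^sup>2) \<partial>lborel) \<partial>M) \<longlonglongrightarrow> 0" if "0 \<le> T" for T
  proof (rule tendsto_sandwich[OF _ _ tendsto_const e[OF that]])
    show "\<forall>\<^sub>F n in sequentially. (\<integral>\<^sup>+ \<omega>. (\<integral>\<^sup>+ s\<in>{0..T}.
        ennreal ((simple_proc (m n) (\<tau> n) (\<xi>c n) s \<omega> - H s \<omega>)\<^sup>2) \<partial>lborel) \<partial>M)
      \<le> (\<integral>\<^sup>+ \<omega>. (\<integral>\<^sup>+ s\<in>{0..T}. ennreal ((?h n s \<omega> - H s \<omega>)\<^sup>2) \<partial>lborel) \<partial>M)"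
    proof (intro always_eventually allI nn_integral_mono)
      fix n \<omega> s assume "\<omega> \<in> space M"
      then show "ennreal ((simple_proc (m n) (\<tau> n) (\<xi>c n) s \<omega> - H s \<omega>)\<^sup>2) * indicator {0..T} s
        \<le> ennreal ((?h n s \<omega> - H s \<omega>)\<^sup>2) * indicator {0..T} s"
        using clip2(1)[OF HS[of s \<omega>], of "?h n s \<omega>"] unfolding hc
        by (auto simp: indicator_def abs_le_square_iff intro!: ennreal_leI)
    qed
  qed simp
  \<comment> \<open>The integral of the correction \<open>clip h - h\<close> tends to 0: by the
    isometry its second moment is the integral of the squared displacement, which is dominated by
    that of \<open>(h - H)^2\<close>.\<close>
  have d0: "(\<lambda>n. \<integral>\<^sup>+ \<omega>. ennreal ((?Jd n t \<omega>)\<^sup>2) \<partial>M) \<longlonglongrightarrow> 0" if "0 < t" for t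
  proof (rule tendsto_sandwich[OF _ _ tendsto_const e[OF less_imp_le[OF that]]])
    show "\<forall>\<^sub>F n in sequentially. (\<integral>\<^sup>+ \<omega>. ennreal ((?Jd n t \<omega>)\<^sup>2) \<partial>M)
      \<le> (\<integral>\<^sup>+ \<omega>. (\<integral>\<^sup>+ s\<in>{0..t}. ennreal ((?h n s \<omega> - H s \<omega>)\<^sup>2) \<partial>lborel) \<partial>M)"
    proof (intro always_eventually allI)
      fix n
      have "(\<integral>\<^sup>+ \<omega>. ennreal ((?Jd n t \<omega>)\<^sup>2) \<partial>M) = ennreal (expectation (\<lambda>\<omega>. (?Jd n t \<omega>)\<^sup>2))"
        using J_increment_power[OF i sdd refl refl order_refl that, of 2] simple_integral_0[OF sdd]
        by (intro nn_integral_eq_integral) auto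
      also have "\<dots> = (\<integral>\<^sup>+\<omega>. (\<integral>\<^sup>+r. ennreal ((simple_proc (m n) (\<tau> n) (\<xi>d n) r \<omega>)\<^sup>2) * indicator {0<..t} r \<partial>lborel) \<partial>M)"
        using J_isometry[OF i sdd refl refl order_refl that bounded_F_const[of 0 1]] simple_integral_0[OF sdd] by simp
      also have "\<dots> \<le> (\<integral>\<^sup>+ \<omega>. (\<integral>\<^sup>+ s\<in>{0..t}. ennreal ((?h n s \<omega> - H s \<omega>)\<^sup>2) \<partial>lborel) \<partial>M)"
      proof (intro nn_integral_mono)
        fix \<omega> s assume "\<omega> \<in> space M"
        then show "ennreal ((simple_proc (m n) (\<tau> n) (\<xi>d n) s \<omega>)\<^sup>2) * indicator {0<..t} s
          \<le> ennreal ((?h n s \<omega> - H s \<omega>)\<^sup>2) * indicator {0..t} s"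
          using clip2(2)[OF HS[of s \<omega>], of "?h n s \<omega>"] unfolding hd
          by (auto simp: indicator_def abs_le_square_iff intro!: ennreal_leI)
      qed
      finally show "(\<integral>\<^sup>+ \<omega>. ennreal ((?Jd n t \<omega>)\<^sup>2) \<partial>M)
        \<le> (\<integral>\<^sup>+ \<omega>. (\<integral>\<^sup>+ s\<in>{0..t}. ennreal ((?h n s \<omega> - H s \<omega>)\<^sup>2) \<partial>lborel) \<partial>M)" .
    qed
  qed simp
  have cc: "(\<lambda>n. \<integral>\<^sup>+ \<omega>. ennreal ((?Jc n t \<omega> - I t \<omega>)\<^sup>2) \<partial>M) \<longlonglongrightarrow> 0" if "0 \<le> t" for t
  proof (cases "t = 0")
    case True
    then show ?thesis using c[of 0] simple_integral_0[OF sd] simple_integral_0[OF sdc] by simp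
  next
    case False
    then have t: "0 < t" using that by simp
    have J_eq: "?Jd n t \<omega> = ?Jc n t \<omega> - ?J n t \<omega>" for n \<omega>
      unfolding \<xi>d_def by (rule simple_integral_diff_integrand)
    have lim: "(\<lambda>n. 2 * (\<integral>\<^sup>+ \<omega>. ennreal ((?Jd n t \<omega>)\<^sup>2) \<partial>M) + 2 * (\<integral>\<^sup>+ \<omega>. ennreal ((?J n t \<omega> - I t \<omega>)\<^sup>2) \<partial>M))
      \<longlonglongrightarrow> 2 * 0 + 2 * 0"
      by (intro tendsto_add ennreal_tendsto_cmult d0[OF t] c[OF that]) auto
    show ?thesis
    proof (rule tendsto_sandwich[OF _ _ tendsto_const])
      show "\<forall>\<^sub>F n in sequentially. (\<integral>\<^sup>+ \<omega>. ennreal ((?Jc n t \<omega> - I t \<omega>)\<^sup>2) \<partial>M)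
        \<le> 2 * (\<integral>\<^sup>+ \<omega>. ennreal ((?Jd n t \<omega>)\<^sup>2) \<partial>M) + 2 * (\<integral>\<^sup>+ \<omega>. ennreal ((?J n t \<omega> - I t \<omega>)\<^sup>2) \<partial>M)"
      proof (intro always_eventually allI)
        fix n
        have mm: "?Jd n t \<in> borel_measurable M" "(\<lambda>\<omega>. ?J n t \<omega> - I t \<omega>) \<in> borel_measurable M"
          using measurable_F_M[OF simple_integral_measurable[OF i sdd that] that]
            measurable_F_M[OF simple_integral_measurable[OF i sd that] that] ito_measurable_M[OF that] by auto
        have "?Jc n t \<omega> - I t \<omega> = ?Jd n t \<omega> + (?J n t \<omega> - I t \<omega>)" for \<omega>
          using J_eq by simp
        then show "(\<integral>\<^sup>+ \<omega>. ennreal ((?Jc n t \<omega> - I t \<omega>)\<^sup>2) \<partial>M)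
        \<le> 2 * (\<integral>\<^sup>+ \<omega>. ennreal ((?Jd n t \<omega>)\<^sup>2) \<partial>M) + 2 * (\<integral>\<^sup>+ \<omega>. ennreal ((?J n t \<omega> - I t \<omega>)\<^sup>2) \<partial>M)"
          using nn_integral_square_add_le[OF mm] by presburger
      qed
      show "(\<lambda>n. 2 * (\<integral>\<^sup>+ \<omega>. ennreal ((?Jd n t \<omega>)\<^sup>2) \<partial>M) + 2 * (\<integral>\<^sup>+ \<omega>. ennreal ((?J n t \<omega> - I t \<omega>)\<^sup>2) \<partial>M)) \<longlonglongrightarrow> 0"
        using lim by simp
    qed simp
  qed
  show ?thesis
    by (intro exI[of _ m] exI[of _ \<tau>] exI[of _ \<xi>c] conjI allI impI ballI sdc ec cc) (simp_all add: hc clip)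
qed

lemma ito_L2_approx:
  assumes st: "0 \<le> s" "s < t"
  shows "\<exists>m \<tau> \<xi>. ito_L2_approximation i H I S s t m \<tau> \<xi>"
proof -
  obtain m \<tau> \<xi> where sd: "\<And>n. simple_data M F (m n) (\<tau> n) (\<xi> n)"
    and b: "\<And>n r \<omega>. \<omega> \<in> space M \<Longrightarrow> \<bar>simple_proc (m n) (\<tau> n) (\<xi> n) r \<omega>\<bar> \<le> S"
    and e: "\<And>T. 0 \<le> T \<Longrightarrow> (\<lambda>n. \<integral>\<^sup>+ \<omega>. (\<integral>\<^sup>+ s\<in>{0..T}.
      ennreal ((simple_proc (m n) (\<tau> n) (\<xi> n) s \<omega> - H s \<omega>)\<^sup>2) \<partial>lborel) \<partial>M) \<longlonglongrightarrow> 0"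
    and c: "\<And>t. 0 \<le> t \<Longrightarrow> (\<lambda>n. \<integral>\<^sup>+ \<omega>.
      ennreal ((simple_integral (W i) (m n) (\<tau> n) (\<xi> n) t \<omega> - I t \<omega>)\<^sup>2) \<partial>M) \<longlonglongrightarrow> 0"
    using ito_bounded_approx by blast
  let ?J = "\<lambda>n. simple_integral (W i) (m n) (\<tau> n) (\<xi> n)"
  have t: "0 \<le> t" using st by simp
  have mJ: "(\<lambda>\<omega>. ?J n r \<omega> - I r \<omega>) \<in> borel_measurable M" if "0 \<le> r" for n r
    using measurable_F_M[OF simple_integral_measurable[OF i sd that] that] ito_measurable_M[OF that] by simp
  have L2: "L2_tendsto M (\<lambda>n \<omega>. ?J n t \<omega> - ?J n s \<omega>) (\<lambda>\<omega>. I t \<omega> - I s \<omega>)"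
  proof (rule L2_tendstoI)
    show "(\<lambda>\<omega>. ?J n t \<omega> - ?J n s \<omega>) \<in> borel_measurable M" for n
      by (rule J_increment_measurable_M[OF i sd refl refl st])
    show "integrable M (\<lambda>\<omega>. (?J n t \<omega> - ?J n s \<omega>)\<^sup>2)" for n
      by (rule J_increment_power[OF i sd refl refl st]) simp
    show "(\<lambda>\<omega>. I t \<omega> - I s \<omega>) \<in> borel_measurable M"
      using ito_measurable_M st(1) t by (intro borel_measurable_diff) auto
    have lim: "(\<lambda>n. 2 * (\<integral>\<^sup>+ \<omega>. ennreal ((?J n t \<omega> - I t \<omega>)\<^sup>2) \<partial>M) + 2 * (\<integral>\<^sup>+ \<omega>. ennreal ((?J n s \<omega> - I s \<omega>)\<^sup>2) \<partial>M))
      \<longlonglongrightarrow> 2 * 0 + 2 * 0"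
      by (intro tendsto_add ennreal_tendsto_cmult c t st(1)) auto
    show "(\<lambda>n. \<integral>\<^sup>+ \<omega>. ennreal ((?J n t \<omega> - ?J n s \<omega> - (I t \<omega> - I s \<omega>))\<^sup>2) \<partial>M) \<longlonglongrightarrow> 0"
    proof (rule tendsto_sandwich[OF _ _ tendsto_const])
      show "\<forall>\<^sub>F n in sequentially. (\<integral>\<^sup>+ \<omega>. ennreal ((?J n t \<omega> - ?J n s \<omega> - (I t \<omega> - I s \<omega>))\<^sup>2) \<partial>M)
        \<le> 2 * (\<integral>\<^sup>+ \<omega>. ennreal ((?J n t \<omega> - I t \<omega>)\<^sup>2) \<partial>M) + 2 * (\<integral>\<^sup>+ \<omega>. ennreal ((?J n s \<omega> - I s \<omega>)\<^sup>2) \<partial>M)"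
      proof (intro always_eventually allI)
        fix n
        have 1: "?J n t \<omega> - ?J n s \<omega> - (I t \<omega> - I s \<omega>) = (?J n t \<omega> - I t \<omega>) + - (?J n s \<omega> - I s \<omega>)" for \<omega>
          by simp
        show "(\<integral>\<^sup>+ \<omega>. ennreal ((?J n t \<omega> - ?J n s \<omega> - (I t \<omega> - I s \<omega>))\<^sup>2) \<partial>M)
          \<le> 2 * (\<integral>\<^sup>+ \<omega>. ennreal ((?J n t \<omega> - I t \<omega>)\<^sup>2) \<partial>M) + 2 * (\<integral>\<^sup>+ \<omega>. ennreal ((?J n s \<omega> - I s \<omega>)\<^sup>2) \<partial>M)"
          unfolding 1
          using nn_integral_square_add_le[OF mJ[OF t] borel_measurable_uminus[OF mJ[OF st(1)]], of n n]
          by (simp only: power2_minus)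
      qed
      show "(\<lambda>n. 2 * (\<integral>\<^sup>+ \<omega>. ennreal ((?J n t \<omega> - I t \<omega>)\<^sup>2) \<partial>M) + 2 * (\<integral>\<^sup>+ \<omega>. ennreal ((?J n s \<omega> - I s \<omega>)\<^sup>2) \<partial>M)) \<longlonglongrightarrow> 0"
        using lim by simp
    qed simp
  qed
  show ?thesis
    unfolding ito_L2_approximation_def
    by (intro exI[of _ m] exI[of _ \<tau>] exI[of _ \<xi>] conjI allI ballI sd b e[OF t] L2)
qed

section \<open>Passage to the limit in the moments\<close>

lemma ito_increment_power:
  assumes st: "0 \<le> s" "s < t" and "k \<le> 4"
  shows "integrable M (\<lambda>\<omega>. (I t \<omega> - I s \<omega>) ^ k)"
    and ito_fourth_moment: "expectation (\<lambda>\<omega>. (I t \<omega> - I s \<omega>) ^ 4) \<le> 3 * S ^ 4 * (t - s)\<^sup>2"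
proof -
  obtain m \<tau> \<xi> where ap: "ito_L2_approximation i H I S s t m \<tau> \<xi>"
    using ito_L2_approx[OF st] by blast
  note sd = ito_L2_approximationD(1)[OF ap] and b = ito_L2_approximationD(2)[OF ap]
    and lim = ito_L2_approximationD(4)[OF ap]
  note p = L2_tendsto_power4[OF lim J_increment_power4[OF i sd refl refl st] J_fourth_moment[OF i sd refl refl st b]]
  show "expectation (\<lambda>\<omega>. (I t \<omega> - I s \<omega>) ^ 4) \<le> 3 * S ^ 4 * (t - s)\<^sup>2" by (rule p(2))
  have "(\<lambda>\<omega>. I t \<omega> - I s \<omega>) \<in> borel_measurable M"
    using ito_measurable_M st by (intro borel_measurable_diff) auto
  then show "integrable M (\<lambda>\<omega>. (I t \<omega> - I s \<omega>) ^ k)"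
    using integrable_power_le_4[OF _ p(1) \<open>k \<le> 4\<close>] by simp
qed

lemma L2_tendsto_const1: "L2_tendsto M (\<lambda>_ _. 1) (\<lambda>_. 1)"
  by (simp add: L2_tendsto_def)

lemma ito_martingale:
  assumes st: "0 \<le> s" "s < t" and Y: "bounded_F s Y"
  shows "expectation (\<lambda>\<omega>. Y \<omega> * (I t \<omega> - I s \<omega>)) = 0"
proof -
  obtain m \<tau> \<xi> where ap: "ito_L2_approximation i H I S s t m \<tau> \<xi>"
    using ito_L2_approx[OF st] by blast
  note sd = ito_L2_approximationD(1)[OF ap] and lim = ito_L2_approximationD(4)[OF ap]
  obtain C where C: "\<And>\<omega>. \<omega> \<in> space M \<Longrightarrow> \<bar>Y \<omega>\<bar> \<le> C" using Y unfolding bounded_F_def by blast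
  \<comment> \<open>Pairing with the constant sequence 1 specialises the convergence of products to
    a single factor.\<close>
  have "(\<lambda>n. 0) \<longlonglongrightarrow> expectation (\<lambda>\<omega>. Y \<omega> * (I t \<omega> - I s \<omega>))"
    using L2_tendsto_integral_mult[OF lim L2_tendsto_const1 measurable_F_M[OF bounded_F_measurable[OF Y] st(1)] C]
      J_martingale[OF i sd refl refl st bounded_F_measurable[OF Y] bounded_F_integrable[OF Y st(1)]] by simp
  then show ?thesis using LIMSEQ_unique tendsto_const by metis
qed

lemma ito_second_moment_upper:
  assumes st: "0 \<le> s" "s < t" and Y: "bounded_F s Y" "\<And>\<omega>. \<omega> \<in> space M \<Longrightarrow> 0 \<le> Y \<omega>"
  shows "expectation (\<lambda>\<omega>. Y \<omega> * (I t \<omega> - I s \<omega>)\<^sup>2) \<le> S\<^sup>2 * (t - s) * expectation Y"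
proof -
  obtain m \<tau> \<xi> where ap: "ito_L2_approximation i H I S s t m \<tau> \<xi>"
    using ito_L2_approx[OF st] by blast
  note sd = ito_L2_approximationD(1)[OF ap] and b = ito_L2_approximationD(2)[OF ap]
    and lim = ito_L2_approximationD(4)[OF ap]
  obtain C where C: "\<And>\<omega>. \<omega> \<in> space M \<Longrightarrow> \<bar>Y \<omega>\<bar> \<le> C" using Y unfolding bounded_F_def by blast
  show ?thesis
    by (rule LIMSEQ_le_const2[OF L2_tendsto_integral_mult[OF lim lim measurable_F_M[OF bounded_F_measurable[OF Y(1)] st(1)] C, folded power2_eq_square]])
       (use J_second_moment[OF i sd refl refl st Y b] in auto)
qed

text \<open>The lower bound for \<open>H^2\<close> is not inherited by the approximating integrands
  \<open>h\<close>. Instead \<open>h^2 + (h - H)^2 / z \<ge> (1 - z) * H^2\<close> for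
  \<open>0 < z < 1\<close>. The error term vanishes as \<open>n\<close> grows because the weight
  \<open>Y\<close> is bounded, and the factor \<open>1 - z\<close> is removed at the end by letting
  it approach 1.\<close>

lemma ito_second_moment_lower:
  assumes st: "0 \<le> s" "s < t" and Y: "bounded_F s Y" "\<And>\<omega>. \<omega> \<in> space M \<Longrightarrow> 0 \<le> Y \<omega>"
  shows "L * (t - s) * expectation Y \<le> expectation (\<lambda>\<omega>. Y \<omega> * (I t \<omega> - I s \<omega>)\<^sup>2)"
proof -
  obtain m \<tau> \<xi> where ap: "ito_L2_approximation i H I S s t m \<tau> \<xi>"
    using ito_L2_approx[OF st] by blast
  note sd = ito_L2_approximationD(1)[OF ap] and e = ito_L2_approximationD(3)[OF ap]
    and lim = ito_L2_approximationD(4)[OF ap]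
  obtain C where C: "\<And>\<omega>. \<omega> \<in> space M \<Longrightarrow> \<bar>Y \<omega>\<bar> \<le> C" using Y unfolding bounded_F_def by blast
  then have C0: "0 \<le> C" using not_empty by fastforce
  have t: "0 \<le> t" using st by simp
  have YM: "Y \<in> borel_measurable M" by (rule measurable_F_M[OF bounded_F_measurable[OF Y(1)] st(1)])
  let ?h = "\<lambda>n. simple_proc (m n) (\<tau> n) (\<xi> n)"
  let ?J = "\<lambda>n. simple_integral (W i) (m n) (\<tau> n) (\<xi> n)"
  define E where "E n = (\<integral>\<^sup>+ \<omega>. (\<integral>\<^sup>+ s\<in>{0..t}. ennreal ((?h n s \<omega> - H s \<omega>)\<^sup>2) \<partial>lborel) \<partial>M)" for n
  define A where "A n = expectation (\<lambda>\<omega>. Y \<omega> * (?J n t \<omega> - ?J n s \<omega>)\<^sup>2)" for n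
  have Alim: "A \<longlonglongrightarrow> expectation (\<lambda>\<omega>. Y \<omega> * (I t \<omega> - I s \<omega>)\<^sup>2)"
    unfolding A_def using L2_tendsto_integral_mult[OF lim lim YM C, folded power2_eq_square] .
  have A0: "0 \<le> A n" for n
    unfolding A_def using Y(2) by (intro integral_nonneg_AE) (auto intro!: AE_I2)
  have key: "ennreal ((1 - z) * (L * (t - s) * expectation Y)) \<le> ennreal (A n) + ennreal (C / z) * E n"
    if z: "0 < z" "z < 1" for z n
  proof -
    let ?a = "\<lambda>\<omega>. \<integral>\<^sup>+r. ennreal ((?h n r \<omega>)\<^sup>2) * indicator {s<..t} r \<partial>lborel"
    let ?d = "\<lambda>\<omega>. \<integral>\<^sup>+r. ennreal ((?h n r \<omega> - H r \<omega>)\<^sup>2) * indicator {0..t} r \<partial>lborel"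
    have pm: "(\<lambda>x. H (if snd x \<in> {0..t} then snd x else 0) (fst x)) \<in> borel_measurable (M \<Otimes>\<^sub>M lborel)"
      using ito t unfolding ito_integral_def by (intro progressively_measurable_pair) blast+
    have \<xi>m: "\<xi> n j \<in> borel_measurable M" if "j \<in> {..<m n}" for j
    proof -
      have "\<xi> n j \<in> borel_measurable (F (\<tau> n j))" using sd[of n] that unfolding simple_data_def by blast
      then show ?thesis by (rule measurable_F_M) (use simple_data_nonneg[OF sd[of n], of j] that in simp)
    qed
    have hm: "(\<lambda>x. ?h n (snd x) (fst x)) \<in> borel_measurable (M \<Otimes>\<^sub>M lborel)"
      unfolding simple_proc_def
      by (intro borel_measurable_sum borel_measurable_times measurable_compose[OF measurable_fst \<xi>m]
          measurable_compose[OF measurable_snd borel_measurable_indicator]) auto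
    \<comment> \<open>The time inside \<open>H\<close> is clamped to \<open>[0, t]\<close> to obtain
      joint measurability; the indicator makes the clamping invisible.\<close>
    define D where "D = (\<lambda>\<omega> r. ennreal ((?h n r \<omega> - H (if r \<in> {0..t} then r else 0) \<omega>)\<^sup>2) * indicator {0..t} r)"
    have "(\<lambda>x. D (fst x) (snd x)) \<in> borel_measurable (M \<Otimes>\<^sub>M lborel)"
      unfolding D_def
      by (intro borel_measurable_times_ennreal measurable_compose[OF _ measurable_ennreal] borel_measurable_power
          borel_measurable_diff hm pm measurable_compose[OF measurable_snd borel_measurable_indicator]) auto
    then have Dm: "case_prod D \<in> borel_measurable (M \<Otimes>\<^sub>M lborel)" by (simp only: split_beta')
    have D_eq: "D \<omega> r = ennreal ((?h n r \<omega> - H r \<omega>)\<^sup>2) * indicator {0..t} r" for \<omega> r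
      by (cases "r \<in> {0..t}") (simp_all add: D_def)
    have d_eq: "?d \<omega> = (\<integral>\<^sup>+r. D \<omega> r \<partial>lborel)" for \<omega>
      unfolding D_eq ..
    have dm: "?d \<in> borel_measurable M"
      unfolding d_eq by (rule lborel.borel_measurable_nn_integral[where f = D, OF Dm])
    have am: "?a \<in> borel_measurable M" by (rule h_sq_integral_measurable[OF i sd refl refl])
    have inner: "ennreal ((1 - z) * L * (t - s)) \<le> ?a \<omega> + ennreal (1 / z) * ?d \<omega>" if \<omega>: "\<omega> \<in> space M" for \<omega>
    proof -
      have "ennreal ((1 - z) * L * (t - s)) = (\<integral>\<^sup>+r. ennreal ((1 - z) * L) * indicator {s<..t} r \<partial>lborel)"
        using st z L by (simp add: nn_integral_cmult_indicator ennreal_mult')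
      also have "\<dots> \<le> (\<integral>\<^sup>+r. ennreal ((?h n r \<omega>)\<^sup>2) * indicator {s<..t} r + ennreal (1 / z) * D \<omega> r \<partial>lborel)"
      proof (rule nn_integral_mono)
        fix r
        show "ennreal ((1 - z) * L) * indicator {s<..t} r
          \<le> ennreal ((?h n r \<omega>)\<^sup>2) * indicator {s<..t} r + ennreal (1 / z) * D \<omega> r"
        proof (cases "r \<in> {s<..t}")
          case True
          then have r: "0 \<le> r" "r \<in> {0..t}" using st by auto
          have "z * a\<^sup>2 + 2 * (a * d) + d\<^sup>2 / z = (z * a + d)\<^sup>2 / z" for a d
            using z by (simp add: field_simps power2_eq_square)
          then have "0 \<le> z * (H r \<omega>)\<^sup>2 + 2 * (H r \<omega> * (?h n r \<omega> - H r \<omega>)) + (?h n r \<omega> - H r \<omega>)\<^sup>2 / z"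
            using z by simp
          moreover have "(?h n r \<omega>)\<^sup>2 \<ge> (H r \<omega>)\<^sup>2 + 2 * (H r \<omega> * (?h n r \<omega> - H r \<omega>))"
            using zero_le_power2[of "?h n r \<omega> - H r \<omega>"] by (simp add: power2_eq_square algebra_simps)
          moreover have "(1 - z) * L \<le> (1 - z) * (H r \<omega>)\<^sup>2" using HL[OF r(1) \<omega>] z by (intro mult_left_mono) auto
          ultimately have "(1 - z) * L \<le> (?h n r \<omega>)\<^sup>2 + 1 / z * (?h n r \<omega> - H r \<omega>)\<^sup>2"
            by (simp add: left_diff_distrib)
          then have "ennreal ((1 - z) * L) \<le> ennreal ((?h n r \<omega>)\<^sup>2 + 1 / z * (?h n r \<omega> - H r \<omega>)\<^sup>2)"
            by (rule ennreal_leI)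
          also have "\<dots> = ennreal ((?h n r \<omega>)\<^sup>2) + ennreal (1 / z) * ennreal ((?h n r \<omega> - H r \<omega>)\<^sup>2)"
            using z by (subst ennreal_plus) (simp_all add: ennreal_mult[symmetric])
          finally show ?thesis
            unfolding D_eq indicator_simps(1)[OF True] indicator_simps(1)[OF r(2)] mult_1_right .
        next
          case False
          show ?thesis unfolding indicator_simps(2)[OF False] by simp
        qed
      qed
      also have "\<dots> = ?a \<omega> + (\<integral>\<^sup>+r. ennreal (1 / z) * D \<omega> r \<partial>lborel)"
      proof (rule nn_integral_add)
        have "(\<lambda>r. ?h n r \<omega>) \<in> borel_measurable lborel" unfolding simple_proc_def by measurable
        then show "(\<lambda>r. ennreal ((?h n r \<omega>)\<^sup>2) * indicator {s<..t} r) \<in> borel_measurable lborel" by simp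
        have "D \<omega> \<in> borel_measurable lborel" using measurable_Pair2[OF Dm \<omega>] by simp
        then show "(\<lambda>r. ennreal (1 / z) * D \<omega> r) \<in> borel_measurable lborel" by simp
      qed
      also have "(\<integral>\<^sup>+r. ennreal (1 / z) * D \<omega> r \<partial>lborel) = ennreal (1 / z) * ?d \<omega>"
        unfolding d_eq by (rule nn_integral_cmult) (use measurable_Pair2[OF Dm \<omega>] in simp)
      finally show ?thesis .
    qed
    have "ennreal ((1 - z) * (L * (t - s) * expectation Y)) = ennreal (expectation (\<lambda>\<omega>. Y \<omega> * ((1 - z) * L * (t - s))))"
      by (simp add: mult_ac)
    also have "\<dots> = (\<integral>\<^sup>+\<omega>. ennreal (Y \<omega> * ((1 - z) * L * (t - s))) \<partial>M)"
      using bounded_F_integrable[OF Y(1) st(1)] Y(2) z L st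
      by (intro nn_integral_eq_integral[symmetric]) (auto intro!: AE_I2)
    also have "\<dots> \<le> (\<integral>\<^sup>+\<omega>. ennreal (Y \<omega>) * ?a \<omega> + ennreal (C / z) * ?d \<omega> \<partial>M)"
    proof (rule nn_integral_mono)
      fix \<omega> assume \<omega>: "\<omega> \<in> space M"
      have "ennreal (Y \<omega> * ((1 - z) * L * (t - s))) = ennreal (Y \<omega>) * ennreal ((1 - z) * L * (t - s))"
        using Y(2)[OF \<omega>] by (rule ennreal_mult')
      also have "\<dots> \<le> ennreal (Y \<omega>) * (?a \<omega> + ennreal (1 / z) * ?d \<omega>)"
        by (intro mult_left_mono inner \<omega>) simp
      also have "\<dots> = ennreal (Y \<omega>) * ?a \<omega> + ennreal (Y \<omega>) * ennreal (1 / z) * ?d \<omega>"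
        by (simp only: distrib_left mult.assoc)
      also have "ennreal (Y \<omega>) * ennreal (1 / z) = ennreal (Y \<omega> / z)"
        using Y(2)[OF \<omega>] z by (simp add: ennreal_mult'[symmetric])
      also have "ennreal (Y \<omega>) * ?a \<omega> + ennreal (Y \<omega> / z) * ?d \<omega> \<le> ennreal (Y \<omega>) * ?a \<omega> + ennreal (C / z) * ?d \<omega>"
        using C[OF \<omega>] z by (intro add_left_mono mult_right_mono ennreal_leI divide_right_mono) auto
      finally show "ennreal (Y \<omega> * ((1 - z) * L * (t - s))) \<le> ennreal (Y \<omega>) * ?a \<omega> + ennreal (C / z) * ?d \<omega>" .
    qed
    also have "\<dots> = (\<integral>\<^sup>+\<omega>. ennreal (Y \<omega>) * ?a \<omega> \<partial>M) + (\<integral>\<^sup>+\<omega>. ennreal (C / z) * ?d \<omega> \<partial>M)"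
      by (intro nn_integral_add borel_measurable_times_ennreal measurable_compose[OF YM measurable_ennreal] am dm borel_measurable_const)
    also have "(\<integral>\<^sup>+\<omega>. ennreal (Y \<omega>) * ?a \<omega> \<partial>M) = ennreal (A n)"
      unfolding A_def by (rule J_isometry[OF i sd refl refl st Y, symmetric])
    also have "(\<integral>\<^sup>+\<omega>. ennreal (C / z) * ?d \<omega> \<partial>M) = ennreal (C / z) * E n"
      unfolding E_def by (rule nn_integral_cmult[OF dm])
    finally show ?thesis .
  qed
  show ?thesis
  proof (rule field_le_mult_one_interval)
    fix z' :: real assume z': "0 < z'" "z' < 1"
    define z where "z = 1 - z'"
    have z: "0 < z" "z < 1" using z' by (auto simp: z_def)
    have "(\<lambda>n. ennreal (A n) + ennreal (C / z) * E n) \<longlonglongrightarrow> ennreal (expectation (\<lambda>\<omega>. Y \<omega> * (I t \<omega> - I s \<omega>)\<^sup>2)) + ennreal (C / z) * 0"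
      using e unfolding E_def[symmetric] by (intro tendsto_add tendsto_ennrealI Alim ennreal_tendsto_cmult) auto
    then have "ennreal ((1 - z) * (L * (t - s) * expectation Y)) \<le> ennreal (expectation (\<lambda>\<omega>. Y \<omega> * (I t \<omega> - I s \<omega>)\<^sup>2))"
      by (intro LIMSEQ_le_const) (use key[OF z] in auto)
    moreover have "0 \<le> expectation (\<lambda>\<omega>. Y \<omega> * (I t \<omega> - I s \<omega>)\<^sup>2)"
      using Y(2) by (intro integral_nonneg_AE) (auto intro!: AE_I2)
    ultimately show "z' * (L * (t - s) * expectation Y) \<le> expectation (\<lambda>\<omega>. Y \<omega> * (I t \<omega> - I s \<omega>)\<^sup>2)"
      by (simp add: z_def ennreal_le_iff)
  qed
qed

end

lemma ito_cross:
  assumes i: "i \<in> {1..N}" and ito: "ito_integral M F (W i) H I" and HS: "\<And>s \<omega>. 0 \<le> s \<Longrightarrow> \<omega> \<in> space M \<Longrightarrow> \<bar>H s \<omega>\<bar> \<le> S"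
    and j: "j \<in> {1..N}" and ito': "ito_integral M F (W j) H' I'" and HS': "\<And>s \<omega>. 0 \<le> s \<Longrightarrow> \<omega> \<in> space M \<Longrightarrow> \<bar>H' s \<omega>\<bar> \<le> S"
    and "i \<noteq> j" "0 \<le> S" and st: "0 \<le> s" "s < t" and Y: "bounded_F s Y"
  shows "expectation (\<lambda>\<omega>. Y \<omega> * ((I t \<omega> - I s \<omega>) * (I' t \<omega> - I' s \<omega>))) = 0"
proof -
  obtain m \<tau> \<xi> where ap: "ito_L2_approximation i H I S s t m \<tau> \<xi>"
    \<comment> \<open>The lower bound \<open>L\<close> is instantiated by 0, which holds for every
      square.\<close>
    using ito_L2_approx[OF i ito \<open>0 \<le> S\<close> order_refl HS zero_le_power2 st] by blast
  note sd = ito_L2_approximationD(1)[OF ap] and lim = ito_L2_approximationD(4)[OF ap]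
  obtain m' \<tau>' \<xi>' where ap': "ito_L2_approximation j H' I' S s t m' \<tau>' \<xi>'"
    using ito_L2_approx[OF j ito' \<open>0 \<le> S\<close> order_refl HS' zero_le_power2 st] by blast
  note sd' = ito_L2_approximationD(1)[OF ap'] and lim' = ito_L2_approximationD(4)[OF ap']
  obtain C where C: "\<And>\<omega>. \<omega> \<in> space M \<Longrightarrow> \<bar>Y \<omega>\<bar> \<le> C" using Y unfolding bounded_F_def by blast
  have "(\<lambda>n. 0) \<longlonglongrightarrow> expectation (\<lambda>\<omega>. Y \<omega> * ((I t \<omega> - I s \<omega>) * (I' t \<omega> - I' s \<omega>)))"
    using L2_tendsto_integral_mult[OF lim lim' measurable_F_M[OF bounded_F_measurable[OF Y] st(1)] C]
    unfolding simple_integral_cross[OF i j \<open>i \<noteq> j\<close> sd sd' st Y] .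
  then show ?thesis using LIMSEQ_unique tendsto_const by metis
qed

end

section \<open>The Lyapunov function\<close>

text \<open>The third-order remainder is controlled through \<open>q'\<^sup>2 \<le> 4 q D\<close> for the quadratic polynomial
  \<open>q(l) = w + 2 l B + l\<^sup>2 D\<close>.\<close>

lemma powr_taylor_upper:
  fixes \<eta> Z B D p :: real
  assumes \<eta>: "0 < \<eta>" "0 \<le> Z" "0 \<le> D" and BZD: "B\<^sup>2 \<le> Z * D" and p: "0 < p" "p \<le> 1"
  defines "w \<equiv> \<eta> + Z"
  shows "(w + 2 * B + D) powr (-p) \<le> w powr (-p) - p * w powr (-p-1) * (2 * B + D)
    + 2 * p * (p + 1) * w powr (-p-2) * B\<^sup>2 + 12 * \<eta> powr (-p-3/2) * (D * sqrt D)"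
proof -
  define q where "q l = w + 2 * l * B + l\<^sup>2 * D" for l :: real
  define q1 where "q1 l = 2 * B + 2 * l * D" for l :: real
  have bound: "\<eta> \<le> q l" "(q1 l)\<^sup>2 \<le> 4 * (q l * D)" for l
  proof -
    \<comment> \<open>For every \<open>l\<close> the two sides differ by exactly
      \<open>Z * D - B^2\<close>.\<close>
    have *: "(B + l * D)\<^sup>2 \<le> (q l - \<eta>) * D"
      using BZD unfolding q_def w_def by (simp add: power2_eq_square algebra_simps)
    have "0 \<le> q l - \<eta>"
    proof (cases "D = 0")
      case True
      then have "B = 0" using BZD by simp
      then show ?thesis using True \<eta> by (simp add: q_def w_def)
    next
      case False
      then have "D > 0" using \<eta> by simp
      moreover have "0 \<le> (q l - \<eta>) * D" using * zero_le_power2[of "B + l * D"] by linarith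
      ultimately show ?thesis by (simp add: zero_le_mult_iff)
    qed
    then show "\<eta> \<le> q l" by simp
    have "(q1 l)\<^sup>2 = 4 * (B + l * D)\<^sup>2" by (simp add: q1_def power2_eq_square algebra_simps)
    also have "\<dots> \<le> 4 * ((q l - \<eta>) * D)" using * by simp
    also have "\<dots> \<le> 4 * (q l * D)" using \<eta> by (intro mult_left_mono mult_right_mono) auto
    finally show "(q1 l)\<^sup>2 \<le> 4 * (q l * D)" .
  qed
  have qpos: "q l > 0" for l using bound(1)[of l] \<eta> by linarith
  have dq: "(q has_real_derivative q1 l) (at l)" for l
    unfolding q_def q1_def by (auto intro!: derivative_eq_intros simp: power2_eq_square)
  have dq1: "(q1 has_real_derivative 2 * D) (at l)" for l
    unfolding q1_def by (auto intro!: derivative_eq_intros)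
  \<comment> \<open>The derivatives of \<open>q^(-p)\<close> up to order three, for Maclaurin's
    formula on \<open>[0, 1]\<close>. As \<open>q\<close> is quadratic, \<open>q'' = 2 * D\<close>
    is constant and no further factor appears in the third.\<close>
  define h :: "nat \<Rightarrow> real \<Rightarrow> real" where
    "h m l = (if m = 0 then q l powr (-p) else if m = 1 then - p * q l powr (-p-1) * q1 l
      else if m = 2 then p * (p+1) * q l powr (-p-2) * (q1 l)\<^sup>2 - 2 * p * q l powr (-p-1) * D
      else - p * (p+1) * (p+2) * q l powr (-p-3) * (q1 l)^3 + 6 * p * (p+1) * q l powr (-p-2) * q1 l * D)"
    for m l
  have dpow: "((\<lambda>l. q l powr a) has_real_derivative a * q l powr (a - 1) * q1 l) (at l)" for a l
    using DERIV_powr[OF dq[of l] qpos[of l] DERIV_const, of a] qpos[of l]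
    by (simp add: powr_diff field_simps)
  have d0: "(h 0 has_real_derivative h 1 l) (at l)" for l
    unfolding h_def using dpow[of "-p" l] by simp
  have d1: "(h 1 has_real_derivative h 2 l) (at l)" for l
    unfolding h_def
    using DERIV_mult[OF DERIV_cmult[OF dpow[of "-p-1" l], of "-p"] dq1]
    by (simp add: power2_eq_square algebra_simps)
  have dq1sq: "((\<lambda>l. (q1 l)\<^sup>2) has_real_derivative 4 * q1 l * D) (at l)" for l
    using DERIV_power[OF dq1[of l], of 2] by (simp add: algebra_simps)
  have d2: "(h 2 has_real_derivative h 3 l) (at l)" for l
    unfolding h_def
    using DERIV_diff[OF DERIV_mult[OF DERIV_cmult[OF dpow[of "-p-2" l], of "p * (p+1)"] dq1sq]
        DERIV_cmult_right[OF DERIV_cmult[OF dpow[of "-p-1" l], of "2*p"], of D]]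
    by (simp add: power2_eq_square power3_eq_cube algebra_simps)
  have "\<exists>t>0. t < 1 \<and> q 1 powr (-p) = (\<Sum>m<3. h m 0 / fact m * 1 ^ m) + h 3 t / fact 3 * 1 ^ 3"
  proof (rule Maclaurin)
    have "(h m has_real_derivative h (Suc m) l) (at l)" if "m < 3" for m l
    proof -
      consider "m = 0" | "m = 1" | "m = 2" using \<open>m < 3\<close> by linarith
      then show ?thesis using d0 d1 d2 by cases (simp_all add: numeral_3_eq_3 numeral_2_eq_2)
    qed
    then show "\<forall>m t. m < 3 \<and> 0 \<le> t \<and> t \<le> 1 \<longrightarrow> (h m has_real_derivative h (Suc m) t) (at t)" by simp
  qed (auto simp: h_def)
  then obtain t where t: "q 1 powr (-p) = (\<Sum>m<3. h m 0 / fact m) + h 3 t / 6"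
    by (auto simp: fact_numeral)
  have "(\<Sum>m<3. h m 0 / fact m) = w powr (-p) - p * w powr (-p-1) * (2 * B + D)
    + 2 * p * (p + 1) * w powr (-p-2) * B\<^sup>2"
    by (simp add: h_def q_def q1_def numeral_3_eq_3 fact_numeral power2_eq_square field_simps)
  \<comment> \<open>Here \<open>72 = 8 * 6 + 12 * 2\<close>, using \<open>p \<le> 1\<close>;
    division by \<open>3!\<close> leaves the 12 of the statement.\<close>
  moreover have "h 3 t \<le> 72 * \<eta> powr (-p-3/2) * (D * sqrt D)"
  proof -
    have q1b: "\<bar>q1 t\<bar> \<le> 2 * sqrt (q t) * sqrt D"
    proof -
      have "\<bar>q1 t\<bar> = sqrt ((q1 t)\<^sup>2)" by simp
      also have "\<dots> \<le> sqrt (4 * (q t * D))" using bound(2)[of t] by (rule real_sqrt_le_mono)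
      finally show ?thesis by (simp add: real_sqrt_mult)
    qed
    \<comment> \<open>Since \<open>|q'|\<close> is at most \<open>2 * sqrt (q * D)\<close>, both
      summands of the third derivative are multiples of this one quantity, and its power of
      \<open>q\<close> is largest at the lower bound \<eta> of \<open>q\<close>.\<close>
    define R where "R = q t powr (-p-3/2) * (D * sqrt D)"
    have R: "0 \<le> R" using \<eta> by (simp add: R_def)
    have "-p-3/2 = (-p-2) + 1/2" by simp
    then have s1: "q t powr (-p-2) * sqrt (q t) = q t powr (-p-3/2)"
      using qpos[of t] by (simp only: powr_add powr_half_sqrt less_imp_le)
    have "-p-2 = (-p-3) + 1" by simp
    then have s2: "q t powr (-p-3) * q t = q t powr (-p-2)"
      using qpos[of t] by (simp only: powr_add powr_one less_imp_le)
    have e1: "q t powr (-p-2) * (sqrt (q t) * sqrt D) * D = R"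
      unfolding R_def s1[symmetric] by (simp add: mult_ac)
    have "sqrt (q t) ^ 3 * sqrt D ^ 3 = q t * sqrt (q t) * (D * sqrt D)"
      using qpos[of t] \<eta> by (simp add: power3_eq_cube)
    then have e2: "q t powr (-p-3) * (sqrt (q t) ^ 3 * sqrt D ^ 3) = R"
      unfolding R_def s1[symmetric] s2[symmetric] by (simp add: mult_ac)
    have "h 3 t \<le> p * (p+1) * (p+2) * q t powr (-p-3) * \<bar>q1 t\<bar>^3 + 6 * p * (p+1) * q t powr (-p-2) * \<bar>q1 t\<bar> * D"
    proof -
      have "- (\<bar>q1 t\<bar>^3) \<le> (q1 t)^3" by (simp add: power_abs[symmetric])
      then have "p * (p+1) * (p+2) * q t powr (-p-3) * (- (\<bar>q1 t\<bar>^3)) \<le> p * (p+1) * (p+2) * q t powr (-p-3) * (q1 t)^3"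
        using p by (intro mult_left_mono) auto
      moreover have "6 * p * (p+1) * q t powr (-p-2) * q1 t * D \<le> 6 * p * (p+1) * q t powr (-p-2) * \<bar>q1 t\<bar> * D"
        using p \<eta> by (intro mult_left_mono mult_right_mono) auto
      ultimately show ?thesis by (simp add: h_def)
    qed
    also have "\<dots> \<le> p * (p+1) * (p+2) * q t powr (-p-3) * (2 * sqrt (q t) * sqrt D)^3 + 6 * p * (p+1) * q t powr (-p-2) * (2 * sqrt (q t) * sqrt D) * D"
      using p \<eta> q1b by (intro add_mono mult_left_mono mult_right_mono power_mono) auto
    also have "\<dots> = 8 * p * (p+1) * (p+2) * (q t powr (-p-3) * (sqrt (q t) ^ 3 * sqrt D ^ 3))
        + 12 * p * (p+1) * (q t powr (-p-2) * (sqrt (q t) * sqrt D) * D)"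
      by (simp only: power_mult_distrib) (simp add: mult_ac)
    also have "\<dots> = (8 * p * (p+1) * (p+2) + 12 * p * (p+1)) * R"
      unfolding e1 e2 by (simp only: distrib_right)
    also have "\<dots> \<le> 72 * R"
    proof (rule mult_right_mono[OF _ R])
      have "p * (p+1) \<le> 1 * 2" using p by (intro mult_mono) auto
      moreover have "p * (p+1) * (p+2) \<le> 2 * 3" using p calculation by (intro mult_mono) auto
      ultimately show "8 * p * (p+1) * (p+2) + 12 * p * (p+1) \<le> 72" by linarith
    qed
    also have "\<dots> \<le> 72 * \<eta> powr (-p-3/2) * (D * sqrt D)"
    proof -
      have "q t powr (-p-3/2) \<le> \<eta> powr (-p-3/2)"
        using bound(1)[of t] \<eta> p by (intro powr_mono2') auto
      then show ?thesis unfolding R_def using \<eta> by (simp add: mult_right_mono mult.assoc)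
    qed
    finally show ?thesis .
  qed
  ultimately show ?thesis using t by (simp add: q_def)
qed

section \<open>Algebra of the spread of finitely many numbers\<close>

definition avg :: "'i set \<Rightarrow> ('i \<Rightarrow> real) \<Rightarrow> real" where
  "avg A x = (\<Sum>i\<in>A. x i) / real (card A)"

text \<open>The squared Euclidean distance of \<open>x\<close> to the line of constant
  vectors.\<close>

definition spread :: "'i set \<Rightarrow> ('i \<Rightarrow> real) \<Rightarrow> real" where
  "spread A x = (\<Sum>i\<in>A. (x i - avg A x)\<^sup>2)"

lemma spread_nonneg: "0 \<le> spread A x"
  unfolding spread_def by (intro sum_nonneg) simp

lemma avg_add: "avg A (\<lambda>i. x i + y i) = avg A x + avg A y"
  unfolding avg_def by (simp add: sum.distrib add_divide_distrib)

lemma sum_eq_card_avg: "finite A \<Longrightarrow> A \<noteq> {} \<Longrightarrow> (\<Sum>i\<in>A. x i) = real (card A) * avg A x"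
  unfolding avg_def by simp

lemma sum_centred: "finite A \<Longrightarrow> A \<noteq> {} \<Longrightarrow> (\<Sum>i\<in>A. x i - avg A x) = 0"
  by (simp add: sum_subtractf sum_eq_card_avg)

text \<open>A centred vector is orthogonal to the constants, so it suffices to centre one
  factor.\<close>

lemma sum_centred_mult:
  assumes "finite A" "A \<noteq> {}"
  shows "(\<Sum>i\<in>A. (x i - avg A x) * (y i - avg A y)) = (\<Sum>i\<in>A. (x i - avg A x) * y i)"
proof -
  have "(\<Sum>i\<in>A. (x i - avg A x) * (y i - avg A y)) = (\<Sum>i\<in>A. (x i - avg A x) * y i) - (\<Sum>i\<in>A. x i - avg A x) * avg A y"
    unfolding sum_distrib_right sum_subtractf[symmetric] by (simp add: right_diff_distrib)
  then show ?thesis using sum_centred[OF assms, of x] by simp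
qed

text \<open>The increment of the spread along a step thus has the exact form
  \<open>2 * B + D\<close> that the Taylor bound expects.\<close>

lemma spread_add:
  assumes "finite A" "A \<noteq> {}"
  shows "spread A (\<lambda>i. x i + d i) = spread A x + 2 * (\<Sum>i\<in>A. (x i - avg A x) * d i) + spread A d"
proof -
  have "spread A (\<lambda>i. x i + d i)
    = (\<Sum>i\<in>A. (x i - avg A x)\<^sup>2 + 2 * ((x i - avg A x) * (d i - avg A d)) + (d i - avg A d)\<^sup>2)"
    unfolding spread_def avg_add by (intro sum.cong refl) (simp add: power2_eq_square algebra_simps)
  also have "\<dots> = spread A x + 2 * (\<Sum>i\<in>A. (x i - avg A x) * (d i - avg A d)) + spread A d"
    by (simp only: sum.distrib sum_distrib_left[symmetric] spread_def)
  finally show ?thesis unfolding sum_centred_mult[OF assms] .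
qed

lemma spread_eq:
  assumes "finite A" "A \<noteq> {}"
  shows "spread A x = (\<Sum>i\<in>A. (x i)\<^sup>2) - (\<Sum>i\<in>A. x i)\<^sup>2 / real (card A)"
proof -
  have "spread A x = (\<Sum>i\<in>A. (x i - avg A x) * x i)"
    unfolding spread_def power2_eq_square sum_centred_mult[OF assms] ..
  also have "\<dots> = (\<Sum>i\<in>A. (x i)\<^sup>2) - avg A x * (\<Sum>i\<in>A. x i)"
    by (simp add: left_diff_distrib sum_subtractf sum_distrib_left power2_eq_square)
  finally show ?thesis by (simp add: avg_def power2_eq_square)
qed

lemma spread_le_sum_squares: "finite A \<Longrightarrow> A \<noteq> {} \<Longrightarrow> spread A x \<le> (\<Sum>i\<in>A. (x i)\<^sup>2)"
  by (simp add: spread_eq)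

text \<open>Cauchy-Schwarz for centred vectors; it supplies the condition
  \<open>B^2 \<le> Z * D\<close> of the Taylor bound.\<close>

lemma centred_inner_bound:
  assumes "finite A" "A \<noteq> {}"
  shows "(\<Sum>i\<in>A. (x i - avg A x) * d i)\<^sup>2 \<le> spread A x * spread A d"
  unfolding sum_centred_mult[OF assms, of x d, symmetric] spread_def by (rule Cauchy_Schwarz_ineq_sum)

text \<open>The quadratic part enters the Taylor bound with a negative sign and must be bounded from
  below. Young's inequality separates off the drift part \<open>d\<close> at the price of a fraction
  \<epsilon> of the martingale part \<open>v\<close>.\<close>

lemma spread_add_lower:
  assumes "0 < \<epsilon>"
  shows "(1 - \<epsilon>) * spread A v - spread A d / \<epsilon> \<le> spread A (\<lambda>i. d i + v i)"
proof -
  have "(1 - \<epsilon>) * a\<^sup>2 - b\<^sup>2 / \<epsilon> \<le> (b + a)\<^sup>2" for a b :: real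
  proof -
    have "2 * \<bar>a * b\<bar> \<le> \<epsilon> * a\<^sup>2 + b\<^sup>2 / \<epsilon>" using abs_mult_le_weighted[OF assms, of a b] by simp
    moreover have "(b + a)\<^sup>2 = a\<^sup>2 + b\<^sup>2 + 2 * (a * b)" by (simp add: power2_sum)
    moreover have "- \<bar>a * b\<bar> \<le> a * b" "0 \<le> b\<^sup>2" by auto
    moreover have "(1 - \<epsilon>) * a\<^sup>2 = a\<^sup>2 - \<epsilon> * a\<^sup>2" by (simp add: left_diff_distrib)
    ultimately show ?thesis by linarith
  qed
  then have "(\<Sum>i\<in>A. (1 - \<epsilon>) * (v i - avg A v)\<^sup>2 - (d i - avg A d)\<^sup>2 / \<epsilon>)
      \<le> (\<Sum>i\<in>A. ((d i - avg A d) + (v i - avg A v))\<^sup>2)"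
    by (intro sum_mono)
  also have "\<dots> = spread A (\<lambda>i. d i + v i)"
    unfolding spread_def avg_add by (intro sum.cong) (auto simp: algebra_simps)
  finally show ?thesis unfolding spread_def by (simp add: sum_subtractf sum_distrib_left sum_divide_distrib)
qed

lemma spread_add_upper: "spread A (\<lambda>i. d i + v i) \<le> 2 * spread A d + 2 * spread A v"
proof -
  have "spread A (\<lambda>i. d i + v i) = (\<Sum>i\<in>A. ((d i - avg A d) + (v i - avg A v))\<^sup>2)"
    unfolding spread_def avg_add by (intro sum.cong) (auto simp: algebra_simps)
  also have "\<dots> \<le> (\<Sum>i\<in>A. 2 * (d i - avg A d)\<^sup>2 + 2 * (v i - avg A v)\<^sup>2)"
    by (intro sum_mono sum_squares_bound2)
  finally show ?thesis unfolding spread_def by (simp add: sum.distrib sum_distrib_left)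
qed

lemma spread_eq_0:
  assumes "\<And>i j. i \<in> A \<Longrightarrow> j \<in> A \<Longrightarrow> x i = x j" "finite A"
  shows "spread A x = 0"
proof (cases "A = {}")
  case False
  then obtain k where k: "k \<in> A" by blast
  have "avg A x = x k"
    unfolding avg_def using assms(1)[OF _ k] False assms(2) by simp
  then show ?thesis unfolding spread_def using assms(1)[OF _ k] by simp
qed (simp add: spread_def)

text \<open>The sum of the coefficients of all remainder terms of one step, so that one constant
  serves for each of them. Here \<open>c\<close> measures the squared drift, and \<open>e1\<close>,
  \<open>e3\<close> are the occurring negative powers evaluated at their worst point \<eta>.\<close>

definition step_const :: "nat \<Rightarrow> real \<Rightarrow> real \<Rightarrow> real \<Rightarrow> real" where
  "step_const n G \<eta> p = (let e1 = \<eta> powr (-p-1); e3 = \<eta> powr (-p-3/2); c = real n * G\<^sup>2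
     in 5 * e1 + 12 * e3 + 9 * e1 * c + 12 * e3 * (c + 4 * c\<^sup>2) + 48 * e3 * real n)"

lemma step_const_nonneg: "0 \<le> step_const n G \<eta> p"
  unfolding step_const_def Let_def by (intro add_nonneg_nonneg mult_nonneg_nonneg) auto

text \<open>Taylor's formula for \<open>(\<eta> + spread A x)\<^sup>-\<^sup>p\<close> along the step \<open>\<beta> + v\<close>, where the drift part \<open>\<beta>\<close> is of
  order \<open>\<epsilon>\<^sup>2\<close> and the martingale part \<open>v\<close> of order \<open>\<epsilon>\<close>; the last summand collects the terms of order
  \<open>\<epsilon>\<^sup>3\<close>.\<close>

lemma spread_powr_step:
  fixes A :: "'i set" and x \<beta> v :: "'i \<Rightarrow> real" and \<eta> p \<epsilon> \<delta> G :: real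
  assumes A: "finite A" "A \<noteq> {}" and \<eta>: "0 < \<eta>" and p: "0 < p" "p \<le> 1"
    and \<epsilon>: "0 < \<epsilon>" "\<epsilon> \<le> 1" and \<delta>: "0 < \<delta>"
    and \<beta>: "\<And>i. i \<in> A \<Longrightarrow> \<bar>\<beta> i\<bar> \<le> G * \<epsilon>\<^sup>2"
  defines "c \<equiv> real (card A) * G\<^sup>2" and "Z \<equiv> spread A x"
  defines "w \<equiv> \<eta> + Z" and "L \<equiv> (\<Sum>i\<in>A. (x i - avg A x) * v i)"
    and "K \<equiv> step_const (card A) G \<eta> p"
  shows "(\<eta> + spread A (\<lambda>i. x i + (\<beta> i + v i))) powr (-p)
    \<le> w powr (-p) + \<epsilon>\<^sup>2 * (p * w powr (-p-1) * (\<delta> + c * Z / \<delta>)) - 2 * p * w powr (-p-1) * L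
      - p * w powr (-p-1) * spread A v + 2 * p * (p + 1) * w powr (-p-2) * L\<^sup>2
      + K * (\<epsilon> * (\<Sum>i\<in>A. (v i)\<^sup>2) + \<epsilon> ^ 3 + (\<Sum>i\<in>A. (v i) ^ 4) / \<epsilon>)"
proof -
  define e1 where "e1 = \<eta> powr (-p-1)"
  define e3 where "e3 = \<eta> powr (-p-3/2)"
  define R where "R = (\<Sum>i\<in>A. (x i - avg A x) * \<beta> i)"
  define D where "D = spread A (\<lambda>i. \<beta> i + v i)"
  define V where "V = (\<Sum>i\<in>A. (v i)\<^sup>2)"
  define Q where "Q = (\<Sum>i\<in>A. (v i) ^ 4)"
  define w1 where "w1 = w powr (-p-1)"
  define w2 where "w2 = w powr (-p-2)"
  have Z0: "0 \<le> Z" unfolding Z_def by (rule spread_nonneg)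
  have D0: "0 \<le> D" unfolding D_def by (rule spread_nonneg)
  have V0: "0 \<le> V" unfolding V_def by (intro sum_nonneg) simp
  have Q0: "0 \<le> Q" unfolding Q_def by (intro sum_nonneg) simp
  have c0: "0 \<le> c" unfolding c_def by simp
  have w: "0 < w" "\<eta> \<le> w" "Z \<le> w" using \<eta> Z0 by (auto simp: w_def)
  have B_eq: "(\<Sum>i\<in>A. (x i - avg A x) * (\<beta> i + v i)) = R + L"
    unfolding R_def L_def by (simp add: distrib_left sum.distrib)
  have BZD: "(R + L)\<^sup>2 \<le> Z * D"
    unfolding B_eq[symmetric] Z_def D_def by (rule centred_inner_bound[OF A])
  have taylor: "(\<eta> + spread A (\<lambda>i. x i + (\<beta> i + v i))) powr (-p)
    \<le> w powr (-p) - p * w1 * (2 * (R + L) + D) + 2 * p * (p + 1) * w2 * (R + L)\<^sup>2 + 12 * e3 * (D * sqrt D)"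
    using powr_taylor_upper[OF \<eta> Z0 D0 BZD p]
    unfolding spread_add[OF A] B_eq w1_def w2_def w_def e3_def Z_def D_def by (simp add: add.assoc)
  have pos: "0 \<le> w1" "0 \<le> w2" "0 \<le> e1" "0 \<le> e3" by (simp_all add: w1_def w2_def e1_def e3_def)
  have w1e: "w1 \<le> e1" unfolding w1_def e1_def using \<eta> w p by (intro powr_mono2') auto
  have w2Z: "w2 * Z \<le> w1"
  proof -
    have "-p-1 = (-p-2) + 1" by simp
    then have "w2 * w = w1" unfolding w1_def w2_def using w(1) by (simp only: powr_add powr_one less_imp_le)
    then show ?thesis using w(3) pos(2) by (metis mult_left_mono)
  qed
  have \<beta>2: "(\<Sum>i\<in>A. (\<beta> i)\<^sup>2) \<le> c * \<epsilon> ^ 4"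
  proof -
    have "(\<beta> i)\<^sup>2 \<le> G\<^sup>2 * \<epsilon> ^ 4" if "i \<in> A" for i
    proof -
      have "(\<beta> i)\<^sup>2 \<le> (G * \<epsilon>\<^sup>2)\<^sup>2" using power_mono[OF \<beta>[OF that], of 2] by simp
      then show ?thesis by (simp add: power_mult_distrib)
    qed
    from sum_bounded_above[of A, OF this] show ?thesis by (simp add: c_def mult_ac)
  qed
  have sp\<beta>: "spread A \<beta> \<le> c * \<epsilon> ^ 4" using spread_le_sum_squares[OF A, of \<beta>] \<beta>2 by linarith
  have spv: "spread A v \<le> V" "0 \<le> spread A v"
    using spread_le_sum_squares[OF A, of v] spread_nonneg by (auto simp: V_def)
  have R2: "R\<^sup>2 \<le> Z * (c * \<epsilon> ^ 4)"
    using centred_inner_bound[OF A, of x \<beta>] mult_left_mono[OF sp\<beta> Z0] unfolding R_def Z_def by linarith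
  have L2: "L\<^sup>2 \<le> Z * V"
    using centred_inner_bound[OF A, of x v] mult_left_mono[OF spv(1) Z0] unfolding L_def Z_def by linarith
  have eps: "\<epsilon> ^ 4 \<le> \<epsilon> ^ 3" "\<epsilon> ^ 4 / \<epsilon> = \<epsilon> ^ 3" "\<epsilon> ^ 5 \<le> \<epsilon> ^ 3" "\<epsilon> ^ 8 / \<epsilon> \<le> \<epsilon> ^ 3"
  proof -
    show "\<epsilon> ^ 4 \<le> \<epsilon> ^ 3" "\<epsilon> ^ 5 \<le> \<epsilon> ^ 3" using \<epsilon> by (auto intro!: power_decreasing)
    show "\<epsilon> ^ 4 / \<epsilon> = \<epsilon> ^ 3" using \<epsilon> by (simp add: power4_eq_xxxx power3_eq_cube)
    have "\<epsilon> ^ 8 / \<epsilon> = \<epsilon> ^ 7" using \<epsilon> by (simp add: field_simps flip: power_Suc)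
    also have "\<dots> \<le> \<epsilon> ^ 3" using \<epsilon> by (intro power_decreasing) auto
    finally show "\<epsilon> ^ 8 / \<epsilon> \<le> \<epsilon> ^ 3" .
  qed
  \<comment> \<open>Young's inequality with weight \<open>\<delta> * \<epsilon>^2\<close> splits the
    drift term, which is of order \<open>\<epsilon>^2 * sqrt Z\<close>, into a small constant
    \<delta>, paid for by the strict inequality between the coefficients, and a multiple of
    \<open>Z\<close>, which gains a power of \<open>w\<close>.\<close>
  have driftR: "- (2 * R) \<le> \<epsilon>\<^sup>2 * (\<delta> + c * Z / \<delta>)"
  proof -
    have "\<bar>1 * R\<bar> \<le> (\<delta> * \<epsilon>\<^sup>2 * 1\<^sup>2 + R\<^sup>2 / (\<delta> * \<epsilon>\<^sup>2)) / 2"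
      by (rule abs_mult_le_weighted) (use \<delta> \<epsilon> in simp)
    moreover have "R\<^sup>2 / (\<delta> * \<epsilon>\<^sup>2) \<le> (Z * (c * \<epsilon> ^ 4)) / (\<delta> * \<epsilon>\<^sup>2)"
      using R2 \<delta> by (intro divide_right_mono) auto
    moreover have "(Z * (c * \<epsilon> ^ 4)) / (\<delta> * \<epsilon>\<^sup>2) = \<epsilon>\<^sup>2 * (c * Z / \<delta>)"
      using \<epsilon> \<delta> by (simp add: field_simps power4_eq_xxxx power2_eq_square)
    ultimately show ?thesis by (simp add: distrib_left mult_ac)
  qed
  have T1a: "- (2 * p * w1 * R) \<le> \<epsilon>\<^sup>2 * (p * w1 * (\<delta> + c * Z / \<delta>))"
    using mult_left_mono[OF driftR, of "p * w1"] p pos by (simp add: mult_ac)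
  \<comment> \<open>The term with \<open>spread A v\<close> has to keep its full coefficient, since
    its expectation is the main negative contribution; the lost fraction \<epsilon> of it goes into
    the remainder.\<close>
  have T1b: "- (p * w1 * D) \<le> - (p * w1 * spread A v) + e1 * (\<epsilon> * V) + e1 * c * \<epsilon> ^ 3"
  proof -
    have "(1 - \<epsilon>) * spread A v - c * \<epsilon> ^ 3 \<le> D"
    proof -
      have "spread A \<beta> / \<epsilon> \<le> c * \<epsilon> ^ 4 / \<epsilon>" using sp\<beta> \<epsilon> by (intro divide_right_mono) auto
      then have "spread A \<beta> / \<epsilon> \<le> c * \<epsilon> ^ 3" using eps(2) by (simp flip: times_divide_eq_right)
      then show ?thesis using spread_add_lower[OF \<epsilon>(1), of A v \<beta>] unfolding D_def by linarith
    qed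
    then have "p * w1 * ((1 - \<epsilon>) * spread A v - c * \<epsilon> ^ 3) \<le> p * w1 * D"
      using p pos by (intro mult_left_mono) auto
    moreover have "p * w1 * (\<epsilon> * spread A v) \<le> e1 * (\<epsilon> * V)"
    proof (rule mult_mono)
      show "p * w1 \<le> e1" using mult_mono[of p 1 w1 e1] p w1e pos by simp
      show "\<epsilon> * spread A v \<le> \<epsilon> * V" using \<epsilon> spv by simp
    qed (use pos \<epsilon> spv in auto)
    moreover have "p * w1 * (c * \<epsilon> ^ 3) \<le> e1 * (c * \<epsilon> ^ 3)"
      using mult_mono[of p 1 w1 e1] p w1e pos c0 \<epsilon> by (intro mult_right_mono) auto
    ultimately show ?thesis by (simp add: algebra_simps)
  qed
  \<comment> \<open>Apart from the exact term \<open>L^2\<close>, everything carries a factor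
    \<open>Z\<close>, and \<open>w2 * Z \<le> w1 \<le> e1\<close>.\<close>
  have T2: "2 * p * (p + 1) * w2 * (R + L)\<^sup>2 \<le> 2 * p * (p + 1) * w2 * L\<^sup>2 + 4 * (e1 * (\<epsilon> * V)) + 8 * (e1 * c * \<epsilon> ^ 3)"
  proof -
    have "(R + L)\<^sup>2 \<le> L\<^sup>2 + \<epsilon> * L\<^sup>2 + (R\<^sup>2 + R\<^sup>2 / \<epsilon>)"
      using abs_mult_le_weighted[OF \<epsilon>(1), of L R] abs_ge_self[of "L * R"] by (simp add: power2_sum mult_ac)
    moreover have "R\<^sup>2 \<le> R\<^sup>2 / \<epsilon>" using \<epsilon> by (simp add: le_divide_eq mult_left_le)
    moreover have "R\<^sup>2 / \<epsilon> \<le> Z * (c * \<epsilon> ^ 3)"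
    proof -
      have "R\<^sup>2 / \<epsilon> \<le> Z * (c * \<epsilon> ^ 4) / \<epsilon>" using R2 \<epsilon> by (intro divide_right_mono) auto
      also have "\<dots> = Z * (c * (\<epsilon> ^ 4 / \<epsilon>))" by simp
      finally show ?thesis unfolding eps(2) .
    qed
    moreover have "\<epsilon> * L\<^sup>2 \<le> Z * (\<epsilon> * V)" using mult_left_mono[OF L2, of \<epsilon>] \<epsilon> by (simp add: mult_ac)
    ultimately have "(R + L)\<^sup>2 \<le> L\<^sup>2 + Z * (\<epsilon> * V + 2 * (c * \<epsilon> ^ 3))" by (simp add: distrib_left)
    then have "w2 * (R + L)\<^sup>2 \<le> w2 * (L\<^sup>2 + Z * (\<epsilon> * V + 2 * (c * \<epsilon> ^ 3)))"
      using pos by (intro mult_left_mono)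
    also have "\<dots> = w2 * L\<^sup>2 + (w2 * Z) * (\<epsilon> * V + 2 * (c * \<epsilon> ^ 3))" by (simp add: algebra_simps)
    also have "\<dots> \<le> w2 * L\<^sup>2 + e1 * (\<epsilon> * V + 2 * (c * \<epsilon> ^ 3))"
      using w2Z w1e V0 c0 \<epsilon> by (intro add_left_mono mult_right_mono) auto
    finally have "2 * p * (p + 1) * (w2 * (R + L)\<^sup>2) \<le> 2 * p * (p + 1) * (w2 * L\<^sup>2 + e1 * (\<epsilon> * V + 2 * (c * \<epsilon> ^ 3)))"
      using p by (intro mult_left_mono) auto
    also have "\<dots> = 2 * p * (p + 1) * w2 * L\<^sup>2 + 2 * p * (p + 1) * (e1 * (\<epsilon> * V + 2 * (c * \<epsilon> ^ 3)))"
      by (simp add: algebra_simps)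
    also have "\<dots> \<le> 2 * p * (p + 1) * w2 * L\<^sup>2 + 4 * (e1 * (\<epsilon> * V + 2 * (c * \<epsilon> ^ 3)))"
    proof (intro add_left_mono mult_right_mono)
      show "2 * p * (p + 1) \<le> 4" using mult_mono[of p 1 "p + 1" 2] p by simp
    qed (use pos \<epsilon> V0 c0 in simp)
    finally show ?thesis by (simp add: algebra_simps)
  qed
  have T3: "12 * e3 * (D * sqrt D) \<le> 12 * (e3 * (\<epsilon> * V)) + 12 * e3 * (c + 4 * c\<^sup>2) * \<epsilon> ^ 3 + 48 * e3 * real (card A) * (Q / \<epsilon>)"
  proof -
    have D_le: "D \<le> 2 * (c * \<epsilon> ^ 4) + 2 * V"
      using spread_add_upper[of A \<beta> v] sp\<beta> spv unfolding D_def by linarith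
    have V2: "V\<^sup>2 \<le> real (card A) * Q"
      using Cauchy_Schwarz_ineq_sum[of "\<lambda>_. 1" "\<lambda>i. (v i)\<^sup>2" A] by (simp add: V_def Q_def)
    have "D\<^sup>2 \<le> (2 * (c * \<epsilon> ^ 4) + 2 * V)\<^sup>2" using D_le D0 by (rule power_mono)
    also have "\<dots> \<le> 2 * (2 * (c * \<epsilon> ^ 4))\<^sup>2 + 2 * (2 * V)\<^sup>2" by (rule sum_squares_bound2)
    also have "\<dots> = 8 * c\<^sup>2 * \<epsilon> ^ 8 + 8 * V\<^sup>2" by (simp add: power_mult_distrib)
    also have "\<dots> \<le> 8 * c\<^sup>2 * \<epsilon> ^ 8 + 8 * (real (card A) * Q)" using V2 by simp
    finally have "D\<^sup>2 / \<epsilon> \<le> (8 * c\<^sup>2 * \<epsilon> ^ 8 + 8 * (real (card A) * Q)) / \<epsilon>"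
      using \<epsilon> by (intro divide_right_mono) auto
    also have "\<dots> = 8 * c\<^sup>2 * (\<epsilon> ^ 8 / \<epsilon>) + 8 * real (card A) * (Q / \<epsilon>)" by (simp add: add_divide_distrib)
    also have "\<dots> \<le> 8 * c\<^sup>2 * \<epsilon> ^ 3 + 8 * real (card A) * (Q / \<epsilon>)"
      using eps(4) by (intro add_right_mono mult_left_mono) auto
    finally have D2: "D\<^sup>2 / \<epsilon> \<le> 8 * c\<^sup>2 * \<epsilon> ^ 3 + 8 * real (card A) * (Q / \<epsilon>)" .
    have "\<epsilon> * D \<le> \<epsilon> * (2 * (c * \<epsilon> ^ 4) + 2 * V)" using D_le \<epsilon> by (intro mult_left_mono) auto
    also have "\<dots> = 2 * c * \<epsilon> ^ 5 + 2 * (\<epsilon> * V)" by (simp add: algebra_simps numeral_eq_Suc)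
    also have "\<dots> \<le> 2 * c * \<epsilon> ^ 3 + 2 * (\<epsilon> * V)" using eps(3) c0 by (intro add_right_mono mult_left_mono) auto
    finally have D1: "\<epsilon> * D \<le> 2 * c * \<epsilon> ^ 3 + 2 * (\<epsilon> * V)" .
    \<comment> \<open>Young's inequality with weight \<epsilon> trades the power 3/2 for
      \<open>\<epsilon> * D\<close> and \<open>D^2 / \<epsilon>\<close>, that is, for second and
      fourth powers of \<open>v\<close>; after taking expectations both are of order
      \<open>\<epsilon>^3\<close>.\<close>
    have "D * sqrt D \<le> (\<epsilon> * D + D\<^sup>2 / \<epsilon>) / 2"
    proof -
      have "\<bar>sqrt D * D\<bar> \<le> (\<epsilon> * (sqrt D)\<^sup>2 + D\<^sup>2 / \<epsilon>) / 2" by (rule abs_mult_le_weighted[OF \<epsilon>(1)])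
      then show ?thesis using D0 by (simp add: mult.commute)
    qed
    also have "\<dots> \<le> \<epsilon> * V + (c + 4 * c\<^sup>2) * \<epsilon> ^ 3 + 4 * real (card A) * (Q / \<epsilon>)"
      using D1 D2 by (simp add: algebra_simps)
    finally have "12 * e3 * (D * sqrt D) \<le> 12 * e3 * (\<epsilon> * V + (c + 4 * c\<^sup>2) * \<epsilon> ^ 3 + 4 * real (card A) * (Q / \<epsilon>))"
      using pos by (intro mult_left_mono) auto
    then show ?thesis by (simp add: algebra_simps)
  qed
  define k1 where "k1 = 12 * e3 * (c + 4 * c\<^sup>2)"
  define k2 where "k2 = 48 * e3 * real (card A)"
  have k: "0 \<le> k1" "0 \<le> k2" using pos c0 by (auto simp: k1_def k2_def)
  \<comment> \<open>The coefficients are collected from the estimates above: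
    \<open>5 = 1 + 4\<close> and \<open>9 = 1 + 8\<close> from the first-order and second-order
    terms, 12 from the Taylor remainder.\<close>
  have KK: "5 * (e1 * (\<epsilon> * V)) + 12 * (e3 * (\<epsilon> * V)) + 9 * (e1 * c * \<epsilon> ^ 3) + k1 * \<epsilon> ^ 3 + k2 * (Q / \<epsilon>)
    \<le> K * (\<epsilon> * V + \<epsilon> ^ 3 + Q / \<epsilon>)"
  proof -
    have K: "K = 5 * e1 + 12 * e3 + 9 * e1 * c + k1 + k2" by (simp add: K_def step_const_def Let_def e1_def e3_def c_def k1_def k2_def)
    have "5 * e1 + 12 * e3 \<le> K" "9 * e1 * c + k1 \<le> K" "k2 \<le> K"
      using k pos c0 unfolding K by (auto intro!: add_nonneg_nonneg mult_nonneg_nonneg)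
    then have "(5 * e1 + 12 * e3) * (\<epsilon> * V) + (9 * e1 * c + k1) * \<epsilon> ^ 3 + k2 * (Q / \<epsilon>)
      \<le> K * (\<epsilon> * V) + K * \<epsilon> ^ 3 + K * (Q / \<epsilon>)"
      using \<epsilon> V0 Q0 by (intro add_mono mult_right_mono) auto
    then show ?thesis by (simp add: algebra_simps)
  qed
  have eq: "p * w1 * (2 * (R + L) + D) = 2 * p * w1 * R + 2 * p * w1 * L + p * w1 * D" by (simp add: algebra_simps)
  have comb: "x \<le> b + r' - l - s + q + k"
    if "x \<le> b - (r + l + d) + t2 + t3" "- r \<le> r'" "- d \<le> - s + e + f" "t2 \<le> q + 4 * e + 8 * f"
      "t3 \<le> 12 * g + h + j" "5 * e + 12 * g + 9 * f + h + j \<le> k" for x b r l d t2 t3 r' s e f q g h j k :: real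
    using that by linarith
  show ?thesis
    unfolding w1_def[symmetric] w2_def[symmetric] V_def[symmetric] Q_def[symmetric]
    by (rule comb[OF taylor[unfolded eq] T1a T1b T2 T3[folded k1_def k2_def] KK])
qed

text \<open>The generator applied to \<open>t\<^sup>2 w\<^sup>-\<^sup>p\<close> is bounded above uniformly in \<open>\<eta>\<close>: for small \<open>w\<close> the term of
  order \<open>t\<^sup>2 w\<^sup>-\<^sup>p\<^sup>-\<^sup>1\<close> dominates and is negative, and the factor \<open>t\<^sup>2\<close> makes the bound independent of the
  initial value.\<close>

lemma generator_bound:
  fixes p \<delta> c T b B :: real
  assumes p: "0 < p" "p \<le> 1" and \<delta>: "0 < \<delta>" and c: "0 \<le> c" and T: "0 < T" and b: "0 \<le> b"
    and B: "2 * (p + 1) * b + 2 * \<delta> \<le> B"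
  obtains C where "0 \<le> C"
    "\<And>t w Z. 0 < t \<Longrightarrow> t \<le> T \<Longrightarrow> 0 < w \<Longrightarrow> 0 \<le> Z \<Longrightarrow> Z \<le> w \<Longrightarrow>
      2 * t * w powr (-p) + t\<^sup>2 * (p * w powr (-p-1) * (\<delta> + c * Z / \<delta>)) - t\<^sup>2 * p * B * w powr (-p-1)
        + 2 * t\<^sup>2 * p * (p + 1) * b * (w powr (-p-2) * Z) \<le> C"
proof
  \<comment> \<open>For \<open>t \<le> T\<close>, \<kappa> collects the coefficients of
    \<open>t * w^(-p)\<close>: 2 from the derivative of \<open>t^2\<close> and the rest from the
    drift. \<open>C\<close> is the value of \<open>\<kappa> * t * w^(-p)\<close> at
    \<open>t = T\<close> and \<open>w = T * p * \<delta> / \<kappa>\<close>.\<close>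
  define \<kappa> where "\<kappa> = 2 + T * p * c / \<delta>"
  define C where "C = \<kappa> * ((p * \<delta> / \<kappa>) powr (-p) * T powr (1 - p))"
  have \<kappa>: "\<kappa> > 0" unfolding \<kappa>_def using T p c \<delta> by (intro add_pos_nonneg) auto
  show C0: "0 \<le> C" unfolding C_def using \<kappa> by (intro mult_nonneg_nonneg) auto
  fix t w Z :: real assume t: "0 < t" "t \<le> T" and w: "0 < w" and Z: "0 \<le> Z" "Z \<le> w"
  define w0 where "w0 = w powr (-p)"
  define w1 where "w1 = w powr (-p-1)"
  define w2 where "w2 = w powr (-p-2)"
  have pos: "0 \<le> w0" "0 \<le> w1" "0 \<le> w2" by (simp_all add: w0_def w1_def w2_def)
  have "-p = (-p-1) + 1" "-p-1 = (-p-2) + 1" by simp_all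
  then have ww: "w1 * w = w0" "w2 * w = w1"
    unfolding w0_def w1_def w2_def using w by (metis powr_add powr_one less_imp_le)+
  have Z1: "w1 * Z \<le> w0" "w2 * Z \<le> w1" using mult_left_mono[OF Z(2)] pos ww by metis+
  have "2 * t * w0 + t\<^sup>2 * (p * w1 * (\<delta> + c * Z / \<delta>)) - t\<^sup>2 * p * B * w1 + 2 * t\<^sup>2 * p * (p + 1) * b * (w2 * Z)
    = 2 * t * w0 + t\<^sup>2 * p * \<delta> * w1 + t\<^sup>2 * p * c / \<delta> * (w1 * Z) - t\<^sup>2 * p * B * w1 + 2 * t\<^sup>2 * p * (p + 1) * b * (w2 * Z)"
    by (simp add: algebra_simps)
  \<comment> \<open>Of the two \<delta> contained in the bound for \<open>B\<close>, one cancels the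
    drift error and the other remains as the negative term.\<close>
  also have "\<dots> \<le> 2 * t * w0 + t\<^sup>2 * p * \<delta> * w1 + t\<^sup>2 * p * c / \<delta> * w0 - t\<^sup>2 * p * (2 * (p + 1) * b + 2 * \<delta>) * w1 + 2 * t\<^sup>2 * p * (p + 1) * b * w1"
    using Z1 B p c \<delta> b pos by (intro add_mono diff_mono mult_left_mono mult_right_mono order_refl) auto
  also have "\<dots> = t * w0 * (2 + t * p * c / \<delta>) - t\<^sup>2 * p * \<delta> * w1"
    by (simp add: algebra_simps power2_eq_square)
  also have "\<dots> \<le> t * w0 * \<kappa> - t\<^sup>2 * p * \<delta> * w1"
    unfolding \<kappa>_def using t p c \<delta> pos by (intro diff_right_mono mult_left_mono add_left_mono divide_right_mono mult_right_mono) auto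
  also have "\<dots> \<le> C"
  \<comment> \<open>Below this threshold the negative term of order \<open>w^(-p-1)\<close>
    outweighs the positive one; above it \<open>w^(-p)\<close> is bounded. Since the threshold is
    proportional to \<open>t\<close>, the bound is a multiple of \<open>t^(1-p)\<close>, which stays
    bounded because \<open>p \<le> 1\<close>.\<close>
  proof (cases "w \<le> t * p * \<delta> / \<kappa>")
    case True
    then have "w * \<kappa> \<le> t * p * \<delta>" using \<kappa> by (simp add: le_divide_eq)
    then have "t * w1 * (w * \<kappa>) \<le> t * w1 * (t * p * \<delta>)" using t pos by (intro mult_left_mono) auto
    then have "t * w0 * \<kappa> \<le> t\<^sup>2 * p * \<delta> * w1"
      unfolding ww(1)[symmetric] by (simp add: power2_eq_square mult_ac)
    then show ?thesis using C0 by linarith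
  next
    case False
    then have "w0 \<le> (t * p * \<delta> / \<kappa>) powr (-p)"
      unfolding w0_def using p t \<delta> \<kappa> by (intro powr_mono2') auto
    also have "t * p * \<delta> / \<kappa> = t * (p * \<delta> / \<kappa>)" by simp
    also have "(t * (p * \<delta> / \<kappa>)) powr (-p) = t powr (-p) * (p * \<delta> / \<kappa>) powr (-p)"
      by (rule powr_mult)
    finally have "t * w0 \<le> t * (t powr (-p) * (p * \<delta> / \<kappa>) powr (-p))" using t by (intro mult_left_mono) auto
    also have "\<dots> = t powr (1 - p) * (p * \<delta> / \<kappa>) powr (-p)"
      using t powr_add[of t 1 "-p"] by simp
    also have "\<dots> \<le> T powr (1 - p) * (p * \<delta> / \<kappa>) powr (-p)"
      using t p by (intro mult_right_mono powr_mono2) auto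
    finally have "t * w0 * \<kappa> \<le> C" unfolding C_def using \<kappa> by (simp add: mult_ac mult_right_mono)
    moreover have "0 \<le> t\<^sup>2 * p * \<delta> * w1" using p \<delta> pos by auto
    ultimately show ?thesis by linarith
  qed
  finally show "2 * t * w powr (-p) + t\<^sup>2 * (p * w powr (-p-1) * (\<delta> + c * Z / \<delta>)) - t\<^sup>2 * p * B * w powr (-p-1)
        + 2 * t\<^sup>2 * p * (p + 1) * b * (w powr (-p-2) * Z) \<le> C"
    by (simp only: w0_def w1_def w2_def)
qed

section \<open>Diffusions with bounded coefficients\<close>

lemma continuous_on_avg:
  assumes "\<And>i. i \<in> A \<Longrightarrow> continuous_on T (x i)"
  shows "continuous_on T (\<lambda>t. avg A (\<lambda>i. x i t))"
  unfolding avg_def divide_inverse by (intro continuous_intros assms)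

lemma continuous_on_spread:
  assumes "\<And>i. i \<in> A \<Longrightarrow> continuous_on T (x i)"
  shows "continuous_on T (\<lambda>t. spread A (\<lambda>i. x i t))"
  unfolding spread_def by (intro continuous_intros continuous_on_avg assms)

lemma borel_measurable_avg:
  assumes "\<And>i. i \<in> A \<Longrightarrow> x i \<in> borel_measurable M"
  shows "(\<lambda>\<omega>. avg A (\<lambda>i. x i \<omega>)) \<in> borel_measurable M"
  unfolding avg_def by (intro borel_measurable_divide borel_measurable_sum borel_measurable_const assms)

lemma borel_measurable_spread:
  assumes "\<And>i. i \<in> A \<Longrightarrow> x i \<in> borel_measurable M"
  shows "(\<lambda>\<omega>. spread A (\<lambda>i. x i \<omega>)) \<in> borel_measurable M"
  unfolding spread_def
  by (intro borel_measurable_sum borel_measurable_power borel_measurable_diff borel_measurable_avg assms)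

text \<open>A continuous semimartingale whose drift is bounded by \<open>G\<close> and whose components have independent
  noises with squared volatility in \<open>[a, b]\<close>, expressed through the conditional moments of the increments
  of the martingale parts \<open>I i\<close>.\<close>

locale bounded_diffusion = brownian_filtration M F N W
  for M :: "'a measure" and F N W +
  fixes A :: "nat set" and X I :: "nat \<Rightarrow> real \<Rightarrow> 'a \<Rightarrow> real" and G a b :: real
  assumes A: "finite A" "A \<noteq> {}"
    and X_measurable: "\<And>i t. i \<in> A \<Longrightarrow> 0 \<le> t \<Longrightarrow> X i t \<in> borel_measurable (F t)"
    and X_continuous: "\<And>i \<omega>. i \<in> A \<Longrightarrow> \<omega> \<in> space M \<Longrightarrow> continuous_on {0..} (\<lambda>t. X i t \<omega>)"
    and I_measurable: "\<And>i t. i \<in> A \<Longrightarrow> 0 \<le> t \<Longrightarrow> I i t \<in> borel_measurable (F t)"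
    and drift: "\<And>i. i \<in> A \<Longrightarrow> AE \<omega> in M. \<forall>s t. 0 \<le> s \<and> s \<le> t \<longrightarrow>
      \<bar>X i t \<omega> - X i s \<omega> - (I i t \<omega> - I i s \<omega>)\<bar> \<le> G * (t - s)"
    and I_power: "\<And>i s t k. i \<in> A \<Longrightarrow> 0 \<le> s \<Longrightarrow> s < t \<Longrightarrow> k \<le> 4 \<Longrightarrow> integrable M (\<lambda>\<omega>. (I i t \<omega> - I i s \<omega>) ^ k)"
    and I_martingale: "\<And>i s t Y. i \<in> A \<Longrightarrow> 0 \<le> s \<Longrightarrow> s < t \<Longrightarrow> bounded_F s Y \<Longrightarrow>
      expectation (\<lambda>\<omega>. Y \<omega> * (I i t \<omega> - I i s \<omega>)) = 0"
    and I_cross: "\<And>i j s t Y. i \<in> A \<Longrightarrow> j \<in> A \<Longrightarrow> i \<noteq> j \<Longrightarrow> 0 \<le> s \<Longrightarrow> s < t \<Longrightarrow> bounded_F s Y \<Longrightarrow>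
      expectation (\<lambda>\<omega>. Y \<omega> * ((I i t \<omega> - I i s \<omega>) * (I j t \<omega> - I j s \<omega>))) = 0"
    and I_lower: "\<And>i s t Y. i \<in> A \<Longrightarrow> 0 \<le> s \<Longrightarrow> s < t \<Longrightarrow> bounded_F s Y \<Longrightarrow> (\<And>\<omega>. \<omega> \<in> space M \<Longrightarrow> 0 \<le> Y \<omega>) \<Longrightarrow>
      a * (t - s) * expectation Y \<le> expectation (\<lambda>\<omega>. Y \<omega> * (I i t \<omega> - I i s \<omega>)\<^sup>2)"
    and I_upper: "\<And>i s t Y. i \<in> A \<Longrightarrow> 0 \<le> s \<Longrightarrow> s < t \<Longrightarrow> bounded_F s Y \<Longrightarrow> (\<And>\<omega>. \<omega> \<in> space M \<Longrightarrow> 0 \<le> Y \<omega>) \<Longrightarrow>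
      expectation (\<lambda>\<omega>. Y \<omega> * (I i t \<omega> - I i s \<omega>)\<^sup>2) \<le> b * (t - s) * expectation Y"
    and I_fourth: "\<And>i s t. i \<in> A \<Longrightarrow> 0 \<le> s \<Longrightarrow> s < t \<Longrightarrow>
      expectation (\<lambda>\<omega>. (I i t \<omega> - I i s \<omega>) ^ 4) \<le> 3 * b\<^sup>2 * (t - s)\<^sup>2"
    and b: "0 < b" and ab: "2 * b < (real (card A) - 1) * a"
begin

section \<open>Moments of the martingale increments\<close>

definition incr :: "real \<Rightarrow> real \<Rightarrow> nat \<Rightarrow> 'a \<Rightarrow> real" where
  "incr s t i \<omega> = I i t \<omega> - I i s \<omega>"

lemma incr_measurable: "i \<in> A \<Longrightarrow> 0 \<le> s \<Longrightarrow> s < t \<Longrightarrow> incr s t i \<in> borel_measurable M"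
  unfolding incr_def using measurable_F_M[OF I_measurable] by (intro borel_measurable_diff) auto

lemma incr_mult_integrable:
  assumes "i \<in> A" "j \<in> A" "0 \<le> s" "s < t" "bounded_F s Y"
  shows "integrable M (\<lambda>\<omega>. Y \<omega> * (incr s t i \<omega> * incr s t j \<omega>))"
  using I_power[of i s t 2] I_power[of j s t 2] assms
  by (intro bounded_F_integrable_mult[OF assms(5,3)] integrable_mult_of_squares incr_measurable) (auto simp: incr_def)

lemma incr_linear:
  assumes st: "0 \<le> s" "s < t" and y: "\<And>i. i \<in> A \<Longrightarrow> bounded_F s (y i)"
  shows "integrable M (\<lambda>\<omega>. \<Sum>i\<in>A. y i \<omega> * incr s t i \<omega>)"
    and "expectation (\<lambda>\<omega>. \<Sum>i\<in>A. y i \<omega> * incr s t i \<omega>) = 0"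
proof -
  have i: "integrable M (\<lambda>\<omega>. y i \<omega> * incr s t i \<omega>)" if "i \<in> A" for i
    using bounded_F_integrable_mult[OF y[OF that] st(1) I_power[OF that st, of 1]] by (simp add: incr_def)
  then show "integrable M (\<lambda>\<omega>. \<Sum>i\<in>A. y i \<omega> * incr s t i \<omega>)" by simp
  show "expectation (\<lambda>\<omega>. \<Sum>i\<in>A. y i \<omega> * incr s t i \<omega>) = 0"
    using i I_martingale[OF _ st y] by (simp add: incr_def)
qed

text \<open>The mixed products have mean zero by \<open>I_cross\<close>, so only the diagonal of the
  double sum survives.\<close>

lemma incr_quadratic:
  assumes st: "0 \<le> s" "s < t" and Y: "bounded_F s Y" and y: "\<And>i. i \<in> A \<Longrightarrow> bounded_F s (y i)"
  shows "integrable M (\<lambda>\<omega>. Y \<omega> * (\<Sum>i\<in>A. y i \<omega> * incr s t i \<omega>)\<^sup>2)"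
    and "expectation (\<lambda>\<omega>. Y \<omega> * (\<Sum>i\<in>A. y i \<omega> * incr s t i \<omega>)\<^sup>2)
      = (\<Sum>i\<in>A. expectation (\<lambda>\<omega>. (Y \<omega> * (y i \<omega>)\<^sup>2) * (incr s t i \<omega>)\<^sup>2))"
proof -
  have b: "bounded_F s (\<lambda>\<omega>. Y \<omega> * (y i \<omega> * y j \<omega>))" if "i \<in> A" "j \<in> A" for i j
    by (intro bounded_F_mult Y y that)
  have int: "integrable M (\<lambda>\<omega>. (Y \<omega> * (y i \<omega> * y j \<omega>)) * (incr s t i \<omega> * incr s t j \<omega>))" if "i \<in> A" "j \<in> A" for i j
    by (rule incr_mult_integrable[OF that st b[OF that]])
  have eq: "(\<lambda>\<omega>. Y \<omega> * (\<Sum>i\<in>A. y i \<omega> * incr s t i \<omega>)\<^sup>2)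
    = (\<lambda>\<omega>. \<Sum>i\<in>A. \<Sum>j\<in>A. (Y \<omega> * (y i \<omega> * y j \<omega>)) * (incr s t i \<omega> * incr s t j \<omega>))"
  proof (rule ext)
    fix \<omega>
    have "Y \<omega> * (\<Sum>i\<in>A. y i \<omega> * incr s t i \<omega>)\<^sup>2
      = Y \<omega> * (\<Sum>i\<in>A. \<Sum>j\<in>A. (y i \<omega> * incr s t i \<omega>) * (y j \<omega> * incr s t j \<omega>))"
      by (simp only: power2_eq_square sum_product)
    also have "\<dots> = (\<Sum>i\<in>A. \<Sum>j\<in>A. Y \<omega> * ((y i \<omega> * incr s t i \<omega>) * (y j \<omega> * incr s t j \<omega>)))"
      by (simp only: sum_distrib_left)
    also have "\<dots> = (\<Sum>i\<in>A. \<Sum>j\<in>A. (Y \<omega> * (y i \<omega> * y j \<omega>)) * (incr s t i \<omega> * incr s t j \<omega>))"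
      by (intro sum.cong refl) (simp only: mult_ac)
    finally show "Y \<omega> * (\<Sum>i\<in>A. y i \<omega> * incr s t i \<omega>)\<^sup>2
      = (\<Sum>i\<in>A. \<Sum>j\<in>A. (Y \<omega> * (y i \<omega> * y j \<omega>)) * (incr s t i \<omega> * incr s t j \<omega>))" .
  qed
  show "integrable M (\<lambda>\<omega>. Y \<omega> * (\<Sum>i\<in>A. y i \<omega> * incr s t i \<omega>)\<^sup>2)"
    unfolding eq using int by (intro Bochner_Integration.integrable_sum) auto
  have "expectation (\<lambda>\<omega>. Y \<omega> * (\<Sum>i\<in>A. y i \<omega> * incr s t i \<omega>)\<^sup>2)
    = (\<Sum>i\<in>A. \<Sum>j\<in>A. expectation (\<lambda>\<omega>. (Y \<omega> * (y i \<omega> * y j \<omega>)) * (incr s t i \<omega> * incr s t j \<omega>)))"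
    unfolding eq
  proof (subst Bochner_Integration.integral_sum)
    show "integrable M (\<lambda>\<omega>. \<Sum>j\<in>A. (Y \<omega> * (y i \<omega> * y j \<omega>)) * (incr s t i \<omega> * incr s t j \<omega>))" if "i \<in> A" for i
      using int that by (intro Bochner_Integration.integrable_sum) auto
    show "(\<Sum>i\<in>A. expectation (\<lambda>\<omega>. \<Sum>j\<in>A. (Y \<omega> * (y i \<omega> * y j \<omega>)) * (incr s t i \<omega> * incr s t j \<omega>)))
      = (\<Sum>i\<in>A. \<Sum>j\<in>A. expectation (\<lambda>\<omega>. (Y \<omega> * (y i \<omega> * y j \<omega>)) * (incr s t i \<omega> * incr s t j \<omega>)))"
      using int by (intro sum.cong refl Bochner_Integration.integral_sum) auto
  qed
  also have "\<dots> = (\<Sum>i\<in>A. \<Sum>j\<in>A. if j = i then expectation (\<lambda>\<omega>. (Y \<omega> * (y i \<omega>)\<^sup>2) * (incr s t i \<omega>)\<^sup>2) else 0)"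
    using I_cross[OF _ _ _ st b] by (intro sum.cong refl) (auto simp: incr_def power2_eq_square)
  also have "\<dots> = (\<Sum>i\<in>A. expectation (\<lambda>\<omega>. (Y \<omega> * (y i \<omega>)\<^sup>2) * (incr s t i \<omega>)\<^sup>2))"
    using A(1) by simp
  finally show "expectation (\<lambda>\<omega>. Y \<omega> * (\<Sum>i\<in>A. y i \<omega> * incr s t i \<omega>)\<^sup>2)
      = (\<Sum>i\<in>A. expectation (\<lambda>\<omega>. (Y \<omega> * (y i \<omega>)\<^sup>2) * (incr s t i \<omega>)\<^sup>2))" .
qed

lemma incr_sum_squares:
  assumes st: "0 \<le> s" "s < t"
  shows "integrable M (\<lambda>\<omega>. \<Sum>i\<in>A. (incr s t i \<omega>)\<^sup>2)"
    and "expectation (\<lambda>\<omega>. \<Sum>i\<in>A. (incr s t i \<omega>)\<^sup>2) \<le> real (card A) * b * (t - s)"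
    and "integrable M (\<lambda>\<omega>. \<Sum>i\<in>A. (incr s t i \<omega>) ^ 4)"
    and "expectation (\<lambda>\<omega>. \<Sum>i\<in>A. (incr s t i \<omega>) ^ 4) \<le> real (card A) * (3 * b\<^sup>2 * (t - s)\<^sup>2)"
proof -
  have i: "integrable M (\<lambda>\<omega>. (incr s t i \<omega>)\<^sup>2)" "integrable M (\<lambda>\<omega>. (incr s t i \<omega>) ^ 4)" if "i \<in> A" for i
    using I_power[OF that st, of 2] I_power[OF that st, of 4] by (simp_all add: incr_def)
  then show "integrable M (\<lambda>\<omega>. \<Sum>i\<in>A. (incr s t i \<omega>)\<^sup>2)" "integrable M (\<lambda>\<omega>. \<Sum>i\<in>A. (incr s t i \<omega>) ^ 4)" by simp_all
  have "expectation (\<lambda>\<omega>. (incr s t i \<omega>)\<^sup>2) \<le> b * (t - s)" if "i \<in> A" for i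
    using I_upper[OF that st bounded_F_const[of s 1]] by (simp add: incr_def prob_space)
  from sum_bounded_above[of A, OF this]
  show "expectation (\<lambda>\<omega>. \<Sum>i\<in>A. (incr s t i \<omega>)\<^sup>2) \<le> real (card A) * b * (t - s)"
    using i by (simp add: mult.assoc)
  have "expectation (\<lambda>\<omega>. (incr s t i \<omega>) ^ 4) \<le> 3 * b\<^sup>2 * (t - s)\<^sup>2" if "i \<in> A" for i
    using I_fourth[OF that st] by (simp add: incr_def)
  from sum_bounded_above[of A, OF this]
  show "expectation (\<lambda>\<omega>. \<Sum>i\<in>A. (incr s t i \<omega>) ^ 4) \<le> real (card A) * (3 * b\<^sup>2 * (t - s)\<^sup>2)"
    using i by simp
qed

text \<open>The spread is the sum of squares minus the squared sum divided by the number of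
  particles. By orthogonality the squared sum has the same weighted mean as the sum of squares, so a
  fraction \<open>(n - 1) / n\<close> of the latter is left: this is the origin of the factor
  \<open>n - 1\<close>.\<close>

lemma incr_spread:
  assumes st: "0 \<le> s" "s < t" and Y: "bounded_F s Y" "\<And>\<omega>. \<omega> \<in> space M \<Longrightarrow> 0 \<le> Y \<omega>"
  shows "integrable M (\<lambda>\<omega>. Y \<omega> * spread A (\<lambda>i. incr s t i \<omega>))"
    and "(real (card A) - 1) * a * (t - s) * expectation Y \<le> expectation (\<lambda>\<omega>. Y \<omega> * spread A (\<lambda>i. incr s t i \<omega>))"
proof -
  let ?n = "real (card A)"
  have n: "0 < ?n" using A by (simp add: card_gt_0_iff)
  have i: "integrable M (\<lambda>\<omega>. Y \<omega> * (incr s t i \<omega>)\<^sup>2)" if "i \<in> A" for i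
    using bounded_F_integrable_mult[OF Y(1) st(1) I_power[OF that st, of 2]] by (simp add: incr_def)
  note q = incr_quadratic[OF st Y(1) bounded_F_const[of s 1]]
  have eq: "(\<lambda>\<omega>. Y \<omega> * spread A (\<lambda>i. incr s t i \<omega>)) = (\<lambda>\<omega>. (\<Sum>i\<in>A. Y \<omega> * (incr s t i \<omega>)\<^sup>2)
    - (Y \<omega> * (\<Sum>i\<in>A. 1 * incr s t i \<omega>)\<^sup>2) / ?n)"
    unfolding spread_eq[OF A] by (simp add: right_diff_distrib sum_distrib_left)
  show "integrable M (\<lambda>\<omega>. Y \<omega> * spread A (\<lambda>i. incr s t i \<omega>))"
    unfolding eq using i q(1) by simp
  have "?n * (a * (t - s) * expectation Y) \<le> (\<Sum>i\<in>A. expectation (\<lambda>\<omega>. Y \<omega> * (incr s t i \<omega>)\<^sup>2))" (is "_ \<le> ?S")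
    using sum_bounded_below[of A "a * (t - s) * expectation Y"] I_lower[OF _ st Y] by (simp add: incr_def)
  moreover have "expectation (\<lambda>\<omega>. Y \<omega> * spread A (\<lambda>i. incr s t i \<omega>)) = ?S - ?S / ?n"
    unfolding eq using i q by simp
  moreover have "?S - ?S / ?n = (?n - 1) / ?n * ?S" using n by (simp add: field_simps)
  moreover have "1 \<le> ?n" using n by simp
  then have "(?n - 1) / ?n * (?n * (a * (t - s) * expectation Y)) \<le> (?n - 1) / ?n * ?S"
    using calculation(1) by (intro mult_left_mono) auto
  ultimately show "(?n - 1) * a * (t - s) * expectation Y \<le> expectation (\<lambda>\<omega>. Y \<omega> * spread A (\<lambda>i. incr s t i \<omega>))"
    using n by (simp add: mult.assoc)
qed

section \<open>The expected increment of the Lyapunov function\<close>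

abbreviation Z :: "real \<Rightarrow> 'a \<Rightarrow> real" where
  "Z t \<omega> \<equiv> spread A (\<lambda>i. X i t \<omega>)"

definition lyapunov :: "real \<Rightarrow> real \<Rightarrow> real \<Rightarrow> 'a \<Rightarrow> real" where
  "lyapunov \<eta> p t \<omega> = t\<^sup>2 * (\<eta> + Z t \<omega>) powr (-p)"

lemma Z_measurable: "0 \<le> t \<Longrightarrow> Z t \<in> borel_measurable (F t)"
  by (intro borel_measurable_spread X_measurable)

lemma bounded_F_powr:
  assumes "0 \<le> t" "0 < \<eta>" "q \<le> 0"
  shows "bounded_F t (\<lambda>\<omega>. (\<eta> + Z t \<omega>) powr q)"
proof -
  have "(\<lambda>\<omega>. (\<eta> + Z t \<omega>) powr q) \<in> borel_measurable (F t)"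
    by (intro powr_real_measurable borel_measurable_add borel_measurable_const Z_measurable assms)
  moreover have "\<bar>(\<eta> + Z t \<omega>) powr q\<bar> \<le> \<eta> powr q" for \<omega>
    using spread_nonneg[of A "\<lambda>i. X i t \<omega>"] assms by (simp add: powr_mono2')
  ultimately show ?thesis unfolding bounded_F_def by blast
qed

text \<open>No moment of \<open>X\<close> is available, as the initial values are arbitrary. The
  deviation from the mean is at most \<open>sqrt (\<eta> + Z)\<close>, however, and the negative
  power compensates it.\<close>

lemma bounded_F_coeff:
  assumes t: "0 \<le> t" "0 < \<eta>" "q \<le> -1/2" and i: "i \<in> A"
  shows "bounded_F t (\<lambda>\<omega>. (\<eta> + Z t \<omega>) powr q * (X i t \<omega> - avg A (\<lambda>i. X i t \<omega>)))"
proof -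
  have "(\<lambda>\<omega>. (\<eta> + Z t \<omega>) powr q * (X i t \<omega> - avg A (\<lambda>i. X i t \<omega>))) \<in> borel_measurable (F t)"
    by (intro borel_measurable_times powr_real_measurable borel_measurable_add borel_measurable_const
        borel_measurable_diff borel_measurable_avg X_measurable Z_measurable t i)
  moreover have "\<bar>(\<eta> + Z t \<omega>) powr q * (X i t \<omega> - avg A (\<lambda>i. X i t \<omega>))\<bar> \<le> \<eta> powr (q + 1/2)" for \<omega>
  proof -
    let ?w = "\<eta> + Z t \<omega>"
    have w: "\<eta> \<le> ?w" "0 < ?w" using spread_nonneg[of A "\<lambda>i. X i t \<omega>"] t(2) by auto
    have "(X i t \<omega> - avg A (\<lambda>i. X i t \<omega>))\<^sup>2 \<le> Z t \<omega>"
      unfolding spread_def using A(1) i by (intro member_le_sum) auto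
    then have "\<bar>X i t \<omega> - avg A (\<lambda>i. X i t \<omega>)\<bar> \<le> sqrt ?w"
      using t(2) by (intro real_le_rsqrt) auto
    then have "\<bar>?w powr q * (X i t \<omega> - avg A (\<lambda>i. X i t \<omega>))\<bar> \<le> ?w powr q * sqrt ?w"
      unfolding abs_mult by (intro mult_mono) auto
    also have "\<dots> = ?w powr (q + 1/2)"
      using w(2) by (simp only: powr_add powr_half_sqrt less_imp_le)
    also have "\<dots> \<le> \<eta> powr (q + 1/2)"
      using w t by (intro powr_mono2') auto
    finally show ?thesis .
  qed
  ultimately show ?thesis unfolding bounded_F_def by blast
qed

lemma bounded_F_powr_mult:
  assumes t: "0 \<le> t" "0 < \<eta>" "q \<le> -1"
  shows "bounded_F t (\<lambda>\<omega>. (\<eta> + Z t \<omega>) powr q * Z t \<omega>)"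
proof -
  have "(\<lambda>\<omega>. (\<eta> + Z t \<omega>) powr q * Z t \<omega>) \<in> borel_measurable (F t)"
    by (intro borel_measurable_times powr_real_measurable borel_measurable_add borel_measurable_const Z_measurable t)
  moreover have "\<bar>(\<eta> + Z t \<omega>) powr q * Z t \<omega>\<bar> \<le> \<eta> powr (q + 1)" for \<omega>
  proof -
    let ?w = "\<eta> + Z t \<omega>"
    have w: "\<eta> \<le> ?w" "0 < ?w" "0 \<le> Z t \<omega>" using spread_nonneg[of A "\<lambda>i. X i t \<omega>"] t(2) by auto
    have "\<bar>?w powr q * Z t \<omega>\<bar> \<le> ?w powr q * ?w" using w t(2) by (auto simp: abs_mult intro: mult_left_mono)
    also have "\<dots> = ?w powr (q + 1)" using w(2) by (simp only: powr_add powr_one less_imp_le)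
    also have "\<dots> \<le> \<eta> powr (q + 1)" using w t by (intro powr_mono2') auto
    finally show ?thesis .
  qed
  ultimately show ?thesis unfolding bounded_F_def by blast
qed

lemma bounded_F_indicator: "E \<in> sets (F t) \<Longrightarrow> bounded_F t (indicator E)"
  unfolding bounded_F_def by (auto intro!: exI[of _ 1] simp: indicator_def)

text \<open>The pathwise Taylor bound is integrated term by term: the linear term has mean zero, the
  quadratic ones are controlled by the spread and by the upper second moment, and \<open>gen\<close>
  combines them pointwise. The event \<open>E\<close> is known at time \<open>s\<close>, so its
  indicator may multiply every test variable.\<close>

lemma one_step:
  fixes \<eta> p \<delta> C s t :: real and E :: "'a set"
  defines "c \<equiv> real (card A) * G\<^sup>2"
  assumes \<eta>: "0 < \<eta>" and p: "0 < p" "p \<le> 1" and \<delta>: "0 < \<delta>" and st: "0 \<le> s" "s < t" "t - s \<le> 1"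
    and E: "E \<in> sets (F s)"
    and gen: "\<And>w Z. 0 < w \<Longrightarrow> 0 \<le> Z \<Longrightarrow> Z \<le> w \<Longrightarrow>
      2 * t * w powr (-p) + t\<^sup>2 * (p * w powr (-p-1) * (\<delta> + c * Z / \<delta>)) - t\<^sup>2 * p * ((real (card A) - 1) * a) * w powr (-p-1)
        + 2 * t\<^sup>2 * p * (p + 1) * b * (w powr (-p-2) * Z) \<le> C" and C: "0 \<le> C"
  defines "K \<equiv> step_const (card A) G \<eta> p"
  shows "expectation (\<lambda>\<omega>. indicator E \<omega> * (lyapunov \<eta> p t \<omega> - lyapunov \<eta> p s \<omega>))
    \<le> C * (t - s) + t\<^sup>2 * K * (real (card A) * b + 1 + 3 * real (card A) * b\<^sup>2) * (t - s) * sqrt (t - s)"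
proof -
  define \<epsilon> where "\<epsilon> = sqrt (t - s)"
  have \<epsilon>: "0 < \<epsilon>" "\<epsilon> \<le> 1" "\<epsilon>\<^sup>2 = t - s" using st by (auto simp: \<epsilon>_def real_sqrt_le_1_iff)
  have t0: "0 < t" "0 \<le> t" using st by auto
  let ?n = "real (card A)"
  have c0: "0 \<le> c" by (simp add: c_def)
  have K0: "0 \<le> K" unfolding K_def by (rule step_const_nonneg)
  define e :: "'a \<Rightarrow> real" where "e = indicator E"
  define w0 where "w0 \<omega> = (\<eta> + Z s \<omega>) powr (-p)" for \<omega>
  define w1 where "w1 \<omega> = (\<eta> + Z s \<omega>) powr (-p-1)" for \<omega>
  define w2 where "w2 \<omega> = (\<eta> + Z s \<omega>) powr (-p-2)" for \<omega>
  define y where "y i \<omega> = X i s \<omega> - avg A (\<lambda>i. X i s \<omega>)" for i \<omega>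
  \<comment> \<open>Half of the exponent of \<open>w^(-p-2)\<close> is moved inside the square: each
    coefficient of the sum must be bounded on its own, and \<open>y i\<close> is not.\<close>
  define u where "u i \<omega> = (\<eta> + Z s \<omega>) powr ((-p-2)/2) * y i \<omega>" for i \<omega>
  define V where "V \<omega> = (\<Sum>i\<in>A. (incr s t i \<omega>)\<^sup>2)" for \<omega>
  define Q where "Q \<omega> = (\<Sum>i\<in>A. (incr s t i \<omega>) ^ 4)" for \<omega>
  define R1 where "R1 \<omega> = e \<omega> * (2 * t * w0 \<omega> + t\<^sup>2 * (p * w1 \<omega> * (\<delta> + c * Z s \<omega> / \<delta>)))" for \<omega>
  define R2 where "R2 \<omega> = (\<Sum>i\<in>A. (e \<omega> * (w1 \<omega> * y i \<omega>)) * incr s t i \<omega>)" for \<omega>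
  define R3 where "R3 \<omega> = (e \<omega> * w1 \<omega>) * spread A (\<lambda>i. incr s t i \<omega>)" for \<omega>
  define R4 where "R4 \<omega> = e \<omega> * (\<Sum>i\<in>A. u i \<omega> * incr s t i \<omega>)\<^sup>2" for \<omega>
  define R5 where "R5 \<omega> = \<epsilon> * V \<omega> + \<epsilon> ^ 3 + Q \<omega> / \<epsilon>" for \<omega>
  define R where "R \<omega> = \<epsilon>\<^sup>2 * R1 \<omega> - 2 * t\<^sup>2 * p * R2 \<omega> - t\<^sup>2 * p * R3 \<omega> + 2 * t\<^sup>2 * p * (p + 1) * R4 \<omega> + t\<^sup>2 * K * R5 \<omega>" for \<omega>
  have e01: "e \<omega> = 0 \<or> e \<omega> = 1" for \<omega> by (auto simp: e_def indicator_def)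
  have e_b: "bounded_F s e" unfolding e_def by (rule bounded_F_indicator[OF E])
  have w_b: "bounded_F s w0" "bounded_F s w1" "bounded_F s w2"
    unfolding w0_def w1_def w2_def using p \<eta> st by (auto intro: bounded_F_powr)
  have wZ_b: "bounded_F s (\<lambda>\<omega>. w1 \<omega> * Z s \<omega>)" "bounded_F s (\<lambda>\<omega>. w2 \<omega> * Z s \<omega>)"
    unfolding w1_def w2_def using p \<eta> st by (auto intro: bounded_F_powr_mult)
  have wy_b: "bounded_F s (\<lambda>\<omega>. w1 \<omega> * y i \<omega>)" "bounded_F s (u i)" if "i \<in> A" for i
    unfolding w1_def u_def y_def using p \<eta> st that by (auto intro!: bounded_F_coeff)
  note bi = bounded_F_integrable[OF bounded_F_mult[OF e_b] st(1)]
  have R1_eq: "R1 \<omega> = 2 * t * (e \<omega> * w0 \<omega>) + t\<^sup>2 * p * \<delta> * (e \<omega> * w1 \<omega>) + t\<^sup>2 * p * c / \<delta> * (e \<omega> * (w1 \<omega> * Z s \<omega>))" for \<omega>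
    unfolding R1_def by (simp add: algebra_simps)
  have R1_i: "integrable M R1"
    unfolding R1_eq using bi[OF w_b(1)] bi[OF w_b(2)] bi[OF wZ_b(1)] by (intro Bochner_Integration.integrable_add integrable_mult_right) auto
  have R2: "integrable M R2" "expectation R2 = 0"
    unfolding R2_def
    by (rule incr_linear[OF st(1,2), where y = "\<lambda>i \<omega>. e \<omega> * (w1 \<omega> * y i \<omega>)", OF bounded_F_mult[OF e_b wy_b(1)]], assumption)+
  have ew1: "0 \<le> e \<omega> * w1 \<omega>" for \<omega> using e01[of \<omega>] by (auto simp: w1_def)
  note R3 = incr_spread[OF st(1,2) bounded_F_mult[OF e_b w_b(2)] ew1, folded R3_def]
  have R4: "integrable M R4"
    "expectation R4 = (\<Sum>i\<in>A. expectation (\<lambda>\<omega>. (e \<omega> * (u i \<omega>)\<^sup>2) * (incr s t i \<omega>)\<^sup>2))"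
    unfolding R4_def by (rule incr_quadratic[OF st(1,2) e_b, where y = u, OF wy_b(2)], assumption)+
  have R4_le: "expectation R4 \<le> b * (t - s) * expectation (\<lambda>\<omega>. e \<omega> * (w2 \<omega> * Z s \<omega>))"
  proof -
    have eu: "bounded_F s (\<lambda>\<omega>. e \<omega> * (u i \<omega>)\<^sup>2)" if "i \<in> A" for i
      using bounded_F_mult[OF e_b bounded_F_power[OF wy_b(2)[OF that]]] .
    have "expectation R4 = (\<Sum>i\<in>A. expectation (\<lambda>\<omega>. (e \<omega> * (u i \<omega>)\<^sup>2) * (incr s t i \<omega>)\<^sup>2))" by (rule R4(2))
    also have "\<dots> \<le> (\<Sum>i\<in>A. b * (t - s) * expectation (\<lambda>\<omega>. e \<omega> * (u i \<omega>)\<^sup>2))"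
    proof (rule sum_mono)
      fix i assume i: "i \<in> A"
      show "expectation (\<lambda>\<omega>. (e \<omega> * (u i \<omega>)\<^sup>2) * (incr s t i \<omega>)\<^sup>2) \<le> b * (t - s) * expectation (\<lambda>\<omega>. e \<omega> * (u i \<omega>)\<^sup>2)"
        unfolding incr_def by (rule I_upper[OF i st(1,2) eu[OF i]]) (auto simp: e_def)
    qed
    also have "\<dots> = b * (t - s) * expectation (\<lambda>\<omega>. \<Sum>i\<in>A. e \<omega> * (u i \<omega>)\<^sup>2)"
      using bounded_F_integrable[OF eu st(1)] by (simp add: sum_distrib_left)
    also have "(\<lambda>\<omega>. \<Sum>i\<in>A. e \<omega> * (u i \<omega>)\<^sup>2) = (\<lambda>\<omega>. e \<omega> * (w2 \<omega> * Z s \<omega>))"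
    proof (rule ext)
      fix \<omega>
      have "(u i \<omega>)\<^sup>2 = w2 \<omega> * (y i \<omega>)\<^sup>2" for i
        unfolding u_def w2_def power_mult_distrib by (simp add: power2_eq_square flip: powr_add)
      then show "(\<Sum>i\<in>A. e \<omega> * (u i \<omega>)\<^sup>2) = e \<omega> * (w2 \<omega> * Z s \<omega>)"
        unfolding spread_def y_def by (simp add: sum_distrib_left)
    qed
    finally show ?thesis .
  qed
  note VQ = incr_sum_squares[OF st(1,2), folded V_def Q_def]
  have R5_i: "integrable M R5" unfolding R5_def using VQ by simp
  have R5_le: "expectation R5 \<le> (?n * b + 1 + 3 * ?n * b\<^sup>2) * \<epsilon> ^ 3"
  proof -
    have "expectation R5 = \<epsilon> * expectation V + \<epsilon> ^ 3 + expectation Q / \<epsilon>"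
      unfolding R5_def using VQ by (simp add: prob_space)
    also have "\<dots> \<le> \<epsilon> * (?n * b * \<epsilon>\<^sup>2) + \<epsilon> ^ 3 + (?n * (3 * b\<^sup>2 * (\<epsilon>\<^sup>2)\<^sup>2)) / \<epsilon>"
      using VQ(2,4) \<epsilon> by (intro add_mono mult_left_mono divide_right_mono order_refl) auto
    also have "\<dots> = (?n * b + 1 + 3 * ?n * b\<^sup>2) * \<epsilon> ^ 3"
      using \<epsilon>(1) by (simp add: field_simps power2_eq_square power3_eq_cube)
    finally show ?thesis .
  qed
  have R_i: "integrable M R"
    unfolding R_def using R1_i R2(1) R3(1) R4(1) R5_i by simp
  have U_i: "integrable M (\<lambda>\<omega>. e \<omega> * (t\<^sup>2 * (\<eta> + Z t \<omega>) powr (-p) - s\<^sup>2 * w0 \<omega>))"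
  proof -
    have "integrable M (\<lambda>\<omega>. t\<^sup>2 * (\<eta> + Z t \<omega>) powr (-p) - s\<^sup>2 * w0 \<omega>)"
      using bounded_F_integrable[OF bounded_F_powr[OF t0(2) \<eta>, of "-p"] t0(2)] bounded_F_integrable[OF w_b(1) st(1)] p by simp
    then show ?thesis by (rule bounded_F_integrable_mult[OF e_b st(1)])
  qed
  have "AE \<omega> in M. \<forall>i\<in>A. \<forall>s t. 0 \<le> s \<and> s \<le> t \<longrightarrow> \<bar>X i t \<omega> - X i s \<omega> - (I i t \<omega> - I i s \<omega>)\<bar> \<le> G * (t - s)"
    by (rule AE_finite_allI[OF A(1) drift])
  then have le: "AE \<omega> in M. e \<omega> * (t\<^sup>2 * (\<eta> + Z t \<omega>) powr (-p) - s\<^sup>2 * w0 \<omega>) \<le> R \<omega>"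
  proof eventually_elim
    case (elim \<omega>)
    define \<beta> where "\<beta> i = X i t \<omega> - X i s \<omega> - incr s t i \<omega>" for i
    have \<beta>: "\<bar>\<beta> i\<bar> \<le> G * \<epsilon>\<^sup>2" if "i \<in> A" for i
      using elim that st unfolding \<beta>_def incr_def \<epsilon>(3) by auto
    have X_eq: "(\<lambda>i. X i s \<omega> + (\<beta> i + incr s t i \<omega>)) = (\<lambda>i. X i t \<omega>)" by (simp add: \<beta>_def)
    define L where "L = (\<Sum>i\<in>A. y i \<omega> * incr s t i \<omega>)"
    have step: "(\<eta> + Z t \<omega>) powr (-p) \<le> w0 \<omega> + \<epsilon>\<^sup>2 * (p * w1 \<omega> * (\<delta> + c * Z s \<omega> / \<delta>)) - 2 * p * w1 \<omega> * L
      - p * w1 \<omega> * spread A (\<lambda>i. incr s t i \<omega>) + 2 * p * (p + 1) * w2 \<omega> * L\<^sup>2 + K * R5 \<omega>"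
      using spread_powr_step[where x = "\<lambda>i. X i s \<omega>" and v = "\<lambda>i. incr s t i \<omega>" and \<beta> = \<beta> and G = G,
          OF A \<eta> p \<epsilon>(1,2) \<delta> \<beta>]
      unfolding X_eq w0_def w1_def w2_def L_def y_def R5_def V_def Q_def K_def c_def by simp
    have R5_0: "0 \<le> R5 \<omega>" unfolding R5_def V_def Q_def using \<epsilon>
      by (intro add_nonneg_nonneg mult_nonneg_nonneg divide_nonneg_nonneg sum_nonneg) auto
    have w00: "0 \<le> w0 \<omega>" by (simp add: w0_def)
    show ?case
    proof (cases "e \<omega> = 0")
      case True
      then show ?thesis
        unfolding R_def R1_def R2_def R3_def R4_def using K0 R5_0 by simp
    next
      case False
      then have e1: "e \<omega> = 1" using e01 by blast
      have r2: "R2 \<omega> = w1 \<omega> * L" unfolding R2_def e1 L_def by (simp add: sum_distrib_left mult.assoc)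
      have r3: "R3 \<omega> = w1 \<omega> * spread A (\<lambda>i. incr s t i \<omega>)" unfolding R3_def e1 by simp
      have r4: "R4 \<omega> = w2 \<omega> * L\<^sup>2"
      proof -
        have "(\<Sum>i\<in>A. u i \<omega> * incr s t i \<omega>) = (\<eta> + Z s \<omega>) powr ((-p-2)/2) * L"
          unfolding u_def L_def by (simp add: sum_distrib_left mult.assoc)
        then show ?thesis unfolding R4_def e1 w2_def
          by (simp add: power_mult_distrib) (simp add: power2_eq_square flip: powr_add)
      qed
      \<comment> \<open>The factor \<open>t^2\<close> is frozen at the right endpoint and the state
        at the left one; the change of the factor then contributes
        \<open>(t^2 - s^2) * w0 \<le> 2 * t * (t - s) * w0\<close>.\<close>
      have "t\<^sup>2 * (\<eta> + Z t \<omega>) powr (-p) - s\<^sup>2 * w0 \<omega> \<le> t\<^sup>2 * (w0 \<omega> + \<epsilon>\<^sup>2 * (p * w1 \<omega> * (\<delta> + c * Z s \<omega> / \<delta>)) - 2 * p * w1 \<omega> * L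
      - p * w1 \<omega> * spread A (\<lambda>i. incr s t i \<omega>) + 2 * p * (p + 1) * w2 \<omega> * L\<^sup>2 + K * R5 \<omega>) - s\<^sup>2 * w0 \<omega>"
        using step by (intro diff_right_mono mult_left_mono) auto
      also have "\<dots> = (t\<^sup>2 - s\<^sup>2) * w0 \<omega> + t\<^sup>2 * (\<epsilon>\<^sup>2 * (p * w1 \<omega> * (\<delta> + c * Z s \<omega> / \<delta>))) - 2 * t\<^sup>2 * p * R2 \<omega> - t\<^sup>2 * p * R3 \<omega>
        + 2 * t\<^sup>2 * p * (p + 1) * R4 \<omega> + t\<^sup>2 * K * R5 \<omega>"
        unfolding r2 r3 r4 by (simp add: algebra_simps)
      also have "(t\<^sup>2 - s\<^sup>2) * w0 \<omega> \<le> (\<epsilon>\<^sup>2 * (2 * t)) * w0 \<omega>"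
      proof (rule mult_right_mono[OF _ w00])
        have "t\<^sup>2 - s\<^sup>2 = (t - s) * (t + s)" by (simp add: power2_eq_square algebra_simps)
        also have "\<dots> \<le> (t - s) * (2 * t)" using st by (intro mult_left_mono) auto
        finally show "t\<^sup>2 - s\<^sup>2 \<le> \<epsilon>\<^sup>2 * (2 * t)" unfolding \<epsilon>(3) .
      qed
      also have "(\<epsilon>\<^sup>2 * (2 * t)) * w0 \<omega> + t\<^sup>2 * (\<epsilon>\<^sup>2 * (p * w1 \<omega> * (\<delta> + c * Z s \<omega> / \<delta>))) = \<epsilon>\<^sup>2 * R1 \<omega>"
        unfolding R1_def e1 by (simp only: distrib_left mult_1 mult.assoc mult.left_commute)
      finally show ?thesis unfolding R_def e1 by simp
    qed
  qed
  have "expectation (\<lambda>\<omega>. e \<omega> * (t\<^sup>2 * (\<eta> + Z t \<omega>) powr (-p) - s\<^sup>2 * w0 \<omega>)) \<le> expectation R"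
    by (rule integral_mono_AE[OF U_i R_i le])
  also have "expectation R = \<epsilon>\<^sup>2 * expectation R1 - t\<^sup>2 * p * expectation R3 + 2 * t\<^sup>2 * p * (p + 1) * expectation R4 + t\<^sup>2 * K * expectation R5"
    unfolding R_def using R1_i R2 R3(1) R4(1) R5_i by simp
  also have "\<dots> \<le> \<epsilon>\<^sup>2 * expectation R1 - t\<^sup>2 * p * ((?n - 1) * a * (t - s) * expectation (\<lambda>\<omega>. e \<omega> * w1 \<omega>))
    + 2 * t\<^sup>2 * p * (p + 1) * (b * (t - s) * expectation (\<lambda>\<omega>. e \<omega> * (w2 \<omega> * Z s \<omega>)))
    + t\<^sup>2 * K * ((?n * b + 1 + 3 * ?n * b\<^sup>2) * \<epsilon> ^ 3)"
    using R3(2) R4_le R5_le p K0 by (intro add_mono diff_mono mult_left_mono order_refl) auto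
  also have "\<dots> = \<epsilon>\<^sup>2 * (expectation R1 - t\<^sup>2 * p * ((?n - 1) * a) * expectation (\<lambda>\<omega>. e \<omega> * w1 \<omega>)
    + 2 * t\<^sup>2 * p * (p + 1) * b * expectation (\<lambda>\<omega>. e \<omega> * (w2 \<omega> * Z s \<omega>)))
    + t\<^sup>2 * K * ((?n * b + 1 + 3 * ?n * b\<^sup>2) * \<epsilon> ^ 3)"
    unfolding \<epsilon>(3) by (simp add: algebra_simps)
  also have "expectation R1 - t\<^sup>2 * p * ((?n - 1) * a) * expectation (\<lambda>\<omega>. e \<omega> * w1 \<omega>)
    + 2 * t\<^sup>2 * p * (p + 1) * b * expectation (\<lambda>\<omega>. e \<omega> * (w2 \<omega> * Z s \<omega>)) \<le> C"
  proof -
    have "expectation R1 - t\<^sup>2 * p * ((?n - 1) * a) * expectation (\<lambda>\<omega>. e \<omega> * w1 \<omega>)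
      + 2 * t\<^sup>2 * p * (p + 1) * b * expectation (\<lambda>\<omega>. e \<omega> * (w2 \<omega> * Z s \<omega>))
      = expectation (\<lambda>\<omega>. R1 \<omega> - t\<^sup>2 * p * ((?n - 1) * a) * (e \<omega> * w1 \<omega>) + 2 * t\<^sup>2 * p * (p + 1) * b * (e \<omega> * (w2 \<omega> * Z s \<omega>)))"
      using R1_i bi[OF w_b(2)] bi[OF wZ_b(2)] by simp
    also have "\<dots> \<le> expectation (\<lambda>\<omega>. C)"
    proof (rule integral_mono)
      show "integrable M (\<lambda>\<omega>. R1 \<omega> - t\<^sup>2 * p * ((?n - 1) * a) * (e \<omega> * w1 \<omega>) + 2 * t\<^sup>2 * p * (p + 1) * b * (e \<omega> * (w2 \<omega> * Z s \<omega>)))"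
        using R1_i bi[OF w_b(2)] bi[OF wZ_b(2)] by simp
      fix \<omega>
      show "R1 \<omega> - t\<^sup>2 * p * ((?n - 1) * a) * (e \<omega> * w1 \<omega>) + 2 * t\<^sup>2 * p * (p + 1) * b * (e \<omega> * (w2 \<omega> * Z s \<omega>)) \<le> C"
      proof (cases "e \<omega> = 0")
        case True
        then show ?thesis using C by (simp add: R1_def)
      next
        case False
        then have e1: "e \<omega> = 1" using e01 by blast
        show ?thesis
          using gen[of "\<eta> + Z s \<omega>" "Z s \<omega>"] \<eta> spread_nonneg[of A "\<lambda>i. X i s \<omega>"]
          unfolding R1_def e1 w0_def w1_def w2_def mult_1 by simp
      qed
    qed simp
    finally show ?thesis by (simp add: prob_space)
  qed
  finally have final: "expectation (\<lambda>\<omega>. e \<omega> * (t\<^sup>2 * (\<eta> + Z t \<omega>) powr (-p) - s\<^sup>2 * w0 \<omega>))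
    \<le> \<epsilon>\<^sup>2 * C + t\<^sup>2 * K * ((?n * b + 1 + 3 * ?n * b\<^sup>2) * \<epsilon> ^ 3)"
    by (simp add: mult_left_mono)
  have e3: "\<epsilon> ^ 3 = (t - s) * sqrt (t - s)"
    unfolding \<epsilon>(3)[symmetric] using \<epsilon>(1) by (simp add: power3_eq_cube power2_eq_square)
  show ?thesis
    using final unfolding e3 \<epsilon>(3) e_def w0_def lyapunov_def by (simp add: mult_ac)
qed

end

text \<open>Doob's maximal inequality with an allowance of \<open>d\<close> per step. Increments are
  controlled only on the event that the level has not been reached so far.\<close>

lemma (in prob_space) discrete_maximal_inequality:
  fixes U :: "nat \<Rightarrow> 'a \<Rightarrow> real"
  assumes U: "\<And>k. integrable M (U k)" "\<And>\<omega>. U 0 \<omega> = 0" and \<theta>: "0 < \<theta>"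
    and step: "\<And>k. k < r \<Longrightarrow>
      expectation (\<lambda>\<omega>. indicator {\<omega>\<in>space M. \<forall>j\<le>k. U j \<omega> < \<theta>} \<omega> * (U (Suc k) \<omega> - U k \<omega>)) \<le> d"
    and U0: "\<And>k \<omega>. 0 \<le> U k \<omega>"
  shows "\<theta> * prob {\<omega>\<in>space M. \<exists>j\<le>r. \<theta> \<le> U j \<omega>} \<le> real r * d"
proof -
  define B where "B k = {\<omega>\<in>space M. \<forall>j\<le>k. U j \<omega> < \<theta>}" for k
  have m: "U k \<in> borel_measurable M" for k using U(1) by auto
  have B[measurable]: "B k \<in> events" for k
    unfolding B_def using m by measurable
  have iB: "integrable M (\<lambda>\<omega>. indicator (B k) \<omega> * U l \<omega>)" for k l
    using integrable_mult_indicator[OF B U(1)] by simp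
  have iI: "integrable M (indicator (B k) :: 'a \<Rightarrow> real)" for k
    by (intro integrable_real_indicator B) (simp add: emeasure_eq_measure)
  have pB: "expectation (indicator (B k)) = prob (B k)" for k using B by simp
  \<comment> \<open>The left side is a lower bound for the mean of the process stopped on first
    reaching \<open>\<theta>\<close>. A path that leaves \<open>B k\<close> at the next step has
    value at least \<open>\<theta>\<close> there, so each step adds at most
    \<open>d\<close>.\<close>
  have "expectation (\<lambda>\<omega>. indicator (B k) \<omega> * U k \<omega>) + \<theta> * (1 - prob (B k)) \<le> real k * d" if "k \<le> r" for k
    using that
  proof (induction k)
    case 0
    have "B 0 = space M" using \<theta> by (auto simp: B_def U(2))
    then show ?case by (simp add: U(2) prob_space)
  next
    case (Suc k)
    have "expectation (\<lambda>\<omega>. indicator (B (Suc k)) \<omega> * U (Suc k) \<omega> + \<theta> * (indicator (B k) \<omega> - indicator (B (Suc k)) \<omega>))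
      \<le> expectation (\<lambda>\<omega>. indicator (B k) \<omega> * U (Suc k) \<omega>)"
    proof (rule integral_mono)
      show "integrable M (\<lambda>\<omega>. indicator (B (Suc k)) \<omega> * U (Suc k) \<omega> + \<theta> * (indicator (B k) \<omega> - indicator (B (Suc k)) \<omega>))"
        by (intro Bochner_Integration.integrable_add iB integrable_mult_right Bochner_Integration.integrable_diff iI)
      fix \<omega> assume \<omega>: "\<omega> \<in> space M"
      have sub: "\<omega> \<in> B k" if "\<omega> \<in> B (Suc k)" using that by (auto simp: B_def)
      have "\<theta> \<le> U (Suc k) \<omega>" if BB: "\<omega> \<in> B k" "\<omega> \<notin> B (Suc k)"
      proof -
        obtain j where "j \<le> Suc k" "\<theta> \<le> U j \<omega>" using BB(2) \<omega> by (auto simp: B_def not_less)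
        moreover have "\<not> j \<le> k" using BB(1) calculation(2) by (auto simp: B_def)
        ultimately show ?thesis by (auto simp: le_Suc_eq)
      qed
      then show "indicator (B (Suc k)) \<omega> * U (Suc k) \<omega> + \<theta> * (indicator (B k) \<omega> - indicator (B (Suc k)) \<omega>)
        \<le> indicator (B k) \<omega> * U (Suc k) \<omega>"
        using sub by (cases "\<omega> \<in> B k"; cases "\<omega> \<in> B (Suc k)") auto
    qed (rule iB)
    then have "expectation (\<lambda>\<omega>. indicator (B (Suc k)) \<omega> * U (Suc k) \<omega>) + \<theta> * (prob (B k) - prob (B (Suc k)))
      \<le> expectation (\<lambda>\<omega>. indicator (B k) \<omega> * U (Suc k) \<omega>)"
      using iB iI pB by (simp add: Bochner_Integration.integral_add)
    moreover have "expectation (\<lambda>\<omega>. indicator (B k) \<omega> * U (Suc k) \<omega>) - expectation (\<lambda>\<omega>. indicator (B k) \<omega> * U k \<omega>) \<le> d"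
      using step[of k] Suc.prems iB unfolding B_def[symmetric] by (simp add: right_diff_distrib)
    moreover have "expectation (\<lambda>\<omega>. indicator (B k) \<omega> * U k \<omega>) + \<theta> * (1 - prob (B k)) \<le> real k * d"
      using Suc by simp
    moreover have "\<theta> * (1 - prob (B (Suc k))) = \<theta> * (1 - prob (B k)) + \<theta> * (prob (B k) - prob (B (Suc k)))"
      by (simp add: algebra_simps)
    moreover have "real (Suc k) * d = real k * d + d" by (simp add: algebra_simps)
    ultimately show ?case by linarith
  qed
  from this[of r] have "expectation (\<lambda>\<omega>. indicator (B r) \<omega> * U r \<omega>) + \<theta> * (1 - prob (B r)) \<le> real r * d" by simp
  moreover have "0 \<le> expectation (\<lambda>\<omega>. indicator (B r) \<omega> * U r \<omega>)"
    using U0 by (intro integral_nonneg_AE) (auto intro!: AE_I2 mult_nonneg_nonneg)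
  moreover have "{\<omega>\<in>space M. \<exists>j\<le>r. \<theta> \<le> U j \<omega>} = space M - B r" by (auto simp: B_def not_less)
  ultimately show ?thesis using prob_compl[OF B[of r]] by simp
qed

section \<open>From the maximal inequality to null events\<close>

context bounded_diffusion
begin

text \<open>The order of the choices matters: \<open>C\<close> and \<open>p\<close> are fixed before
  \<eta>, whereas \<open>K\<close> may depend on \<eta>. Its term is of order
  \<open>(t - s)^(3/2)\<close> and disappears when summed over a fine grid.\<close>

lemma step_bound:
  assumes T: "0 < T"
  obtains C p where "0 \<le> C" "0 < p"
    "\<And>\<eta>. 0 < \<eta> \<Longrightarrow> \<exists>K\<ge>0. \<forall>s t E. 0 \<le> s \<and> s < t \<and> t \<le> T \<and> t - s \<le> 1 \<and> E \<in> sets (F s) \<longrightarrow>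
      expectation (\<lambda>\<omega>. indicator E \<omega> * (lyapunov \<eta> p t \<omega> - lyapunov \<eta> p s \<omega>))
      \<le> C * (t - s) + K * (t - s) * sqrt (t - s)"
proof -
  let ?n = "real (card A)"
  \<comment> \<open>Half of the gap \<open>\<delta>0\<close> pays for \<open>2 * p * b\<close>, the
    other half for twice the drift parameter \<open>\<delta>0 / 4\<close>.\<close>
  define \<delta>0 where "\<delta>0 = (?n - 1) * a - 2 * b"
  define p where "p = min 1 (\<delta>0 / (4 * b))"
  have \<delta>0: "0 < \<delta>0" using ab by (simp add: \<delta>0_def)
  have p: "0 < p" "p \<le> 1" "p \<le> \<delta>0 / (4 * b)" using \<delta>0 b by (auto simp: p_def)
  have "p * (4 * b) \<le> \<delta>0" using p(3) b by (simp add: le_divide_eq)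
  moreover have "(?n - 1) * a = \<delta>0 + 2 * b" by (simp add: \<delta>0_def)
  moreover have "2 * (p + 1) * b = p * (4 * b) / 2 + 2 * b" by (simp add: algebra_simps)
  ultimately have B: "2 * (p + 1) * b + 2 * (\<delta>0 / 4) \<le> (?n - 1) * a" by linarith
  define c where "c = ?n * G\<^sup>2"
  have c: "0 \<le> c" by (simp add: c_def)
  have \<delta>: "0 < \<delta>0 / 4" using \<delta>0 by simp
  obtain C where C: "0 \<le> C" and gen: "\<And>t w Z. 0 < t \<Longrightarrow> t \<le> T \<Longrightarrow> 0 < w \<Longrightarrow> 0 \<le> Z \<Longrightarrow> Z \<le> w \<Longrightarrow>
      2 * t * w powr (-p) + t\<^sup>2 * (p * w powr (-p-1) * (\<delta>0 / 4 + c * Z / (\<delta>0 / 4))) - t\<^sup>2 * p * ((?n - 1) * a) * w powr (-p-1)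
        + 2 * t\<^sup>2 * p * (p + 1) * b * (w powr (-p-2) * Z) \<le> C"
    using generator_bound[OF p(1,2) \<delta> c T less_imp_le[OF b] B] by blast
  have "\<exists>K\<ge>0. \<forall>s t E. 0 \<le> s \<and> s < t \<and> t \<le> T \<and> t - s \<le> 1 \<and> E \<in> sets (F s) \<longrightarrow>
      expectation (\<lambda>\<omega>. indicator E \<omega> * (lyapunov \<eta> p t \<omega> - lyapunov \<eta> p s \<omega>))
      \<le> C * (t - s) + K * (t - s) * sqrt (t - s)" if \<eta>: "0 < \<eta>" for \<eta>
  proof -
    define K where "K = step_const (card A) G \<eta> p"
    define m where "m = ?n * b + 1 + 3 * ?n * b\<^sup>2"
    have K0: "0 \<le> K" unfolding K_def by (rule step_const_nonneg)
    have m0: "0 \<le> m" unfolding m_def using b by (intro add_nonneg_nonneg mult_nonneg_nonneg) auto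
    show ?thesis
    proof (intro exI[of _ "T\<^sup>2 * K * m"] conjI allI impI)
      show "0 \<le> T\<^sup>2 * K * m" using K0 m0 by simp
      fix s t E assume *: "0 \<le> s \<and> s < t \<and> t \<le> T \<and> t - s \<le> 1 \<and> E \<in> sets (F s)"
      then have t: "0 < t" "0 \<le> t - s" by auto
      have "expectation (\<lambda>\<omega>. indicator E \<omega> * (lyapunov \<eta> p t \<omega> - lyapunov \<eta> p s \<omega>))
        \<le> C * (t - s) + t\<^sup>2 * K * m * (t - s) * sqrt (t - s)"
        unfolding K_def m_def c_def
        by (rule one_step[OF \<eta> p(1,2) \<delta> _ _ _ _ gen[unfolded c_def] C]) (use * t in auto)
      also have "\<dots> \<le> C * (t - s) + T\<^sup>2 * K * m * (t - s) * sqrt (t - s)"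
        using * t K0 m0 by (intro add_left_mono mult_right_mono power_mono) auto
      finally show "expectation (\<lambda>\<omega>. indicator E \<omega> * (lyapunov \<eta> p t \<omega> - lyapunov \<eta> p s \<omega>))
        \<le> C * (t - s) + T\<^sup>2 * K * m * (t - s) * sqrt (t - s)" .
    qed
  qed
  then show ?thesis using that[OF C p(1)] by blast
qed

lemma hit_bound:
  assumes T: "0 < T" and C: "0 \<le> C" and p: "0 < p" and \<eta>: "0 < \<eta>" and \<kappa>: "0 < \<kappa>" and K: "0 \<le> K"
    and step: "\<And>s t E. 0 \<le> s \<Longrightarrow> s < t \<Longrightarrow> t \<le> T \<Longrightarrow> t - s \<le> 1 \<Longrightarrow> E \<in> sets (F s) \<Longrightarrow>
      expectation (\<lambda>\<omega>. indicator E \<omega> * (lyapunov \<eta> p t \<omega> - lyapunov \<eta> p s \<omega>))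
      \<le> C * (t - s) + K * (t - s) * sqrt (t - s)"
  shows "\<exists>H\<in>events. {\<omega>\<in>space M. \<exists>t\<in>{\<kappa>..T}. Z t \<omega> = 0} \<subseteq> H \<and> prob H \<le> 2 * C * T / \<kappa>\<^sup>2 * \<eta> powr p"
proof -
  define u where "u = lyapunov \<eta> p"
  have u_eq: "u t = (\<lambda>\<omega>. t\<^sup>2 * (\<eta> + Z t \<omega>) powr (-p))" for t by (simp add: u_def lyapunov_def fun_eq_iff)
  define \<tau> where "\<tau> r k = real k * T / real r" for r k :: nat
  \<comment> \<open>If \<open>Z\<close> vanishes at a time at least \<kappa>, the Lyapunov function
    is at least \<open>2 * \<theta>\<close>; the factor 2 leaves room to find a value above
    \<open>\<theta>\<close> at a nearby grid point.\<close>
  define \<theta> where "\<theta> = \<kappa>\<^sup>2 * \<eta> powr (-p) / 2"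
  define S where "S r = {\<omega>\<in>space M. \<exists>j\<le>r. \<theta> \<le> u (\<tau> r j) \<omega>}" for r
  have \<theta>: "0 < \<theta>" using \<kappa> \<eta> by (simp add: \<theta>_def)
  have \<tau>0: "0 \<le> \<tau> r k" for r k using T by (simp add: \<tau>_def)
  have u_F: "u t \<in> borel_measurable (F t)" "integrable M (u t)" if "0 \<le> t" for t
  proof -
    have "bounded_F t (u t)"
      unfolding u_eq using p by (intro bounded_F_mult bounded_F_const bounded_F_powr that \<eta>) simp
    then show "u t \<in> borel_measurable (F t)" "integrable M (u t)"
      using bounded_F_measurable bounded_F_integrable that by blast+
  qed
  have u0: "0 \<le> u t \<omega>" for t \<omega> by (simp add: u_eq)
  have S_ev: "S r \<in> events" for r
  proof -
    have "{\<omega>\<in>space M. \<theta> \<le> u (\<tau> r j) \<omega>} \<in> events" for j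
      using measurable_F_M[OF u_F(1)[OF \<tau>0] \<tau>0] by simp
    then have "(\<Union>j\<in>{..r}. {\<omega>\<in>space M. \<theta> \<le> u (\<tau> r j) \<omega>}) \<in> events" by (intro sets.finite_UN) auto
    also have "(\<Union>j\<in>{..r}. {\<omega>\<in>space M. \<theta> \<le> u (\<tau> r j) \<omega>}) = S r" by (auto simp: S_def)
    finally show ?thesis .
  qed
  have S_prob: "\<theta> * prob (S r) \<le> C * T + K * T * sqrt (T / real r)" if r: "T \<le> real r" "0 < r" for r
  proof -
    have \<Delta>: "\<tau> r (Suc k) - \<tau> r k = T / real r" for k
      unfolding \<tau>_def diff_divide_distrib[symmetric] by (simp add: algebra_simps)
    have \<Delta>0: "0 < T / real r" "T / real r \<le> 1" using r T by auto
    have "\<theta> * prob (S r) \<le> real r * (C * (T / real r) + K * (T / real r) * sqrt (T / real r))"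
      unfolding S_def
    proof (rule discrete_maximal_inequality[OF _ _ \<theta>])
      show "integrable M (u (\<tau> r k))" for k by (rule u_F(2)[OF \<tau>0])
      show "u (\<tau> r 0) \<omega> = 0" for \<omega> by (simp add: u_eq \<tau>_def)
      show "0 \<le> u (\<tau> r k) \<omega>" for k \<omega> by (rule u0)
      fix k assume k: "k < r"
      let ?E = "{\<omega>\<in>space M. \<forall>j\<le>k. u (\<tau> r j) \<omega> < \<theta>}"
      have E: "?E \<in> sets (F (\<tau> r k))"
      proof -
        have "{\<omega>\<in>space M. u (\<tau> r j) \<omega> < \<theta>} \<in> sets (F (\<tau> r k))" if "j \<le> k" for j
        proof -
          have "\<tau> r j \<le> \<tau> r k" unfolding \<tau>_def using that T by (intro divide_right_mono mult_right_mono) auto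
          then have "u (\<tau> r j) \<in> borel_measurable (F (\<tau> r k))" using measurable_F_mono[OF u_F(1)[OF \<tau>0] \<tau>0] by blast
          then have "{\<omega>\<in>space (F (\<tau> r k)). u (\<tau> r j) \<omega> < \<theta>} \<in> sets (F (\<tau> r k))" by simp
          then show ?thesis unfolding space_F[OF \<tau>0] .
        qed
        then have "(\<Inter>j\<in>{..k}. {\<omega>\<in>space M. u (\<tau> r j) \<omega> < \<theta>}) \<in> sets (F (\<tau> r k))" by (intro sets.finite_INT) auto
        also have "(\<Inter>j\<in>{..k}. {\<omega>\<in>space M. u (\<tau> r j) \<omega> < \<theta>}) = ?E" by auto
        finally show ?thesis .
      qed
      have "\<tau> r k < \<tau> r (Suc k)" using \<Delta>[of k] \<Delta>0 by linarith
      moreover have "\<tau> r (Suc k) \<le> T"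
      proof -
        have "real (Suc k) * T \<le> real r * T" using k T by (intro mult_right_mono) auto
        then show ?thesis using r by (simp add: \<tau>_def divide_le_eq mult.commute)
      qed
      ultimately show "expectation (\<lambda>\<omega>. indicator ?E \<omega> * (u (\<tau> r (Suc k)) \<omega> - u (\<tau> r k) \<omega>))
        \<le> C * (T / real r) + K * (T / real r) * sqrt (T / real r)"
        using step[OF \<tau>0 _ _ _ E, of "\<tau> r (Suc k)"] \<Delta>0 unfolding u_def[symmetric] \<Delta> by simp
    qed
    also have "\<dots> = C * T + K * T * sqrt (T / real r)" using r by (simp add: field_simps)
    finally show ?thesis .
  qed
  \<comment> \<open>The lower limit of the events \<open>S r\<close>. By continuity a path that hits
    zero belongs to all \<open>S r\<close> with large \<open>r\<close>, and each of the increasing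
    intersections is bounded by the limit of the bounds for \<open>prob (S r)\<close>, in which the
    term with \<open>K\<close> vanishes.\<close>
  define H where "H = (\<Union>R. \<Inter>r\<in>{R..}. S r)"
  have I_ev: "(\<Inter>r\<in>{R..}. S r) \<in> events" for R using S_ev by (intro sets.countable_INT') auto
  then have H_ev: "H \<in> events" unfolding H_def by (intro sets.countable_UN) auto
  have "prob (\<Inter>r\<in>{R..}. S r) \<le> C * T / \<theta>" for R
  proof (rule LIMSEQ_le_const)
    have "(\<lambda>r. (C * T + K * T * sqrt (T * (1 / real r))) / \<theta>) \<longlonglongrightarrow> (C * T + K * T * sqrt (T * 0)) / \<theta>"
      using \<theta> by (intro tendsto_intros lim_1_over_n) auto
    then show "(\<lambda>r. (C * T + K * T * sqrt (T / real r)) / \<theta>) \<longlonglongrightarrow> C * T / \<theta>" by simp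
    show "\<exists>R'. \<forall>r\<ge>R'. prob (\<Inter>r\<in>{R..}. S r) \<le> (C * T + K * T * sqrt (T / real r)) / \<theta>"
    proof (intro exI allI impI)
      fix r assume r: "max (Suc R) (nat \<lceil>T\<rceil>) \<le> r"
      then have "T \<le> real r" "0 < r" by linarith+
      from S_prob[OF this] have "prob (S r) \<le> (C * T + K * T * sqrt (T / real r)) / \<theta>"
        using \<theta> by (simp add: le_divide_eq mult.commute)
      moreover have "prob (\<Inter>r\<in>{R..}. S r) \<le> prob (S r)"
        using r S_ev by (intro finite_measure_mono) auto
      ultimately show "prob (\<Inter>r\<in>{R..}. S r) \<le> (C * T + K * T * sqrt (T / real r)) / \<theta>" by linarith
    qed
  qed
  moreover have "(\<lambda>R. prob (\<Inter>r\<in>{R..}. S r)) \<longlonglongrightarrow> prob H"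
    unfolding H_def
  proof (rule finite_Lim_measure_incseq)
    show "incseq (\<lambda>R. \<Inter>r\<in>{R..}. S r)" unfolding incseq_def by force
  qed (use I_ev in auto)
  ultimately have "prob H \<le> C * T / \<theta>" by (intro LIMSEQ_le_const2) auto
  also have "\<dots> = 2 * C * T / \<kappa>\<^sup>2 * \<eta> powr p"
    using \<eta> \<kappa> by (simp add: \<theta>_def powr_minus field_simps)
  finally have H_prob: "prob H \<le> 2 * C * T / \<kappa>\<^sup>2 * \<eta> powr p" .
  have "{\<omega>\<in>space M. \<exists>t\<in>{\<kappa>..T}. Z t \<omega> = 0} \<subseteq> H"
  proof
    fix \<omega> assume "\<omega> \<in> {\<omega>\<in>space M. \<exists>t\<in>{\<kappa>..T}. Z t \<omega> = 0}"
    then obtain t where \<omega>: "\<omega> \<in> space M" and t: "\<kappa> \<le> t" "t \<le> T" "Z t \<omega> = 0" by auto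
    have t0: "0 \<le> t" using t \<kappa> by linarith
    have "u t \<omega> \<ge> 2 * \<theta>" unfolding u_eq \<theta>_def t(3) using t(1) \<kappa> by (auto intro!: mult_right_mono power_mono)
    then have gt: "\<theta> < u t \<omega>" using \<theta> by linarith
    have "continuous_on {0..} (\<lambda>t. u t \<omega>)"
    proof -
      have "\<eta> + Z s \<omega> \<noteq> 0" for s using spread_nonneg[of A "\<lambda>i. X i s \<omega>"] \<eta> by linarith
      then show ?thesis unfolding u_eq
        by (intro continuous_on_mult continuous_on_powr continuous_on_add continuous_on_const continuous_on_power
            continuous_on_id continuous_on_spread X_continuous \<omega>) auto
    qed
    then have "((\<lambda>t. u t \<omega>) \<longlongrightarrow> u t \<omega>) (at t within {0..})"
      using t0 by (auto simp: continuous_on_def)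
    from order_tendstoD(1)[OF this gt] obtain \<rho> where \<rho>: "0 < \<rho>"
      "\<And>s. 0 \<le> s \<Longrightarrow> s \<noteq> t \<Longrightarrow> dist s t < \<rho> \<Longrightarrow> \<theta> < u s \<omega>"
      unfolding eventually_at by auto
    have S_in: "\<omega> \<in> S r" if r: "T / \<rho> < real r" "0 < r" for r
    proof -
      \<comment> \<open>The last grid point not after \<open>t\<close>; its distance to
        \<open>t\<close> is less than the mesh.\<close>
      define k where "k = nat \<lfloor>t * real r / T\<rfloor>"
      have q0: "0 \<le> t * real r / T" using t0 T by simp
      have k: "real k \<le> t * real r / T" "t * real r / T < real k + 1"
        unfolding k_def using q0 by linarith+
      have "t * real r / T \<le> real r" using t T r by (simp add: divide_le_eq mult_mono mult.commute)
      then have "k \<le> r" using k(1) by linarith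
      have "\<tau> r k \<le> t" using k(1) T r by (simp add: \<tau>_def divide_le_eq le_divide_eq mult_ac)
      moreover have "t < \<tau> r k + T / real r"
        using k(2) T r by (simp add: \<tau>_def divide_less_eq field_simps)
      moreover have "T / real r < \<rho>" using r \<rho>(1) by (simp add: divide_less_eq mult.commute)
      ultimately have "dist (\<tau> r k) t < \<rho>" by (simp add: dist_real_def)
      then have "\<theta> < u (\<tau> r k) \<omega>" using \<rho>(2)[OF \<tau>0[of r k]] gt by (cases "\<tau> r k = t") auto
      then show ?thesis unfolding S_def using \<omega> \<open>k \<le> r\<close> less_imp_le by blast
    qed
    have "\<omega> \<in> S r" if "r \<in> {Suc (nat \<lceil>T / \<rho>\<rceil>)..}" for r
    proof (rule S_in)
      show "T / \<rho> < real r" using that by simp linarith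
      show "0 < r" using that by simp
    qed
    then show "\<omega> \<in> H" unfolding H_def by blast
  qed
  then show ?thesis using H_ev H_prob by blast
qed

text \<open>On a window \<open>[\<kappa>, T]\<close> the covering events have probability of order
  \<open>\<eta>^p\<close>, so intersecting them over \<open>\<eta> = 1 / Suc j\<close> leaves a null
  event. Both ends of the window are removed by a countable union.\<close>

lemma no_common_value:
  "{\<omega>\<in>space M. \<exists>t>0. \<forall>i\<in>A. \<forall>j\<in>A. X i t \<omega> = X j t \<omega>} \<in> null_sets M"
proof -
  have "\<exists>B\<in>null_sets M. {\<omega>\<in>space M. \<exists>t\<in>{\<kappa>..T}. Z t \<omega> = 0} \<subseteq> B" if T: "0 < T" and \<kappa>: "0 < \<kappa>" for T \<kappa>
  proof -
    obtain C p where C: "0 \<le> C" and p: "0 < p" and step: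
      "\<And>\<eta>. 0 < \<eta> \<Longrightarrow> \<exists>K\<ge>0. \<forall>s t E. 0 \<le> s \<and> s < t \<and> t \<le> T \<and> t - s \<le> 1 \<and> E \<in> sets (F s) \<longrightarrow>
      expectation (\<lambda>\<omega>. indicator E \<omega> * (lyapunov \<eta> p t \<omega> - lyapunov \<eta> p s \<omega>))
      \<le> C * (t - s) + K * (t - s) * sqrt (t - s)"
      using step_bound[OF T] by blast
    have "\<forall>j. \<exists>H. H \<in> events \<and> {\<omega>\<in>space M. \<exists>t\<in>{\<kappa>..T}. Z t \<omega> = 0} \<subseteq> H \<and>
      prob H \<le> 2 * C * T / \<kappa>\<^sup>2 * (1 / real (Suc j)) powr p"
    proof
      fix j :: nat
      have pos: "0 < 1 / real (Suc j)" by simp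
      obtain K where "0 \<le> K" and K: "\<forall>s t E. 0 \<le> s \<and> s < t \<and> t \<le> T \<and> t - s \<le> 1 \<and> E \<in> sets (F s) \<longrightarrow>
        expectation (\<lambda>\<omega>. indicator E \<omega> * (lyapunov (1 / real (Suc j)) p t \<omega> - lyapunov (1 / real (Suc j)) p s \<omega>))
        \<le> C * (t - s) + K * (t - s) * sqrt (t - s)"
        using step[OF pos] by blast
      have "\<exists>H\<in>events. {\<omega>\<in>space M. \<exists>t\<in>{\<kappa>..T}. Z t \<omega> = 0} \<subseteq> H \<and>
        prob H \<le> 2 * C * T / \<kappa>\<^sup>2 * (1 / real (Suc j)) powr p"
        by (rule hit_bound[OF T C p pos \<kappa> \<open>0 \<le> K\<close> K[rule_format]]) simp
      then show "\<exists>H. H \<in> events \<and> {\<omega>\<in>space M. \<exists>t\<in>{\<kappa>..T}. Z t \<omega> = 0} \<subseteq> H \<and>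
        prob H \<le> 2 * C * T / \<kappa>\<^sup>2 * (1 / real (Suc j)) powr p"
        by (simp only: Bex_def)
    qed
    from choice[OF this] obtain H where H: "\<And>j. H j \<in> events"
      "\<And>j. {\<omega>\<in>space M. \<exists>t\<in>{\<kappa>..T}. Z t \<omega> = 0} \<subseteq> H j"
      "\<And>j. prob (H j) \<le> 2 * C * T / \<kappa>\<^sup>2 * (1 / real (Suc j)) powr p"
      by auto
    have ev: "(\<Inter>j. H j) \<in> events" using H(1) by (intro sets.countable_INT) auto
    have "prob (\<Inter>j. H j) \<le> 0"
    proof (rule LIMSEQ_le_const)
      have "(\<lambda>j. 1 / real (Suc j)) \<longlonglongrightarrow> 0" using LIMSEQ_inverse_real_of_nat by (simp add: inverse_eq_divide)
      then have "(\<lambda>j. (1 / real (Suc j)) powr p) \<longlonglongrightarrow> 0"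
        using tendsto_powr2[of "\<lambda>j. 1 / real (Suc j)" 0 sequentially "\<lambda>_. p" p] p by simp
      from tendsto_mult_left[OF this, of "2 * C * T / \<kappa>\<^sup>2"]
      show "(\<lambda>j. 2 * C * T / \<kappa>\<^sup>2 * (1 / real (Suc j)) powr p) \<longlonglongrightarrow> 0" by simp
      have "prob (\<Inter>j. H j) \<le> prob (H j)" for j using H(1) by (intro finite_measure_mono) auto
      then show "\<exists>N. \<forall>j\<ge>N. prob (\<Inter>j. H j) \<le> 2 * C * T / \<kappa>\<^sup>2 * (1 / real (Suc j)) powr p"
        using H(3) order_trans by blast
    qed
    then have "prob (\<Inter>j. H j) = 0" using measure_nonneg[of M "\<Inter>j. H j"] by linarith
    then have "(\<Inter>j. H j) \<in> null_sets M" using ev by (simp add: null_sets_def emeasure_eq_measure)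
    moreover have "{\<omega>\<in>space M. \<exists>t\<in>{\<kappa>..T}. Z t \<omega> = 0} \<subseteq> (\<Inter>j. H j)" using H(2) by blast
    ultimately show ?thesis by blast
  qed
  \<comment> \<open>The windows from \<open>1 / Suc q\<close> to \<open>Suc q\<close> exhaust the
    positive times.\<close>
  then have "\<forall>q. \<exists>B. B \<in> null_sets M \<and> {\<omega>\<in>space M. \<exists>t\<in>{1 / real (Suc q)..real (Suc q)}. Z t \<omega> = 0} \<subseteq> B"
    unfolding Bex_def by simp
  from choice[OF this] obtain B where B: "\<And>q. B q \<in> null_sets M"
    "\<And>q. {\<omega>\<in>space M. \<exists>t\<in>{1 / real (Suc q)..real (Suc q)}. Z t \<omega> = 0} \<subseteq> B q"
    by auto
  have null: "(\<Union>q. B q) \<in> null_sets M" using B(1) by (rule null_sets_UN)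
  have sub: "{\<omega>\<in>space M. \<exists>t>0. \<forall>i\<in>A. \<forall>j\<in>A. X i t \<omega> = X j t \<omega>} \<subseteq> (\<Union>q. B q)"
  proof
    fix \<omega> assume "\<omega> \<in> {\<omega>\<in>space M. \<exists>t>0. \<forall>i\<in>A. \<forall>j\<in>A. X i t \<omega> = X j t \<omega>}"
    then obtain t where \<omega>: "\<omega> \<in> space M" and t: "0 < t" and eq: "\<forall>i\<in>A. \<forall>j\<in>A. X i t \<omega> = X j t \<omega>" by blast
    have Z0: "Z t \<omega> = 0" by (rule spread_eq_0[OF _ A(1)]) (use eq in blast)
    obtain q where q: "max t (1 / t) < real q" using reals_Archimedean2 by blast
    then have "1 / t \<le> real (Suc q)" "t \<le> real (Suc q)" by auto
    then have "t \<in> {1 / real (Suc q)..real (Suc q)}" using t by (simp add: field_simps)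
    then show "\<omega> \<in> (\<Union>q. B q)" using B(2)[of q] \<omega> Z0 by blast
  qed
  \<comment> \<open>Uncountably many times are involved, so measurability is drawn from the usual
    conditions: every subset of a null event belongs to \<open>F 0\<close>.\<close>
  have "{\<omega>\<in>space M. \<exists>t>0. \<forall>i\<in>A. \<forall>j\<in>A. X i t \<omega> = X j t \<omega>} \<in> sets (F 0)"
    by (rule filtration(3)[rule_format, OF null sub])
  then have "{\<omega>\<in>space M. \<exists>t>0. \<forall>i\<in>A. \<forall>j\<in>A. X i t \<omega> = X j t \<omega>} \<in> events" using sets_F[of 0] by auto
  then show ?thesis by (rule null_sets_subset[OF null _ sub])
qed

end

section \<open>Competing Brownian particles\<close>

lemma ranking_permutes: "ranking N x permutes {1..N}"
  using is_ranking_ranking[of N x] by (simp add: is_ranking_def)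

lemma ranking_eq_iff: "ranking N x = p \<longleftrightarrow> is_ranking N x p"
  using is_ranking_ranking[of N x] ex1_is_ranking[of N x] by blast

lemma is_ranking_cong:
  assumes "\<And>a. a \<in> {1..N} \<Longrightarrow> x a = y a"
  shows "is_ranking N x p \<longleftrightarrow> is_ranking N y p"
proof (cases "p permutes {1..N}")
  case True
  then have "x (p i) = y (p i)" if "1 \<le> i" "i \<le> N" for i
    using assms permutes_in_image[OF True, of i] that by simp
  then show ?thesis unfolding is_ranking_def by (smt (verit) less_imp_le_nat order_trans)
qed (simp add: is_ranking_def)

text \<open>A particle has exactly one rank, so the sum selects a single coefficient. All bounds on
  the coefficients by rank thereby become bounds on those of each particle.\<close>

lemma ranking_sum:
  fixes c :: "nat \<Rightarrow> real"
  assumes "i \<in> {1..N}"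
  obtains k where "k \<in> {1..N}" "(\<Sum>k=1..N. of_bool (ranking N x k = i) * c k) = c k"
proof -
  note p = ranking_permutes[of N x]
  obtain k where k: "k \<in> {1..N}" "ranking N x k = i"
    using permutes_image[OF p] assms by (metis imageE)
  have "(\<Sum>j=1..N. of_bool (ranking N x j = i) * c j) = (\<Sum>j=1..N. if j = k then c k else 0)"
    using k(2) permutes_inj[OF p] by (intro sum.cong) (auto dest: injD)
  also have "\<dots> = c k" using k(1) by simp
  finally show ?thesis using that k(1) by blast
qed

text \<open>There are finitely many permutations, and being the ranking is a finite system of
  comparisons. This makes the drift integrand measurable along a path.\<close>

lemma borel_measurable_ranking_sum:
  fixes x :: "nat \<Rightarrow> real \<Rightarrow> real" and c :: "nat \<Rightarrow> real"
  assumes x: "\<And>a. a \<in> {1..N} \<Longrightarrow> x a \<in> borel_measurable borel"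
  shows "(\<lambda>s. \<Sum>k=1..N. of_bool (ranking N (\<lambda>a. x a s) k = i) * c k) \<in> borel_measurable borel"
proof -
  \<comment> \<open>Components outside \<open>{1..N}\<close> may fail to be measurable; setting them
    to 0 does not change the ranking.\<close>
  define y where "y a s = (if a \<in> {1..N} then x a s else 0)" for a s
  have y[measurable]: "y a \<in> borel_measurable borel" for a
    using x by (cases "a \<in> {1..N}") (auto simp: y_def[abs_def])
  have rank: "{s. is_ranking N (\<lambda>a. x a s) p} \<in> sets borel" for p
  proof (cases "p permutes {1..N}")
    case True
    have "is_ranking N (\<lambda>a. x a s) p \<longleftrightarrow>
      (\<forall>i\<in>{1..N}. \<forall>j\<in>{1..N}. i < j \<longrightarrow> y (p i) s \<le> y (p j) s \<and> (y (p i) s = y (p j) s \<longrightarrow> p i < p j))" for s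
    proof -
      have "is_ranking N (\<lambda>a. x a s) p \<longleftrightarrow> is_ranking N (\<lambda>a. y a s) p"
        by (rule is_ranking_cong) (simp add: y_def)
      then show ?thesis using True unfolding is_ranking_def by fastforce
    qed
    then show ?thesis by simp
  qed (simp add: is_ranking_def)
  have ev: "{s. ranking N (\<lambda>a. x a s) k = i} \<in> sets borel" for k
  proof -
    have "finite {p. p permutes {1..N} \<and> p k = i}"
      by (rule finite_subset[OF _ finite_permutations[of "{1..N}"]]) auto
    then have "(\<Union>p\<in>{p. p permutes {1..N} \<and> p k = i}. {s. is_ranking N (\<lambda>a. x a s) p}) \<in> sets borel"
      using rank by (intro sets.finite_UN) auto
    also have "(\<Union>p\<in>{p. p permutes {1..N} \<and> p k = i}. {s. is_ranking N (\<lambda>a. x a s) p})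
      = {s. ranking N (\<lambda>a. x a s) k = i}"
      unfolding ranking_eq_iff[symmetric] using ranking_permutes[of N] by blast
    finally show ?thesis .
  qed
  have "(\<lambda>s. of_bool (ranking N (\<lambda>a. x a s) k = i) :: real) \<in> borel_measurable borel" for k
  proof -
    have "(\<lambda>s. of_bool (ranking N (\<lambda>a. x a s) k = i) :: real) = indicator {s. ranking N (\<lambda>a. x a s) k = i}"
      by (auto simp: indicator_def)
    then show ?thesis using borel_measurable_indicator[OF ev] by simp
  qed
  then show ?thesis by (intro borel_measurable_sum borel_measurable_times) auto
qed

text \<open>Integrability comes before the splitting of the domain, since the set integral of a
  non-integrable function is 0 by default. As \<open>f\<close> is controlled at nonnegative times
  only, measurability is asked of its extension through \<open>max 0\<close>.\<close>

lemma set_integral_increment_bound: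
  fixes f :: "real \<Rightarrow> real"
  assumes f: "(\<lambda>s. f (max 0 s)) \<in> borel_measurable borel" and G: "\<And>s. 0 \<le> s \<Longrightarrow> \<bar>f s\<bar> \<le> G" and rt: "0 \<le> r" "r \<le> t"
  shows "\<bar>(LINT s:{0..t}|lborel. f s) - (LINT s:{0..r}|lborel. f s)\<bar> \<le> G * (t - r)"
proof -
  have si: "set_integrable lborel B f" if "B \<subseteq> {0..t}" "B \<in> sets borel" for B
  proof -
    have "emeasure lborel B \<le> emeasure lborel {0..t}" using that by (intro emeasure_mono) auto
    also have "\<dots> < \<infinity>" using rt by simp
    finally have fin: "emeasure lborel B < \<infinity>" .
    have "integrable lborel (\<lambda>s. indicator B s *\<^sub>R f (max 0 s))"
      using f fin that G by (intro integrableI_bounded_set_indicator[where B = G]) (auto intro!: AE_I2)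
    also have "(\<lambda>s. indicator B s *\<^sub>R f (max 0 s)) = (\<lambda>s. indicator B s *\<^sub>R f s)"
      using that by (auto simp: indicator_def fun_eq_iff max_def)
    finally show ?thesis unfolding set_integrable_def .
  qed
  have dj: "{0..r} \<inter> {r<..t} = {}" by auto
  have un: "{0..t} = {0..r} \<union> {r<..t}" using rt by auto
  have s1: "set_integrable lborel {0..r} f" and s2: "set_integrable lborel {r<..t} f"
    by (rule si; use rt in force)+
  have "(LINT s:{0..t}|lborel. f s) - (LINT s:{0..r}|lborel. f s) = (LINT s:{r<..t}|lborel. f s)"
    unfolding un using set_integral_Un[OF dj s1 s2] by simp
  also have "\<bar>\<dots>\<bar> \<le> (LINT s|lborel. G * indicator {r<..t} s)"
    unfolding set_lebesgue_integral_def
  proof (rule integral_abs_bound_integral)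
    show "integrable lborel (\<lambda>s. indicator {r<..t} s *\<^sub>R f s)"
      using s2 unfolding set_integrable_def .
    show "integrable lborel (\<lambda>s. G * indicator {r<..t} s)" using rt by simp
    fix s show "\<bar>indicator {r<..t} s *\<^sub>R f s\<bar> \<le> G * indicator {r<..t} s"
      using G[of s] rt by (auto simp: indicator_def)
  qed
  also have "\<dots> = G * (t - r)" using rt by simp
  finally show ?thesis .
qed

theorem theorem1p1:
  fixes M :: "'a measure" and F :: "real \<Rightarrow> 'a measure"
    and N n :: nat and g \<sigma> :: "nat \<Rightarrow> real"
    and W X :: "nat \<Rightarrow> real \<Rightarrow> 'a \<Rightarrow> real"
  assumes "N \<ge> 1"
    and "\<And>k. k \<in> {1..N} \<Longrightarrow> (\<sigma> k)\<^sup>2 > 0"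
    and "competing_brownian_particles M F N g \<sigma> W X"
    and "n \<ge> 4"
    and "Max ((\<lambda>k. (\<sigma> k)\<^sup>2) ` {1..N}) < (real n - 1) / 2 * Min ((\<lambda>k. (\<sigma> k)\<^sup>2) ` {1..N})"
  shows "no_tuple_collisions M N X n"
proof -
  note cbp = assms(3)[unfolded competing_brownian_particles_def]
  interpret brownian_filtration M F N W
    by (rule brownian_filtration.intro[OF conjunct1[OF cbp] conjunct1[OF conjunct2[OF cbp]]])
  define H where "H i s \<omega> = (\<Sum>k=1..N. of_bool (rank_at N X s \<omega> k = i) * \<sigma> k)" for i s \<omega>
  define f where "f i \<omega> s = (\<Sum>k=1..N. of_bool (rank_at N X s \<omega> k = i) * g k)" for i \<omega> s
  have X: "\<forall>i\<in>{1..N}. continuous_adapted M F (X i)"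
    by (rule conjunct1[OF conjunct2[OF conjunct2[OF cbp]]])
  have "\<forall>i\<in>{1..N}. \<exists>I. ito_integral M F (W i) (H i) I \<and>
      (AE \<omega> in M. \<forall>t\<ge>0. X i t \<omega> = X i 0 \<omega> + (LINT s:{0..t}|lborel. f i \<omega> s) + I t \<omega>)"
    unfolding H_def f_def by (rule conjunct2[OF conjunct2[OF conjunct2[OF cbp]]])
  from bchoice[OF this] obtain I where ito: "\<And>i. i \<in> {1..N} \<Longrightarrow> ito_integral M F (W i) (H i) (I i)"
    and sde: "\<And>i. i \<in> {1..N} \<Longrightarrow>
      AE \<omega> in M. \<forall>t\<ge>0. X i t \<omega> = X i 0 \<omega> + (LINT s:{0..t}|lborel. f i \<omega> s) + I i t \<omega>"
    by blast
  have X_meas: "X i t \<in> borel_measurable (F t)" if "i \<in> {1..N}" "0 \<le> t" for i t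
    using X that unfolding continuous_adapted_def by blast
  have X_cont: "continuous_on {0..} (\<lambda>t. X i t \<omega>)" if "i \<in> {1..N}" "\<omega> \<in> space M" for i \<omega>
    using X that unfolding continuous_adapted_def by blast
  define a where "a = Min ((\<lambda>k. (\<sigma> k)\<^sup>2) ` {1..N})"
  define b where "b = Max ((\<lambda>k. (\<sigma> k)\<^sup>2) ` {1..N})"
  define G where "G = (\<Sum>k=1..N. \<bar>g k\<bar>)"
  have ab: "a \<le> (\<sigma> k)\<^sup>2" "(\<sigma> k)\<^sup>2 \<le> b" if "k \<in> {1..N}" for k
    using that by (auto simp: a_def b_def)
  have "a \<in> (\<lambda>k. (\<sigma> k)\<^sup>2) ` {1..N}" unfolding a_def using assms(1) by (intro Min_in) auto
  then have a0: "0 < a" using assms(2) by blast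
  have "a \<le> b" using ab[of 1] assms(1) by simp
  with a0 have b0: "0 < b" by simp
  have S: "(sqrt b)\<^sup>2 = b" "(sqrt b) ^ 4 = b\<^sup>2" "0 \<le> sqrt b"
  proof -
    show s2: "(sqrt b)\<^sup>2 = b" "0 \<le> sqrt b" using b0 by auto
    have "(sqrt b) ^ 4 = ((sqrt b)\<^sup>2)\<^sup>2" by simp
    then show "(sqrt b) ^ 4 = b\<^sup>2" using s2(1) by simp
  qed
  \<comment> \<open>The integrand equals some \<open>\<sigma> k\<close>, whose sign is unrestricted,
    so the upper bound concerns its absolute value.\<close>
  have H: "\<bar>H i s \<omega>\<bar> \<le> sqrt b" "a \<le> (H i s \<omega>)\<^sup>2" if i: "i \<in> {1..N}" for i s \<omega>
  proof -
    obtain k where k: "k \<in> {1..N}" "H i s \<omega> = \<sigma> k"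
      unfolding H_def rank_at_def by (rule ranking_sum[OF i])
    show "\<bar>H i s \<omega>\<bar> \<le> sqrt b" unfolding k(2) using ab(2)[OF k(1)] by (intro real_le_rsqrt) simp
    show "a \<le> (H i s \<omega>)\<^sup>2" unfolding k(2) by (rule ab(1)[OF k(1)])
  qed
  have f_bound: "\<bar>f i \<omega> s\<bar> \<le> G" if i: "i \<in> {1..N}" for i s \<omega>
  proof -
    obtain k where k: "k \<in> {1..N}" "f i \<omega> s = g k"
      unfolding f_def rank_at_def by (rule ranking_sum[OF i])
    show ?thesis unfolding k(2) G_def using k(1) by (intro member_le_sum) auto
  qed
  have f_meas: "(\<lambda>s. f i \<omega> (max 0 s)) \<in> borel_measurable borel" if \<omega>: "\<omega> \<in> space M" for i \<omega>
    unfolding f_def rank_at_def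
  proof (rule borel_measurable_ranking_sum)
    fix j assume j: "j \<in> {1..N}"
    \<comment> \<open>Paths are continuous on \<open>[0, \<infinity>)\<close> only; freezing them at
      time 0 extends them to the line.\<close>
    have "continuous_on UNIV (\<lambda>s. X j (max 0 s) \<omega>)"
      by (rule continuous_on_compose2[OF X_cont[OF j \<omega>]]) (auto intro!: continuous_intros)
    then show "(\<lambda>s. X j (max 0 s) \<omega>) \<in> borel_measurable borel"
      by (rule borel_measurable_continuous_onI)
  qed
  \<comment> \<open>The initial value cancels in the increment. One null set serves all pairs of
    times because the integrated equation holds for all \<open>t\<close> simultaneously.\<close>
  have drift: "AE \<omega> in M. \<forall>s t. 0 \<le> s \<and> s \<le> t \<longrightarrow> \<bar>X i t \<omega> - X i s \<omega> - (I i t \<omega> - I i s \<omega>)\<bar> \<le> G * (t - s)"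
    if i: "i \<in> {1..N}" for i
    using sde[OF i] AE_space
  proof eventually_elim
    case (elim \<omega>)
    show ?case
    proof (intro allI impI)
      fix s t :: real assume st: "0 \<le> s \<and> s \<le> t"
      have "X i t \<omega> - X i s \<omega> - (I i t \<omega> - I i s \<omega>)
        = (LINT s:{0..t}|lborel. f i \<omega> s) - (LINT s:{0..s}|lborel. f i \<omega> s)"
        using elim(1)[rule_format, of t] elim(1)[rule_format, of s] st by simp
      then show "\<bar>X i t \<omega> - X i s \<omega> - (I i t \<omega> - I i s \<omega>)\<bar> \<le> G * (t - s)"
        using set_integral_increment_bound[OF f_meas[OF elim(2)] f_bound[OF i]] st by simp
    qed
  qed
  have null: "{\<omega>\<in>space M. \<exists>t>0. \<forall>i\<in>A. \<forall>j\<in>A. X i t \<omega> = X j t \<omega>} \<in> null_sets M"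
    if A: "A \<subseteq> {1..N}" "card A = n" for A
  proof -
    have iN: "i \<in> {1..N}" if "i \<in> A" for i using A(1) that by blast
    have "bounded_diffusion M F N W A X I G a b"
    proof
      show "finite A" "A \<noteq> {}" using A assms(4) finite_subset by auto
      show "X i t \<in> borel_measurable (F t)" if "i \<in> A" "0 \<le> t" for i t using X_meas iN that by blast
      show "continuous_on {0..} (\<lambda>t. X i t \<omega>)" if "i \<in> A" "\<omega> \<in> space M" for i \<omega> using X_cont iN that by blast
      show "AE \<omega> in M. \<forall>s t. 0 \<le> s \<and> s \<le> t \<longrightarrow> \<bar>X i t \<omega> - X i s \<omega> - (I i t \<omega> - I i s \<omega>)\<bar> \<le> G * (t - s)"
        if "i \<in> A" for i using drift iN that by blast
      show "0 < b" by (rule b0)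
      show "2 * b < (real (card A) - 1) * a"
        using assms(5) unfolding a_def[symmetric] b_def[symmetric] A(2) by simp
    next
      fix i t assume i: "i \<in> A"
      \<comment> \<open>The moment results are used with \<open>L = a\<close> and
        \<open>S = sqrt b\<close>; the powers of \<open>S\<close> are rewritten to \<open>b\<close>
        and \<open>b^2\<close>.\<close>
      note ctx = iN[OF i] ito[OF iN[OF i]] S(3) less_imp_le[OF a0] H[OF iN[OF i]]
      show "I i t \<in> borel_measurable (F t)" if "0 \<le> t"
        by (rule ito_measurable[OF ctx that])
      show "integrable M (\<lambda>\<omega>. (I i t \<omega> - I i s \<omega>) ^ k)" if "0 \<le> s" "s < t" "k \<le> 4" for s k
        by (rule ito_increment_power(1)[OF ctx that])
      show "expectation (\<lambda>\<omega>. (I i t \<omega> - I i s \<omega>) ^ 4) \<le> 3 * b\<^sup>2 * (t - s)\<^sup>2" if "0 \<le> s" "s < t" for s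
        using ito_fourth_moment[OF ctx that order_refl] unfolding S(2) .
      fix s Y assume st: "0 \<le> s" "s < t" and Y: "bounded_F s Y"
      show "expectation (\<lambda>\<omega>. Y \<omega> * (I i t \<omega> - I i s \<omega>)) = 0"
        by (rule ito_martingale[OF ctx st Y])
      show "expectation (\<lambda>\<omega>. Y \<omega> * ((I i t \<omega> - I i s \<omega>) * (I j t \<omega> - I j s \<omega>))) = 0" if "j \<in> A" "i \<noteq> j" for j
        by (rule ito_cross[OF ctx(1,2) H(1)[OF iN[OF i]] iN[OF that(1)] ito[OF iN[OF that(1)]] H(1)[OF iN[OF that(1)]]
              that(2) S(3) st Y])
      assume Y0: "\<And>\<omega>. \<omega> \<in> space M \<Longrightarrow> 0 \<le> Y \<omega>"
      show "a * (t - s) * expectation Y \<le> expectation (\<lambda>\<omega>. Y \<omega> * (I i t \<omega> - I i s \<omega>)\<^sup>2)"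
        by (rule ito_second_moment_lower[OF ctx st Y Y0])
      show "expectation (\<lambda>\<omega>. Y \<omega> * (I i t \<omega> - I i s \<omega>)\<^sup>2) \<le> b * (t - s) * expectation Y"
        using ito_second_moment_upper[OF ctx st Y Y0] unfolding S(1) .
    qed
    then show ?thesis by (rule bounded_diffusion.no_common_value)
  qed
  \<comment> \<open>Which particles occupy the colliding ranks depends on the time and on the path,
    but there are only finitely many candidate sets of \<open>n\<close> labels, so covering by all
    of them costs nothing.\<close>
  have union: "(\<Union>A\<in>{A. A \<subseteq> {1..N} \<and> card A = n}. {\<omega>\<in>space M. \<exists>t>0. \<forall>i\<in>A. \<forall>j\<in>A. X i t \<omega> = X j t \<omega>}) \<in> null_sets M"
  proof (rule null_sets_UN'[OF countable_finite])
    show "finite {A. A \<subseteq> {1..N} \<and> card A = n}" by (rule finite_subset[of _ "Pow {1..N}"]) auto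
  qed (use null in blast)
  show ?thesis
    unfolding no_tuple_collisions_def no_collisions_of_ranks_def
  proof (intro ballI impI)
    fix k l assume kl: "k \<in> {1..N}" "l \<in> {1..N}" "k < l \<and> l - k = n - 1"
    let ?B = "{\<omega>\<in>space M. \<exists>t>0. \<forall>j\<in>{k..l}. ranked_particle N X j t \<omega> = ranked_particle N X k t \<omega>}"
    have sub: "?B \<subseteq> (\<Union>A\<in>{A. A \<subseteq> {1..N} \<and> card A = n}. {\<omega>\<in>space M. \<exists>t>0. \<forall>i\<in>A. \<forall>j\<in>A. X i t \<omega> = X j t \<omega>})"
    proof
      fix \<omega> assume "\<omega> \<in> ?B"
      then obtain t where \<omega>: "\<omega> \<in> space M" and t: "0 < t"
        and eq: "\<And>j. j \<in> {k..l} \<Longrightarrow> X (rank_at N X t \<omega> j) t \<omega> = X (rank_at N X t \<omega> k) t \<omega>"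
        unfolding ranked_particle_def by blast
      have p: "rank_at N X t \<omega> permutes {1..N}" unfolding rank_at_def by (rule ranking_permutes)
      let ?A = "rank_at N X t \<omega> ` {k..l}"
      have "?A \<subseteq> {1..N}" using kl permutes_in_image[OF p] by fastforce
      \<comment> \<open>The ranks from \<open>k\<close> to \<open>l\<close> number
        \<open>l - k + 1 = n\<close>, and distinct ranks belong to distinct particles.\<close>
      moreover have "card ?A = n"
        using card_image[OF inj_on_subset[OF permutes_inj[OF p] subset_UNIV], of "{k..l}"] kl assms(4) by (simp; linarith)
      moreover have "\<forall>i\<in>?A. \<forall>j\<in>?A. X i t \<omega> = X j t \<omega>"
      proof (intro ballI)
        fix i j assume "i \<in> ?A" "j \<in> ?A"
        then obtain i' j' where "i = rank_at N X t \<omega> i'" "i' \<in> {k..l}" "j = rank_at N X t \<omega> j'" "j' \<in> {k..l}"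
          by blast
        then show "X i t \<omega> = X j t \<omega>" using eq[of i'] eq[of j'] by metis
      qed
      ultimately show "\<omega> \<in> (\<Union>A\<in>{A. A \<subseteq> {1..N} \<and> card A = n}. {\<omega>\<in>space M. \<exists>t>0. \<forall>i\<in>A. \<forall>j\<in>A. X i t \<omega> = X j t \<omega>})"
        using \<omega> t by blast
    qed
    have "?B \<in> sets (F 0)" by (rule filtration(3)[rule_format, OF union sub])
    then have "?B \<in> events" using sets_F[of 0] by auto
    then show "?B \<in> null_sets M" by (rule null_sets_subset[OF union _ sub])
  qed
qed

end
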